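(* Let $n\geq 3$ be an odd integer. Then there exist a monic polynomial $P\in\mathbb{Z}[X]$ of degree $n$ and a nonzero polynomial $Q\in\mathbb{Z}[X]$ of degree at most $n-1$ such that for every integer $t$, the polynomial $P(X)-tQ(X)$ has Galois group over $\mathbb{Q}$ isomorphic to the alternating group $A_n$.
   Context: The Galois group of a polynomial $f\in\mathbb{Q}[X]$ is the Galois group of its splitting field over $\mathbb{Q}$, viewed as a group of permutations of the roots of $f$ (so a subgroup of $S_n$ when $\deg f=n$). Such a pair $(P,Q)$ is called a line of polynomials of degree $n$ with Galois group $A_n$. *)

theory Defs
  imports
    Complex_Main
    "HOL-Algebra.Bij"
    "HOL-Algebra.Generated_Fields"
    "HOL-Algebra.Sym_Groups"
    "HOL-Algebra.Algebraic_Closure_Type"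
begin

definition complex_roots :: "rat poly \<Rightarrow> complex set" where
  "complex_roots f = {z. poly (map_poly of_rat f) z = 0}"

abbreviation complex_field :: "complex ring" where
  "complex_field \<equiv> ring_of_type_algebra"

definition splitting_field :: "rat poly \<Rightarrow> complex set" where
  "splitting_field f = generate_field complex_field (\<rat> \<union> complex_roots f)"

text \<open>The group \<open>Gal(K/F)\<close> for subfields \<open>F \<subseteq> K\<close> of the complex numbers. Automorphisms are
  extensional functions (\<^const>\<open>undefined\<close> outside \<open>K\<close>), as always in \<^const>\<open>BijGroup\<close>.\<close>

definition field_galois_group :: "complex set \<Rightarrow> complex set \<Rightarrow> (complex \<Rightarrow> complex) monoid" where
  "field_galois_group F K =
     (BijGroup K)\<lparr>carrier :=
        {\<sigma> \<in> Bij K.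
           \<sigma> \<in> ring_hom (complex_field\<lparr>carrier := K\<rparr>) (complex_field\<lparr>carrier := K\<rparr>) \<and>
           (\<forall>x\<in>F. \<sigma> x = x)}\<rparr>"

text \<open>The Galois group of the splitting field over \<open>\<rat>\<close>, acting by permutations on the set of
  roots. Restriction to the roots is injective, because they generate the splitting field.\<close>

definition poly_galois_group :: "rat poly \<Rightarrow> (complex \<Rightarrow> complex) monoid" where
  "poly_galois_group f =
     (BijGroup (complex_roots f))\<lparr>carrier :=
        (\<lambda>\<sigma>. restrict \<sigma> (complex_roots f)) ` carrier (field_galois_group \<rat> (splitting_field f))\<rparr>"

end

theory Submission
  imports Defs "Jordan_Normal_Form.Char_Poly" "HOL-Number_Theory.Cong"
begin

text \<open>
  Put \<open>m = n - 2\<close> and \<open>s = (-1)\<^bsup>(m+1)/2\<^esup>\<close>, and consider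
  \<open>f = X\<^sup>m (X\<^sup>2 + (m+2)\<^sup>2 s m) - t (X\<^sup>2 + (m-2)\<^sup>2 s m)\<close>. Writing \<open>f = P - t Q\<close>, the function \<open>P / Q\<close> has an \<open>m\<close>-fold
  zero at \<open>0\<close> and an \<open>m\<close>-fold pole at infinity, and is otherwise ramified only in two points of index 3:
  \<open>P' Q - P Q' = m X\<^bsup>m-1\<^esup> (X\<^sup>2 + (m\<^sup>2-4) s m)\<^sup>2\<close>. This identity also makes the discriminant a square, so the
  Galois group consists of even permutations for every \<open>t\<close>.

  Now restrict \<open>t\<close> to an arithmetic progression that fixes \<open>t\<close> modulo the squares of three primes. At the
  first one \<open>f\<close> is an Eisenstein polynomial, so the group is transitive. At the second one \<open>f\<close> reduces to
  \<open>X\<^sup>m (X\<^sup>2 + c)\<close> and the inertia group is transitive on \<open>m\<close> roots and fixes the two others; hence the group is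
  primitive. At the third one \<open>f\<close> has a triple root, all other roots are simple, and inertia is generated
  by a 3-cycle. A primitive group that contains a 3-cycle contains the alternating group.
\<close>

section \<open>Algebraic integers\<close>

text \<open>No ramification theory is developed. One principle does its work: if \<open>f r\<close>
  is divisible by \<open>p\<close> exactly once, the roots congruent to \<open>r\<close> modulo a
  maximal ideal \<open>M\<close> above \<open>p\<close> lie in one orbit of any subgroup of
  \<open>G\<close> whose invariant elements of \<open>M\<close> are divisible by \<open>p\<close> up
  to a factor outside \<open>M\<close>; two orbits would make \<open>p^2\<close> divide
  \<open>f r\<close>. Hence the congruences for \<open>t\<close> modulo squares of primes. At the
  first prime the subgroup is all of \<open>G\<close>, where invariants are integers and wild
  ramification does no harm. At the second it is the inertia group, and the prime is taken larger
  than \<open>n!\<close> so that it cannot divide the order of inertia. At the third the principle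
  only excludes trivial inertia; a nontrivial inertia element moves at most three roots, and being
  even it is a 3-cycle.\<close>

definition int_span :: "'i set \<Rightarrow> ('i \<Rightarrow> complex) \<Rightarrow> complex set" where
  "int_span I v = range (\<lambda>c :: 'i \<Rightarrow> int. \<Sum>i\<in>I. of_int (c i) * v i)"

lemma int_spanI: "w = (\<Sum>i\<in>I. of_int (c i) * v i) \<Longrightarrow> w \<in> int_span I v"
  unfolding int_span_def by blast

lemma int_span_base:
  assumes "finite I" "i \<in> I"
  shows "v i \<in> int_span I v"
proof -
  have "(\<Sum>j\<in>I. of_int (if j = i then 1 else 0) * v j) = (\<Sum>j\<in>I. if j = i then v j else 0)"
    by (intro sum.cong) auto
  also have "\<dots> = v i" using assms by simp
  finally show ?thesis by (intro int_spanI[OF sym])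
qed

lemma int_span_add:
  assumes "a \<in> int_span I v" "b \<in> int_span I v"
  shows "a + b \<in> int_span I v"
proof -
  obtain c d :: "_ \<Rightarrow> int" where "a = (\<Sum>i\<in>I. of_int (c i) * v i)" "b = (\<Sum>i\<in>I. of_int (d i) * v i)"
    using assms unfolding int_span_def by auto
  hence "a + b = (\<Sum>i\<in>I. of_int ((\<lambda>i. c i + d i) i) * v i)"
    by (simp add: sum.distrib algebra_simps)
  thus ?thesis by (rule int_spanI)
qed

lemma int_span_of_int_mult:
  assumes "a \<in> int_span I v"
  shows "of_int k * a \<in> int_span I v"
proof -
  obtain c :: "_ \<Rightarrow> int" where "a = (\<Sum>i\<in>I. of_int (c i) * v i)"
    using assms unfolding int_span_def by auto
  hence "of_int k * a = (\<Sum>i\<in>I. of_int ((\<lambda>i. k * c i) i) * v i)"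
    by (simp add: sum_distrib_left algebra_simps)
  thus ?thesis by (rule int_spanI)
qed

lemma int_span_sum:
  assumes "\<And>j. j \<in> J \<Longrightarrow> f j \<in> int_span I v"
  shows "(\<Sum>j\<in>J. f j) \<in> int_span I v"
proof -
  have "0 \<in> int_span I v"
    unfolding int_span_def by (rule range_eqI[of _ _ "\<lambda>_. 0"]) simp
  with assms show ?thesis
    by (induction J rule: infinite_finite_induct) (auto intro: int_span_add)
qed

lemma int_span_stable:
  assumes "\<And>i. i \<in> I \<Longrightarrow> z * v i \<in> int_span I v" "w \<in> int_span I v"
  shows "z * w \<in> int_span I v"
proof -
  obtain c :: "_ \<Rightarrow> int" where "w = (\<Sum>i\<in>I. of_int (c i) * v i)"
    using assms unfolding int_span_def by auto
  hence "z * w = (\<Sum>i\<in>I. of_int (c i) * (z * v i))"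
    by (simp add: sum_distrib_left algebra_simps)
  thus ?thesis using assms(1) by (auto intro!: int_span_sum int_span_of_int_mult)
qed

text \<open>Here \<open>z\<close> is an eigenvalue of an integer matrix, so the characteristic polynomial
  witnesses integrality.\<close>

lemma algebraic_int_if_int_span_stable:
  assumes "finite I" "i0 \<in> I" "v i0 \<noteq> 0"
    and stable: "\<And>i. i \<in> I \<Longrightarrow> z * v i \<in> int_span I v"
  shows "algebraic_int z"
proof -
  define N where "N = card I"
  obtain h where h: "bij_betw h {..<N} I"
    using ex_bij_betw_nat_finite[OF assms(1)] unfolding N_def atLeast0LessThan by blast
  have "\<exists>c :: _ \<Rightarrow> int. z * v i = (\<Sum>j\<in>I. of_int (c j) * v j)" if "i \<in> I" for i
    using stable[OF that] unfolding int_span_def by auto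
  then obtain c :: "_ \<Rightarrow> _ \<Rightarrow> int" where c: "\<And>i. i \<in> I \<Longrightarrow> z * v i = (\<Sum>j\<in>I. of_int (c i j) * v j)"
    by metis
  define A where "A = mat N N (\<lambda>(i, j). c (h i) (h j))"
  define B :: "complex mat" where "B = map_mat of_int A"
  define w where "w = vec N (\<lambda>i. v (h i))"
  have A: "A \<in> carrier_mat N N" and B: "B \<in> carrier_mat N N"
    by (auto simp: A_def B_def)
  have "B *\<^sub>v w = z \<cdot>\<^sub>v w"
  proof (rule eq_vecI)
    fix i assume "i < dim_vec (z \<cdot>\<^sub>v w)"
    hence i: "i < N" by (simp add: w_def)
    hence "h i \<in> I" using h by (auto simp: bij_betw_def)
    have "(B *\<^sub>v w) $ i = (\<Sum>j<N. of_int (c (h i) (h j)) * v (h j))"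
      using i by (simp add: B_def A_def w_def scalar_prod_def atLeast0LessThan)
    also have "\<dots> = (\<Sum>j\<in>I. of_int (c (h i) j) * v j)"
      by (rule sum.reindex_bij_betw[OF h])
    also have "\<dots> = (z \<cdot>\<^sub>v w) $ i"
      using c[OF \<open>h i \<in> I\<close>] i by (simp add: w_def)
    finally show "(B *\<^sub>v w) $ i = (z \<cdot>\<^sub>v w) $ i" .
  qed (simp add: B_def A_def w_def)
  moreover have "w \<noteq> 0\<^sub>v N"
  proof -
    obtain k where k: "k < N" "h k = i0"
      using h assms(2) by (auto simp: bij_betw_def)
    hence "w $ k \<noteq> 0" using assms(3) by (simp add: w_def)
    thus ?thesis using k by auto
  qed
  ultimately have "eigenvalue B z"
    unfolding eigenvalue_def eigenvector_def using B by (auto simp: w_def intro!: exI[of _ w])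
  hence "poly (char_poly B) z = 0"
    using eigenvalue_root_char_poly[OF B] by simp
  moreover have "char_poly B = map_poly of_int (char_poly A)"
    unfolding B_def by (rule of_int_hom.char_poly_hom[OF A])
  moreover have "lead_coeff (char_poly A) = 1"
    using degree_monic_char_poly[OF A] by simp
  ultimately show ?thesis
    unfolding algebraic_int_altdef_ipoly by metis
qed

lemma monic_root_power:
  fixes p :: "int poly"
  assumes "lead_coeff p = 1" "poly (map_poly of_int p) (x :: complex) = 0"
  shows "x ^ degree p = (\<Sum>i<degree p. of_int (- coeff p i) * x ^ i)"
proof -
  have "0 = (\<Sum>i\<le>degree p. of_int (coeff p i) * x ^ i)"
    using assms(2) by (simp add: poly_altdef degree_map_poly coeff_map_poly)
  also have "{..degree p} = insert (degree p) {..<degree p}" by auto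
  finally have "0 = x ^ degree p + (\<Sum>i<degree p. of_int (coeff p i) * x ^ i)"
    using assms(1) by simp
  thus ?thesis by (simp add: sum_negf add_eq_0_iff)
qed

text \<open>The monomials \<open>x ^ i * y ^ j\<close> below the degrees of two monic equations span
  a module stable under both \<open>x\<close> and \<open>y\<close>, hence under \<open>x + y\<close>
  and \<open>x * y\<close>; one module serves both closure properties.\<close>

lemma algebraic_int_common_span:
  assumes "algebraic_int (x :: complex)" "algebraic_int y"
  obtains I :: "(nat \<times> nat) set" and v where "finite I" "\<exists>i\<in>I. v i \<noteq> 0"
    "\<And>w. w \<in> int_span I v \<Longrightarrow> x * w \<in> int_span I v" "\<And>w. w \<in> int_span I v \<Longrightarrow> y * w \<in> int_span I v"
proof -
  obtain p q :: "int poly" where p: "lead_coeff p = 1" "poly (map_poly of_int p) x = 0"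
    and q: "lead_coeff q = 1" "poly (map_poly of_int q) y = 0"
    using assms unfolding algebraic_int_altdef_ipoly by blast
  \<comment> \<open>A monic constant has no root, so both degrees are positive and the monomial 1
    belongs to the family.\<close>
  have deg: "degree f > 0" if "lead_coeff f = 1" "poly (map_poly of_int f) z = 0"
    for f :: "int poly" and z :: complex
  proof (rule ccontr)
    assume "\<not> degree f > 0"
    then obtain a where "f = [:a:]" by (auto elim: degree_eq_zeroE)
    with that show False by (simp add: map_poly_pCons)
  qed
  define I where "I = {..<degree p} \<times> {..<degree q}"
  define v where "v = (\<lambda>(i, j). x ^ i * y ^ j)"
  have fin: "finite I" by (simp add: I_def)
  have base: "x ^ i * y ^ j \<in> int_span I v" if "i < degree p" "j < degree q" for i j
    using int_span_base[OF fin, of "(i, j)" v] that by (simp add: I_def v_def)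
  have x: "x * v k \<in> int_span I v" if "k \<in> I" for k
  proof -
    obtain i j where k: "k = (i, j)" "i < degree p" "j < degree q"
      using \<open>k \<in> I\<close> by (auto simp: I_def)
    show ?thesis
    proof (cases "Suc i < degree p")
      case True
      thus ?thesis using base[of "Suc i" j] k by (simp add: v_def mult_ac)
    next
      case False
      hence "x * v k = x ^ degree p * y ^ j"
        using k by (metis (no_types, lifting) Suc_lessI case_prod_conv mult.assoc power_Suc v_def)
      also have "\<dots> = (\<Sum>i<degree p. of_int (- coeff p i) * (x ^ i * y ^ j))"
        unfolding monic_root_power[OF p] sum_distrib_right by (simp add: mult_ac)
      also have "\<dots> \<in> int_span I v"
        using base k by (intro int_span_sum int_span_of_int_mult) auto
      finally show ?thesis .
    qed
  qed
  have y: "y * v k \<in> int_span I v" if "k \<in> I" for k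
  proof -
    obtain i j where k: "k = (i, j)" "i < degree p" "j < degree q"
      using \<open>k \<in> I\<close> by (auto simp: I_def)
    show ?thesis
    proof (cases "Suc j < degree q")
      case True
      thus ?thesis using base[of i "Suc j"] k by (simp add: v_def mult_ac)
    next
      case False
      hence "degree q = Suc j" using k by simp
      hence "y * v k = y ^ degree q * x ^ i"
        using k by (simp add: v_def mult_ac)
      also have "\<dots> = (\<Sum>j<degree q. of_int (- coeff q j) * (x ^ i * y ^ j))"
        unfolding monic_root_power[OF q] sum_distrib_right by (simp add: mult_ac)
      also have "\<dots> \<in> int_span I v"
        using base k by (intro int_span_sum int_span_of_int_mult) auto
      finally show ?thesis .
    qed
  qed
  have "(0, 0) \<in> I" "v (0, 0) \<noteq> 0"
    using deg[OF p] deg[OF q] by (auto simp: I_def v_def)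
  with fin x y show ?thesis
    using that[of I v] int_span_stable by blast
qed

lemma algebraic_int_add:
  assumes "algebraic_int (x :: complex)" "algebraic_int y"
  shows "algebraic_int (x + y)"
proof (rule algebraic_int_common_span[OF assms])
  fix I :: "(nat \<times> nat) set" and v
  assume *: "finite I" "\<exists>i\<in>I. v i \<noteq> 0"
    "\<And>w. w \<in> int_span I v \<Longrightarrow> x * w \<in> int_span I v" "\<And>w. w \<in> int_span I v \<Longrightarrow> y * w \<in> int_span I v"
  from *(2) obtain i where "i \<in> I" "v i \<noteq> 0" by blast
  show ?thesis
  proof (rule algebraic_int_if_int_span_stable[where I = I and v = v and ?i0.0 = i])
    fix j assume "j \<in> I"
    hence "v j \<in> int_span I v" using int_span_base[OF *(1), of j v] by simp
    thus "(x + y) * v j \<in> int_span I v"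
      unfolding distrib_right by (intro int_span_add *(3,4))
  qed (fact *(1) \<open>i \<in> I\<close> \<open>v i \<noteq> 0\<close>)+
qed

lemma algebraic_int_mult:
  assumes "algebraic_int (x :: complex)" "algebraic_int y"
  shows "algebraic_int (x * y)"
proof (rule algebraic_int_common_span[OF assms])
  fix I :: "(nat \<times> nat) set" and v
  assume *: "finite I" "\<exists>i\<in>I. v i \<noteq> 0"
    "\<And>w. w \<in> int_span I v \<Longrightarrow> x * w \<in> int_span I v" "\<And>w. w \<in> int_span I v \<Longrightarrow> y * w \<in> int_span I v"
  from *(2) obtain i where "i \<in> I" "v i \<noteq> 0" by blast
  show ?thesis
  proof (rule algebraic_int_if_int_span_stable[where I = I and v = v and ?i0.0 = i])
    fix j assume "j \<in> I"
    hence "v j \<in> int_span I v" using int_span_base[OF *(1), of j v] by simp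
    thus "x * y * v j \<in> int_span I v"
      unfolding mult.assoc by (intro *(3,4))
  qed (fact *(1) \<open>i \<in> I\<close> \<open>v i \<noteq> 0\<close>)+
qed

section \<open>Extending homomorphisms of subfields of the complex numbers\<close>

text \<open>A predicate on sets keeps the arithmetic of the type \<open>complex\<close> and its
  simplification rules. Since \<open>inverse 0 = 0\<close>, closure under inverses needs no case
  distinction.\<close>

definition csubfield :: "complex set \<Rightarrow> bool" where
  "csubfield F \<longleftrightarrow> 0 \<in> F \<and> 1 \<in> F \<and> (\<forall>x\<in>F. \<forall>y\<in>F. x + y \<in> F \<and> x * y \<in> F) \<and>
     (\<forall>x\<in>F. - x \<in> F \<and> inverse x \<in> F)"

text \<open>No codomain is fixed and values outside \<open>F\<close> are free, so embeddings into
  the complex numbers, their extensions and their restrictions are all instances. The clause for 1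
  excludes the zero map and forces injectivity.\<close>

definition field_hom_on :: "complex set \<Rightarrow> (complex \<Rightarrow> complex) \<Rightarrow> bool" where
  "field_hom_on F \<phi> \<longleftrightarrow> \<phi> 1 = 1 \<and> (\<forall>x\<in>F. \<forall>y\<in>F. \<phi> (x + y) = \<phi> x + \<phi> y \<and> \<phi> (x * y) = \<phi> x * \<phi> y)"

definition polys_over :: "complex set \<Rightarrow> complex poly set" where
  "polys_over F = {p. \<forall>i. coeff p i \<in> F}"

lemma csubfieldD:
  assumes "csubfield F"
  shows "0 \<in> F" "1 \<in> F" "\<And>x y. x \<in> F \<Longrightarrow> y \<in> F \<Longrightarrow> x + y \<in> F" "\<And>x y. x \<in> F \<Longrightarrow> y \<in> F \<Longrightarrow> x * y \<in> F"
    "\<And>x. x \<in> F \<Longrightarrow> - x \<in> F" "\<And>x. x \<in> F \<Longrightarrow> inverse x \<in> F"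
    "\<And>x y. x \<in> F \<Longrightarrow> y \<in> F \<Longrightarrow> x - y \<in> F" "\<And>x y. x \<in> F \<Longrightarrow> y \<in> F \<Longrightarrow> x / y \<in> F"
  using assms unfolding csubfield_def
  by (auto simp: divide_inverse) (metis diff_conv_add_uminus)

lemma csubfield_sum:
  assumes "csubfield F" "\<And>i. i \<in> I \<Longrightarrow> f i \<in> F"
  shows "sum f I \<in> F"
  using assms(2)
  by (induction I rule: infinite_finite_induct) (auto intro: csubfieldD[OF assms(1)])

lemma csubfield_power:
  assumes "csubfield F" "x \<in> F"
  shows "x ^ k \<in> F"
  by (induction k) (auto intro: csubfieldD[OF assms(1)] assms(2))

lemma csubfield_of_nat: "csubfield F \<Longrightarrow> of_nat k \<in> F"
  by (induction k) (auto intro: csubfieldD)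

lemma csubfield_of_int: "csubfield F \<Longrightarrow> of_int k \<in> F"
  by (cases k) (auto intro: csubfieldD csubfield_of_nat simp del: of_nat_Suc)

lemma Rats_subset_csubfield:
  assumes "csubfield F" shows "\<rat> \<subseteq> F"
  using assms by (auto elim!: Rats_cases' intro!: csubfieldD(8) csubfield_of_int)

lemma csubfield_Rats: "csubfield \<rat>"
  unfolding csubfield_def by auto

lemma polys_over_0: "csubfield F \<Longrightarrow> 0 \<in> polys_over F"
  by (simp add: polys_over_def csubfieldD)

lemma polys_over_add:
  "csubfield F \<Longrightarrow> p \<in> polys_over F \<Longrightarrow> q \<in> polys_over F \<Longrightarrow> p + q \<in> polys_over F"
  by (simp add: polys_over_def csubfieldD)

lemma polys_over_diff:
  "csubfield F \<Longrightarrow> p \<in> polys_over F \<Longrightarrow> q \<in> polys_over F \<Longrightarrow> p - q \<in> polys_over F"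
  by (simp add: polys_over_def csubfieldD)

lemma polys_over_uminus: "csubfield F \<Longrightarrow> p \<in> polys_over F \<Longrightarrow> - p \<in> polys_over F"
  by (simp add: polys_over_def csubfieldD)

lemma polys_over_mult:
  "csubfield F \<Longrightarrow> p \<in> polys_over F \<Longrightarrow> q \<in> polys_over F \<Longrightarrow> p * q \<in> polys_over F"
  by (auto simp: polys_over_def coeff_mult intro!: csubfield_sum csubfieldD(4))

lemma polys_over_smult:
  "csubfield F \<Longrightarrow> c \<in> F \<Longrightarrow> p \<in> polys_over F \<Longrightarrow> smult c p \<in> polys_over F"
  by (simp add: polys_over_def csubfieldD)

lemma polys_over_pCons:
  "csubfield F \<Longrightarrow> c \<in> F \<Longrightarrow> p \<in> polys_over F \<Longrightarrow> pCons c p \<in> polys_over F"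
  by (simp add: polys_over_def coeff_pCons split: nat.splits)

lemma polys_over_pderiv:
  "csubfield F \<Longrightarrow> p \<in> polys_over F \<Longrightarrow> pderiv p \<in> polys_over F"
  unfolding polys_over_def
  by (auto simp: coeff_pderiv simp del: of_nat_Suc intro!: csubfieldD(4) csubfield_of_nat)

text \<open>Division is redone one coefficient at a time so that quotient and remainder visibly stay
  over \<open>F\<close>.\<close>

lemma polys_over_division:
  assumes F: "csubfield F" and p: "p \<in> polys_over F" and q: "q \<in> polys_over F" "q \<noteq> 0"
  obtains k r where "k \<in> polys_over F" "r \<in> polys_over F" "p = k * q + r" "r = 0 \<or> degree r < degree q"
proof -
  have "\<exists>k\<in>polys_over F. \<exists>r\<in>polys_over F. p = k * q + r \<and> (r = 0 \<or> degree r < degree q)"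
    using p
  proof (induction p)
    case 0
    thus ?case using polys_over_0[OF F] by (intro bexI[of _ 0]) auto
  next
    case (pCons a p)
    have "coeff (pCons a p) i \<in> F" for i using pCons.prems unfolding polys_over_def by blast
    from this[of 0] this[of "Suc _"] have a: "a \<in> F" and p: "p \<in> polys_over F"
      unfolding polys_over_def by auto
    then obtain k r where kr: "k \<in> polys_over F" "r \<in> polys_over F" "p = k * q + r"
      "r = 0 \<or> degree r < degree q"
      using pCons.IH by blast
    define b where "b = coeff (pCons a r) (degree q) / coeff q (degree q)"
    define r' where "r' = pCons a r - smult b q"
    have ar: "pCons a r \<in> polys_over F" by (rule polys_over_pCons[OF F a kr(2)])
    hence b: "b \<in> F" using q(1) unfolding b_def polys_over_def by (auto intro!: csubfieldD(8)[OF F])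
    have "degree (pCons a r) \<le> degree q" using kr(4) by auto
    hence "degree r' \<le> degree q" unfolding r'_def by (intro degree_diff_le) auto
    moreover have "coeff r' (degree q) = 0" using q(2) by (simp add: r'_def b_def)
    ultimately have "r' = 0 \<or> degree r' < degree q"
      by (metis leading_coeff_0_iff le_neq_implies_less)
    moreover have "pCons a p = pCons b k * q + r'" by (simp add: r'_def kr(3))
    moreover have "pCons b k \<in> polys_over F" "r' \<in> polys_over F"
      unfolding r'_def by (intro polys_over_pCons polys_over_diff polys_over_smult F b kr(1) ar q(1))+
    ultimately show ?case by blast
  qed
  thus ?thesis using that by blast
qed

lemma field_hom_onD:
  assumes "field_hom_on F \<phi>" "csubfield F"
  shows "\<phi> 1 = 1" "\<phi> 0 = 0" "\<And>x y. x \<in> F \<Longrightarrow> y \<in> F \<Longrightarrow> \<phi> (x + y) = \<phi> x + \<phi> y"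
    "\<And>x y. x \<in> F \<Longrightarrow> y \<in> F \<Longrightarrow> \<phi> (x * y) = \<phi> x * \<phi> y" "\<And>x. x \<in> F \<Longrightarrow> \<phi> (- x) = - \<phi> x"
    "\<And>x y. x \<in> F \<Longrightarrow> y \<in> F \<Longrightarrow> \<phi> (x - y) = \<phi> x - \<phi> y"
    "\<And>x. x \<in> F \<Longrightarrow> \<phi> x = 0 \<longleftrightarrow> x = 0" "\<And>x. x \<in> F \<Longrightarrow> \<phi> (inverse x) = inverse (\<phi> x)"
proof -
  note F = csubfieldD[OF assms(2)]
  show 1: "\<phi> 1 = 1" and add: "\<And>x y. x \<in> F \<Longrightarrow> y \<in> F \<Longrightarrow> \<phi> (x + y) = \<phi> x + \<phi> y"
    and mult: "\<And>x y. x \<in> F \<Longrightarrow> y \<in> F \<Longrightarrow> \<phi> (x * y) = \<phi> x * \<phi> y"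
    using assms(1) unfolding field_hom_on_def by auto
  show 0: "\<phi> 0 = 0" using add[OF F(1) F(1)] by simp
  show minus: "\<phi> (- x) = - \<phi> x" if "x \<in> F" for x
    using add[OF that F(5)[OF that]] 0 by (simp add: eq_neg_iff_add_eq_0 add.commute)
  show "\<phi> (x - y) = \<phi> x - \<phi> y" if "x \<in> F" "y \<in> F" for x y
    using add[OF that(1) F(5)[OF that(2)]] minus[OF that(2)] by simp
  have inv: "\<phi> x * \<phi> (inverse x) = 1" if "x \<in> F" "x \<noteq> 0" for x
    using mult[OF that(1) F(6)[OF that(1)]] 1 that by simp
  show "\<phi> x = 0 \<longleftrightarrow> x = 0" if "x \<in> F" for x
    using inv[OF that] 0 by (cases "x = 0") auto
  show "\<phi> (inverse x) = inverse (\<phi> x)" if "x \<in> F" for x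
    using inv[OF that] 0 by (cases "x = 0") (auto intro: inverse_unique[symmetric])
qed

lemma field_hom_on_sum:
  assumes "field_hom_on F \<phi>" "csubfield F" "\<And>i. i \<in> I \<Longrightarrow> f i \<in> F"
  shows "\<phi> (sum f I) = (\<Sum>i\<in>I. \<phi> (f i))"
  using assms(3)
proof (induction I rule: infinite_finite_induct)
  case (insert i I)
  thus ?case
    using field_hom_onD(3)[OF assms(1,2), of "f i" "sum f I"] csubfield_sum[OF assms(2), of I f]
    by simp
qed (simp_all add: field_hom_onD(2)[OF assms(1,2)])

lemma field_hom_on_power:
  assumes "field_hom_on F \<phi>" "csubfield F" "x \<in> F"
  shows "\<phi> (x ^ k) = \<phi> x ^ k"
  by (induction k)
    (simp_all add: field_hom_onD[OF assms(1,2)] csubfield_power[OF assms(2,3)] assms(3))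

lemma field_hom_on_poly:
  assumes "field_hom_on F \<phi>" "csubfield F" "p \<in> polys_over F" "x \<in> F"
  shows "\<phi> (poly p x) = poly (map_poly \<phi> p) (\<phi> x)"
proof -
  note h = field_hom_onD[OF assms(1,2)]
  have c: "coeff p i \<in> F" for i using assms(3) by (simp add: polys_over_def)
  have "degree (map_poly \<phi> p) = degree p"
    using h(2,7) c by (intro degree_map_poly) auto
  moreover have "\<phi> (poly p x) = (\<Sum>i\<le>degree p. \<phi> (coeff p i * x ^ i))"
    unfolding poly_altdef
    by (intro field_hom_on_sum[OF assms(1,2)] csubfieldD(4)[OF assms(2)] c
          csubfield_power[OF assms(2,4)])
  ultimately show ?thesis
    by (simp add: poly_altdef h(2,4) c coeff_map_poly csubfield_power[OF assms(2,4)]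
        field_hom_on_power[OF assms(1,2,4)])
qed

lemma map_poly_hom_add:
  assumes "field_hom_on F \<phi>" "csubfield F" "p \<in> polys_over F" "q \<in> polys_over F"
  shows "map_poly \<phi> (p + q) = map_poly \<phi> p + map_poly \<phi> q"
  using assms(3,4) by (intro poly_eqI) (simp add: coeff_map_poly field_hom_onD[OF assms(1,2)] polys_over_def)

lemma map_poly_hom_diff:
  assumes "field_hom_on F \<phi>" "csubfield F" "p \<in> polys_over F" "q \<in> polys_over F"
  shows "map_poly \<phi> (p - q) = map_poly \<phi> p - map_poly \<phi> q"
  using assms(3,4) by (intro poly_eqI) (simp add: coeff_map_poly field_hom_onD[OF assms(1,2)] polys_over_def)

lemma map_poly_hom_mult:
  assumes "field_hom_on F \<phi>" "csubfield F" "p \<in> polys_over F" "q \<in> polys_over F"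
  shows "map_poly \<phi> (p * q) = map_poly \<phi> p * map_poly \<phi> q"
proof (rule poly_eqI)
  fix k
  have "\<phi> (\<Sum>i\<le>k. coeff p i * coeff q (k - i)) = (\<Sum>i\<le>k. \<phi> (coeff p i * coeff q (k - i)))"
    using assms(3,4) by (intro field_hom_on_sum[OF assms(1,2)] csubfieldD(4)[OF assms(2)])
      (auto simp: polys_over_def)
  thus "coeff (map_poly \<phi> (p * q)) k = coeff (map_poly \<phi> p * map_poly \<phi> q) k"
    using assms(3,4) by (simp add: coeff_map_poly coeff_mult field_hom_onD[OF assms(1,2)] polys_over_def)
qed

text \<open>Least degree is all that is asked; the polynomial is not normalised to be monic.\<close>

definition minimal_poly_over :: "complex set \<Rightarrow> complex \<Rightarrow> complex poly \<Rightarrow> bool" where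
  "minimal_poly_over F x m \<longleftrightarrow> m \<in> polys_over F \<and> m \<noteq> 0 \<and> poly m x = 0 \<and>
     (\<forall>p\<in>polys_over F. p \<noteq> 0 \<longrightarrow> poly p x = 0 \<longrightarrow> degree m \<le> degree p)"

lemma minimal_poly_over_exists:
  assumes "p \<in> polys_over F" "p \<noteq> 0" "poly p x = 0"
  obtains m where "minimal_poly_over F x m"
proof -
  let ?P = "\<lambda>q. q \<in> polys_over F \<and> q \<noteq> 0 \<and> poly q x = 0"
  have "?P (arg_min degree ?P) \<and> (\<forall>y. ?P y \<longrightarrow> degree (arg_min degree ?P) \<le> degree y)"
    using assms by (intro arg_min_nat_lemma[of ?P p]) auto
  thus ?thesis using that unfolding minimal_poly_over_def by blast
qed

lemma minimal_poly_over_dvd: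
  assumes F: "csubfield F" and m: "minimal_poly_over F x m"
    and p: "p \<in> polys_over F" "poly p x = 0"
  obtains k where "k \<in> polys_over F" "p = k * m"
proof -
  obtain k r where kr: "k \<in> polys_over F" "r \<in> polys_over F" "p = k * m + r" "r = 0 \<or> degree r < degree m"
    using polys_over_division[OF F p(1), of m] m unfolding minimal_poly_over_def by metis
  have "poly r x = 0" using kr(3) p(2) m unfolding minimal_poly_over_def by simp
  hence "r = 0" using kr(2,4) m unfolding minimal_poly_over_def by (metis not_less)
  thus ?thesis using kr that by simp
qed

definition adjoin :: "complex set \<Rightarrow> complex \<Rightarrow> complex set" where
  "adjoin F x = (\<lambda>p. poly p x) ` polys_over F"

lemma adjoin_superset:
  assumes "csubfield F"
  shows "F \<subseteq> adjoin F x" "x \<in> adjoin F x"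
proof -
  have "[:c:] \<in> polys_over F" if "c \<in> F" for c
    using polys_over_pCons[OF assms that polys_over_0[OF assms]] .
  thus "F \<subseteq> adjoin F x" unfolding adjoin_def by (force intro: image_eqI[of _ _ "[:_:]"])
  have "[:0, 1:] \<in> polys_over F"
    using assms by (intro polys_over_pCons polys_over_0 csubfieldD)
  thus "x \<in> adjoin F x" unfolding adjoin_def by (force intro: image_eqI[of _ _ "[:0, 1:]"])
qed

text \<open>Inverses come from the Euclidean algorithm applied to the minimal polynomial.\<close>

lemma csubfield_adjoin:
  assumes F: "csubfield F" and m: "minimal_poly_over F x m"
  shows "csubfield (adjoin F x)"
proof -
  have inv: "\<exists>q\<in>polys_over F. poly p x * poly q x = 1"
    if "p \<in> polys_over F" "poly p x \<noteq> 0" "degree p < degree m" for p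
    using that
  proof (induction "degree p" arbitrary: p rule: less_induct)
    case less
    have "p \<noteq> 0" using less.prems by auto
    obtain k r where kr: "k \<in> polys_over F" "r \<in> polys_over F" "m = k * p + r" "r = 0 \<or> degree r < degree p"
      using polys_over_division[OF F _ less.prems(1) \<open>p \<noteq> 0\<close>, of m] m
      unfolding minimal_poly_over_def by metis
    \<comment> \<open>As \<open>m\<close> vanishes at \<open>x\<close>, the value of the remainder
      is minus that of \<open>k * p\<close>; an inverse of the former yields one of the latter, and
      the induction applies to the smaller degree of \<open>r\<close>.\<close>
    have mx: "poly k x * poly p x + poly r x = 0"
      using m kr(3) unfolding minimal_poly_over_def by (metis poly_add poly_mult)
    show ?case
    proof (cases "degree p = 0")
      case True
      then obtain c where c: "p = [:c:]" by (auto elim: degree_eq_zeroE)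
      have "c \<in> F" using less.prems(1) c unfolding polys_over_def by (metis (mono_tags) coeff_pCons_0 mem_Collect_eq)
      hence "[:inverse c:] \<in> polys_over F"
        by (intro polys_over_pCons F polys_over_0 csubfieldD)
      thus ?thesis using \<open>p \<noteq> 0\<close> c by (intro bexI[of _ "[:inverse c:]"]) auto
    next
      case False
      have "poly r x \<noteq> 0"
      proof
        assume r0: "poly r x = 0"
        have "r = 0"
          using m kr(2,4) r0 less.prems(3) unfolding minimal_poly_over_def by (metis less_trans not_less)
        hence mk: "m = k * p" using kr(3) by simp
        have "poly k x = 0" using mx r0 less.prems(2) by simp
        moreover have "k \<noteq> 0" using mk m unfolding minimal_poly_over_def by auto
        ultimately have "degree m \<le> degree k" using m kr(1) unfolding minimal_poly_over_def by blast
        moreover have "degree m = degree k + degree p"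
          unfolding mk using \<open>k \<noteq> 0\<close> \<open>p \<noteq> 0\<close> by (rule degree_mult_eq)
        ultimately show False using False by simp
      qed
      moreover from this have "degree r < degree p" using kr(4) by auto
      ultimately obtain q where q: "q \<in> polys_over F" "poly r x * poly q x = 1"
        using less.hyps[OF _ kr(2)] less.prems(3) by fastforce
      have "- k * q \<in> polys_over F" by (intro polys_over_mult polys_over_uminus F kr(1) q(1))
      moreover have "poly p x * poly (- k * q) x = 1"
      proof -
        have "poly r x = - (poly k x * poly p x)" using mx by (simp add: add_eq_0_iff)
        thus ?thesis using q(2) by (simp add: mult_ac)
      qed
      ultimately show ?thesis by blast
    qed
  qed
  have 1: "inverse z \<in> adjoin F x" if "z \<in> adjoin F x" for z
  proof (cases "z = 0")
    case True
    thus ?thesis using that by simp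
  next
    case False
    obtain p where p: "p \<in> polys_over F" "z = poly p x" using \<open>z \<in> adjoin F x\<close> unfolding adjoin_def by auto
    obtain k r where kr: "k \<in> polys_over F" "r \<in> polys_over F" "p = k * m + r" "r = 0 \<or> degree r < degree m"
      using polys_over_division[OF F p(1), of m] m unfolding minimal_poly_over_def by metis
    have zr: "z = poly r x" using p(2) kr(3) m unfolding minimal_poly_over_def by simp
    hence "degree r < degree m" using kr(4) False by auto
    then obtain q where "q \<in> polys_over F" "z * poly q x = 1"
      using inv[OF kr(2)] zr False by auto
    thus ?thesis unfolding adjoin_def by (metis image_eqI inverse_unique)
  qed
  have 2: "0 \<in> adjoin F x" "1 \<in> adjoin F x"
    using adjoin_superset(1)[OF F, of x] csubfieldD(1,2)[OF F] by auto
  have 3: "a + b \<in> adjoin F x" "a * b \<in> adjoin F x" "- a \<in> adjoin F x"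
    if ab: "a \<in> adjoin F x" "b \<in> adjoin F x" for a b
  proof -
    obtain p q where pq: "p \<in> polys_over F" "a = poly p x" "q \<in> polys_over F" "b = poly q x"
      using ab unfolding adjoin_def by auto
    have "a + b = poly (p + q) x" "a * b = poly (p * q) x" "- a = poly (- p) x" by (auto simp: pq)
    thus "a + b \<in> adjoin F x" "a * b \<in> adjoin F x" "- a \<in> adjoin F x"
      unfolding adjoin_def using pq F by (metis image_eqI polys_over_add polys_over_mult polys_over_uminus)+
  qed
  show ?thesis unfolding csubfield_def by (intro conjI ballI 1 2 3)
qed

text \<open>The extension evaluates coefficientwise images at \<open>y\<close>. It is well defined
  because two representatives differ by a multiple of \<open>m\<close>, which is mapped to a
  multiple of \<open>map_poly \<phi> m\<close> and so vanishes at \<open>y\<close>.\<close>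

lemma extend_field_hom_to_root:
  assumes F: "csubfield F" and h: "field_hom_on F \<phi>"
    and m: "minimal_poly_over F x m" and y: "poly (map_poly \<phi> m) y = 0"
  obtains \<psi> where "field_hom_on (adjoin F x) \<psi>" "\<forall>z\<in>F. \<psi> z = \<phi> z" "\<psi> x = y"
proof -
  define rep where "rep = (\<lambda>z. SOME p. p \<in> polys_over F \<and> z = poly p x)"
  define \<psi> where "\<psi> = (\<lambda>z. poly (map_poly \<phi> (rep z)) y)"
  have psi: "\<psi> (poly p x) = poly (map_poly \<phi> p) y" if p: "p \<in> polys_over F" for p
  proof -
    have rep: "rep (poly p x) \<in> polys_over F \<and> poly p x = poly (rep (poly p x)) x"
      unfolding rep_def by (rule someI[of _ p]) (simp add: p)
    have "poly (rep (poly p x) - p) x = 0" using rep by simp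
    then obtain k where k: "k \<in> polys_over F" "rep (poly p x) - p = k * m"
      using minimal_poly_over_dvd[OF F m polys_over_diff[OF F]] rep p by metis
    have "map_poly \<phi> (rep (poly p x)) - map_poly \<phi> p = map_poly \<phi> k * map_poly \<phi> m"
      using map_poly_hom_diff[OF h F, of "rep (poly p x)" p] map_poly_hom_mult[OF h F k(1), of m] k rep p m
      unfolding minimal_poly_over_def by metis
    hence "poly (map_poly \<phi> (rep (poly p x))) y - poly (map_poly \<phi> p) y = 0"
      using y by (metis mult_zero_right poly_diff poly_mult)
    thus ?thesis by (simp add: \<psi>_def)
  qed
  have const: "\<psi> z = \<phi> z" if "z \<in> F" for z
    using psi[of "[:z:]"] polys_over_pCons[OF F that polys_over_0[OF F]] field_hom_onD(2)[OF h F]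
    by (simp add: Polynomial.map_poly_pCons)
  have "\<psi> x = y"
    using psi[of "[:0, 1:]"] polys_over_pCons[OF F _ polys_over_pCons[OF F _ polys_over_0[OF F]]]
      csubfieldD(1,2)[OF F] field_hom_onD(1,2)[OF h F]
    by (simp add: Polynomial.map_poly_pCons)
  moreover have "field_hom_on (adjoin F x) \<psi>"
    unfolding field_hom_on_def
  proof (intro conjI ballI)
    show "\<psi> 1 = 1" using const[of 1] csubfieldD(2)[OF F] field_hom_onD(1)[OF h F] by simp
    fix a b assume "a \<in> adjoin F x" "b \<in> adjoin F x"
    then obtain p q where pq: "p \<in> polys_over F" "a = poly p x" "q \<in> polys_over F" "b = poly q x"
      unfolding adjoin_def by auto
    show "\<psi> (a + b) = \<psi> a + \<psi> b"
      using psi[OF polys_over_add[OF F pq(1,3)]] psi[OF pq(1)] psi[OF pq(3)] map_poly_hom_add[OF h F pq(1,3)]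
      by (simp add: pq)
    show "\<psi> (a * b) = \<psi> a * \<psi> b"
      using psi[OF polys_over_mult[OF F pq(1,3)]] psi[OF pq(1)] psi[OF pq(3)] map_poly_hom_mult[OF h F pq(1,3)]
      by (simp add: pq)
  qed
  ultimately show ?thesis using that const by blast
qed

lemma algebraic_poly_over:
  assumes "algebraic x" "csubfield F"
  obtains p where "p \<in> polys_over F" "p \<noteq> 0" "poly p x = 0"
proof -
  obtain p where p: "\<forall>i. coeff p i \<in> \<int>" "p \<noteq> 0" "poly p x = 0"
    using assms(1) unfolding algebraic_def by blast
  have "coeff p i \<in> F" for i
  proof -
    obtain k where "coeff p i = of_int k" using p(1) Ints_cases by blast
    thus ?thesis using csubfield_of_int[OF assms(2)] by simp
  qed
  hence "p \<in> polys_over F" unfolding polys_over_def by blast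
  thus ?thesis using p that by blast
qed

text \<open>The image of the minimal polynomial is again nonconstant, so it has a complex root;
  extensions therefore never leave the complex numbers.\<close>

lemma extend_field_hom_algebraic:
  assumes F: "csubfield F" and h: "field_hom_on F \<phi>" and x: "algebraic x"
  obtains F' \<psi> where "csubfield F'" "F \<subseteq> F'" "x \<in> F'" "field_hom_on F' \<psi>"
    "\<forall>z\<in>F. \<psi> z = \<phi> z"
proof -
  obtain p where "p \<in> polys_over F" "p \<noteq> 0" "poly p x = 0" by (rule algebraic_poly_over[OF x F])
  then obtain m where m: "minimal_poly_over F x m" by (rule minimal_poly_over_exists)
  have "degree m > 0"
  proof (rule ccontr)
    assume "\<not> degree m > 0"
    then obtain c where "m = [:c:]" by (auto elim: degree_eq_zeroE)
    thus False using m unfolding minimal_poly_over_def by auto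
  qed
  moreover have "degree (map_poly \<phi> m) = degree m"
    using m field_hom_onD(2,7)[OF h F] unfolding minimal_poly_over_def polys_over_def
    by (intro degree_map_poly) auto
  ultimately have "\<not> constant (poly (map_poly \<phi> m))" by (simp add: constant_degree)
  then obtain y where y: "poly (map_poly \<phi> m) y = 0" using fundamental_theorem_of_algebra by blast
  obtain \<psi> where "field_hom_on (adjoin F x) \<psi>" "\<forall>z\<in>F. \<psi> z = \<phi> z"
    by (rule extend_field_hom_to_root[OF F h m y]) blast
  thus ?thesis using that csubfield_adjoin[OF F m] adjoin_superset[OF F] by blast
qed

lemma extend_field_hom_finite:
  assumes "finite S" "\<And>x :: complex. x \<in> S \<Longrightarrow> algebraic x" "csubfield F" "field_hom_on F \<phi>"
  obtains F' \<psi> where "csubfield F'" "F \<subseteq> F'" "S \<subseteq> F'" "field_hom_on F' \<psi>"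
    "\<forall>z\<in>F. \<psi> z = \<phi> z"
proof -
  have "\<exists>F' \<psi>. csubfield F' \<and> F \<subseteq> F' \<and> S \<subseteq> F' \<and> field_hom_on F' \<psi> \<and> (\<forall>z\<in>F. \<psi> z = \<phi> z)"
    using assms(1,2)
  proof (induction S)
    case empty
    thus ?case using assms(3,4) by blast
  next
    case (insert x S)
    then obtain F1 \<psi>' where 1: "csubfield F1" "F \<subseteq> F1" "S \<subseteq> F1" "field_hom_on F1 \<psi>'" "\<forall>z\<in>F. \<psi>' z = \<phi> z"
      by auto
    obtain F2 \<psi>'' where "csubfield F2" "F1 \<subseteq> F2" "x \<in> F2" "field_hom_on F2 \<psi>''" "\<forall>z\<in>F1. \<psi>'' z = \<psi>' z"
      by (rule extend_field_hom_algebraic[OF 1(1,4), of x]) (use insert.prems in auto)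
    with 1 show ?case by (intro exI[of _ F2] exI[of _ \<psi>'']) auto
  qed
  thus ?thesis using that by blast
qed

text \<open>Separability in characteristic 0: the derivative has smaller degree than
  \<open>m\<close>, so \<open>a\<close> is only a simple root, and degree at least 2 leaves room for
  another one.\<close>

lemma minimal_poly_over_other_root:
  assumes F: "csubfield F" and m: "minimal_poly_over F a m" and a: "a \<notin> F"
  obtains y where "poly m y = 0" "y \<noteq> a"
proof -
  have mF: "m \<in> polys_over F" "m \<noteq> 0" "poly m a = 0" using m unfolding minimal_poly_over_def by auto
  have "degree m \<noteq> 0" using mF by (auto elim!: degree_eq_zeroE)
  have "degree m \<noteq> 1"
  proof
    assume "degree m = 1"
    then obtain c d where cd: "m = [:c, d:]" "d \<noteq> 0" by (metis degree1_coeffs)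
    have "coeff m 0 \<in> F" "coeff m 1 \<in> F" using mF(1) unfolding polys_over_def by blast+
    hence "c \<in> F" "d \<in> F" using cd by auto
    moreover have "a = - c / d" using mF(3) cd by (simp add: field_simps eq_neg_iff_add_eq_0)
    ultimately show False using a csubfieldD(5,8)[OF F] by auto
  qed
  obtain g where g: "m = [:- a, 1:] * g" using mF(3) unfolding poly_eq_0_iff_dvd by (rule dvdE)
  have "poly (pderiv m) a \<noteq> 0"
  proof
    assume "poly (pderiv m) a = 0"
    moreover have "pderiv m \<noteq> 0" using \<open>degree m \<noteq> 0\<close> by (simp add: pderiv_eq_0_iff)
    ultimately have "degree m \<le> degree (pderiv m)"
      using m polys_over_pderiv[OF F mF(1)] unfolding minimal_poly_over_def by blast
    thus False using \<open>degree m \<noteq> 0\<close> by (simp add: degree_pderiv)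
  qed
  moreover have "poly (pderiv m) a = poly g a" unfolding g pderiv_mult by (simp add: pderiv_pCons)
  ultimately have ga: "poly g a \<noteq> 0" by simp
  have "g \<noteq> 0" using ga by auto
  hence "degree m = 1 + degree g" unfolding g by (subst degree_mult_eq) auto
  hence "degree g \<noteq> 0" using \<open>degree m \<noteq> 1\<close> by auto
  hence "\<not> constant (poly g)" by (simp add: constant_degree)
  then obtain y where "poly g y = 0" using fundamental_theorem_of_algebra by blast
  thus ?thesis using that[of y] ga unfolding g by auto
qed

section \<open>Splitting fields\<close>

lemma complex_field_simps:
  "carrier complex_field = UNIV" "monoid.mult complex_field = (*)" "one complex_field = 1"
  "ring.zero complex_field = 0" "add complex_field = (+)"
  by (simp_all add: ring_of_type_algebra_def fun_eq_iff)

lemma complex_field_a_inv: "a_inv complex_field x = - x"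
proof -
  interpret F: field complex_field by (rule field_from_type_algebra)
  show ?thesis
    by (rule F.minus_equality[symmetric, of "- x" x, symmetric]) (simp_all add: complex_field_simps)
qed

lemma complex_field_m_inv: "x \<noteq> 0 \<Longrightarrow> m_inv complex_field x = inverse x"
proof -
  assume "x \<noteq> 0"
  interpret F: field complex_field by (rule field_from_type_algebra)
  show ?thesis
    using \<open>x \<noteq> 0\<close> F.inv_char[of x "inverse x"] by (simp add: complex_field_simps)
qed

lemma csubfield_generate_field: "csubfield (generate_field complex_field S)"
  unfolding csubfield_def
proof (intro conjI ballI)
  let ?K = "generate_field complex_field S"
  show 1: "1 \<in> ?K" using generate_field.one[of complex_field S] by (simp add: complex_field_simps)
  show uminus: "- x \<in> ?K" if "x \<in> ?K" for x
    using generate_field.a_inv[OF that] by (simp add: complex_field_a_inv)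
  show add: "x + y \<in> ?K" if "x \<in> ?K" "y \<in> ?K" for x y
    using generate_field.eng_add[OF that] by (simp add: complex_field_simps)
  show "x * y \<in> ?K" if "x \<in> ?K" "y \<in> ?K" for x y
    using generate_field.eng_mult[OF that] by (simp add: complex_field_simps)
  show 0: "0 \<in> ?K" using add[OF 1 uminus[OF 1]] by simp
  show "inverse x \<in> ?K" if "x \<in> ?K" for x
    using generate_field.m_inv[OF that] 0
    by (cases "x = 0") (auto simp: complex_field_simps complex_field_m_inv)
qed

lemma generate_field_least:
  assumes F: "csubfield F" and "S \<subseteq> F"
  shows "generate_field complex_field S \<subseteq> F"
proof
  fix z assume "z \<in> generate_field complex_field S"
  thus "z \<in> F"
    by induction (use assms csubfieldD[OF F] in
      \<open>auto simp: complex_field_simps complex_field_a_inv complex_field_m_inv\<close>)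
qed

lemma csubfield_splitting_field: "csubfield (splitting_field f)"
  unfolding splitting_field_def by (rule csubfield_generate_field)

lemma complex_roots_in_splitting_field: "complex_roots f \<subseteq> splitting_field f"
  unfolding splitting_field_def by (auto intro: generate_field.incl)

lemma splitting_field_least:
  assumes "csubfield F" "complex_roots f \<subseteq> F"
  shows "splitting_field f \<subseteq> F"
  unfolding splitting_field_def using assms Rats_subset_csubfield
  by (intro generate_field_least) auto

lemma field_hom_on_of_int:
  assumes "field_hom_on F \<phi>" "csubfield F"
  shows "\<phi> (of_int k) = of_int k"
proof -
  note h = field_hom_onD[OF assms]
  have nat: "\<phi> (of_nat j) = of_nat j" for j
    by (induction j) (simp_all add: h csubfield_of_nat[OF assms(2)] csubfieldD[OF assms(2)])
  show ?thesis
  proof (cases "k \<ge> 0")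
    case True
    thus ?thesis using nat[of "nat k"] by simp
  next
    case False
    have "\<phi> (- of_nat (nat (- k))) = - of_nat (nat (- k))"
      using h(5)[OF csubfield_of_nat[OF assms(2)]] nat by simp
    thus ?thesis using False by simp
  qed
qed

lemma field_hom_on_Rats:
  assumes "field_hom_on F \<phi>" "csubfield F" "q \<in> \<rat>"
  shows "\<phi> q = q"
proof -
  obtain a b where "q = of_int a / of_int b" using assms(3) by (auto elim: Rats_cases')
  thus ?thesis
    using field_hom_onD(4,8)[OF assms(1,2)] csubfield_of_int[OF assms(2)]
      field_hom_on_of_int[OF assms(1,2)] csubfieldD(6)[OF assms(2)]
    by (simp add: divide_inverse)
qed

text \<open>The condition of fixing the rationals disappears, since every map preserving 1, sums and
  products does so.\<close>

lemma carrier_field_galois_group: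
  assumes K: "csubfield K"
  shows "\<sigma> \<in> carrier (field_galois_group \<rat> K) \<longleftrightarrow> \<sigma> \<in> Bij K \<and> field_hom_on K \<sigma>"
proof
  assume "\<sigma> \<in> carrier (field_galois_group \<rat> K)"
  thus "\<sigma> \<in> Bij K \<and> field_hom_on K \<sigma>"
    by (auto simp: field_galois_group_def Ring.ring_hom_def complex_field_simps field_hom_on_def)
next
  assume *: "\<sigma> \<in> Bij K \<and> field_hom_on K \<sigma>"
  hence "\<sigma> \<in> K \<rightarrow> K" by (simp add: Bij_imp_funcset)
  moreover have "\<forall>q\<in>\<rat>. \<sigma> q = q" using * field_hom_on_Rats[OF _ K, of \<sigma>] by blast
  ultimately show "\<sigma> \<in> carrier (field_galois_group \<rat> K)"
    using * by (auto simp: field_galois_group_def Ring.ring_hom_def complex_field_simps field_hom_on_def)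
qed

lemma rat_map_poly_over_Rats: "map_poly of_rat f \<in> polys_over \<rat>"
  by (simp add: polys_over_def coeff_map_poly)

lemma field_hom_on_root:
  assumes h: "field_hom_on F \<phi>" and F: "csubfield F" and z: "z \<in> F" "z \<in> complex_roots f"
  shows "\<phi> z \<in> complex_roots f"
proof -
  let ?p = "map_poly of_rat f :: complex poly"
  have p: "?p \<in> polys_over F"
    using rat_map_poly_over_Rats[of f] Rats_subset_csubfield[OF F] by (auto simp: polys_over_def)
  have "map_poly \<phi> ?p = ?p"
    using field_hom_on_Rats[OF h F] field_hom_onD(2)[OF h F]
    by (intro poly_eqI) (simp add: coeff_map_poly)
  hence "\<phi> (poly ?p z) = poly ?p (\<phi> z)" using field_hom_on_poly[OF h F p z(1)] by simp
  thus ?thesis using z(2) field_hom_onD(2)[OF h F] by (simp add: complex_roots_def)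
qed

section \<open>Normality of splitting fields and Galois descent\<close>

lemma field_hom_on_inj:
  assumes h: "field_hom_on F \<phi>" and F: "csubfield F"
  shows "inj_on \<phi> F"
proof (rule inj_onI)
  fix a b assume ab: "a \<in> F" "b \<in> F" "\<phi> a = \<phi> b"
  hence "\<phi> (a - b) = 0" using field_hom_onD(6)[OF h F] by simp
  thus "a = b" using ab field_hom_onD(7)[OF h F] csubfieldD(7)[OF F] by auto
qed

lemma field_hom_on_image_subfield:
  assumes h: "field_hom_on F \<phi>" and F: "csubfield F"
  shows "csubfield (\<phi> ` F)"
  unfolding csubfield_def
proof (intro conjI ballI)
  note hF = field_hom_onD[OF h F] and F' = csubfieldD[OF F]
  show "0 \<in> \<phi> ` F" using hF(2) F'(1) by force
  show "1 \<in> \<phi> ` F" using hF(1) F'(2) by force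
  show "- a \<in> \<phi> ` F" "inverse a \<in> \<phi> ` F" if a: "a \<in> \<phi> ` F" for a
  proof -
    obtain a' where a': "a' \<in> F" "a = \<phi> a'" using a by blast
    show "- a \<in> \<phi> ` F" using F'(5)[OF a'(1)] hF(5)[OF a'(1)] a'(2) by force
    show "inverse a \<in> \<phi> ` F" using F'(6)[OF a'(1)] hF(8)[OF a'(1)] a'(2) by force
  qed
  fix a b assume "a \<in> \<phi> ` F" "b \<in> \<phi> ` F"
  then obtain a' b' where ab: "a' \<in> F" "b' \<in> F" "a = \<phi> a'" "b = \<phi> b'" by blast
  show "a + b \<in> \<phi> ` F" using F'(3)[OF ab(1,2)] hF(3)[OF ab(1,2)] ab(3,4) by force
  show "a * b \<in> \<phi> ` F" using F'(4)[OF ab(1,2)] hF(4)[OF ab(1,2)] ab(3,4) by force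
qed

lemma field_hom_on_preimage_subfield:
  assumes h: "field_hom_on F \<phi>" and F: "csubfield F" and K: "csubfield K"
  shows "csubfield {z \<in> F. \<phi> z \<in> K}"
  unfolding csubfield_def
  by (simp add: field_hom_onD[OF h F] csubfieldD[OF F] csubfieldD[OF K])

lemma finite_complex_roots: "f \<noteq> 0 \<Longrightarrow> finite (complex_roots f)"
proof -
  assume "f \<noteq> 0"
  then obtain i where "coeff f i \<noteq> 0" by (meson leading_coeff_neq_0)
  hence "coeff (map_poly of_rat f :: complex poly) i \<noteq> 0" by (simp add: coeff_map_poly)
  hence "(map_poly of_rat f :: complex poly) \<noteq> 0" by auto
  thus ?thesis unfolding complex_roots_def by (rule poly_roots_finite)
qed

text \<open>An injective map of the finite root set into itself permutes it. Hence the image of the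
  splitting field and the preimage of the splitting field are both subfields containing all roots,
  and minimality gives the two inclusions that make the restriction an automorphism.\<close>

lemma restrict_hom_in_galois_group:
  assumes h: "field_hom_on F \<phi>" and F: "csubfield F" and f: "f \<noteq> 0"
    and sub: "splitting_field f \<subseteq> F"
  shows "restrict \<phi> (splitting_field f) \<in> carrier (field_galois_group \<rat> (splitting_field f))"
proof -
  let ?K = "splitting_field f" and ?R = "complex_roots f"
  note K = csubfield_splitting_field[of f] and R = complex_roots_in_splitting_field[of f]
  have hK: "field_hom_on ?K \<phi>" using h sub unfolding field_hom_on_def by blast
  have RR: "\<phi> ` ?R \<subseteq> ?R" using field_hom_on_root[OF hK K] R by auto
  have "\<phi> ` ?R = ?R"
    using RR finite_complex_roots[OF f] inj_on_subset[OF field_hom_on_inj[OF hK K] R]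
    by (simp add: card_image card_subset_eq)
  hence "?K \<subseteq> \<phi> ` ?K"
    using R by (intro splitting_field_least field_hom_on_image_subfield[OF hK K]) auto
  moreover have "?K \<subseteq> {z \<in> ?K. \<phi> z \<in> ?K}"
    using R RR by (intro splitting_field_least field_hom_on_preimage_subfield[OF hK K K]) auto
  ultimately have "\<phi> ` ?K = ?K" by auto
  hence "restrict \<phi> ?K \<in> Bij ?K"
    using field_hom_on_inj[OF hK K] by (simp add: Bij_def bij_betw_def inj_on_def)
  moreover have "field_hom_on ?K (restrict \<phi> ?K)"
    using hK csubfieldD[OF K] unfolding field_hom_on_def by simp
  ultimately show ?thesis unfolding carrier_field_galois_group[OF K] by blast
qed

text \<open>An irrational \<open>a\<close> has a conjugate \<open>y\<close> different from
  \<open>a\<close>. The embedding of \<open>adjoin \<rat> a\<close> that sends \<open>a\<close> to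
  \<open>y\<close> extends to a field containing all roots of \<open>f\<close>, and restricting it
  to the splitting field gives an automorphism that moves \<open>a\<close>.\<close>

lemma galois_fixed_imp_Rats:
  assumes f: "f \<noteq> 0" and a: "a \<in> splitting_field f" "algebraic a"
    and fixed: "\<And>\<sigma>. \<sigma> \<in> carrier (field_galois_group \<rat> (splitting_field f)) \<Longrightarrow> \<sigma> a = a"
  shows "a \<in> \<rat>"
proof (rule ccontr)
  assume "a \<notin> \<rat>"
  let ?K = "splitting_field f"
  note Q = csubfield_Rats
  obtain p where "p \<in> polys_over \<rat>" "p \<noteq> 0" "poly p a = 0" by (rule algebraic_poly_over[OF a(2) Q])
  then obtain m where m: "minimal_poly_over \<rat> a m" by (rule minimal_poly_over_exists)
  obtain y where y: "poly m y = 0" "y \<noteq> a" by (rule minimal_poly_over_other_root[OF Q m \<open>a \<notin> \<rat>\<close>])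
  have "field_hom_on \<rat> (\<lambda>z. z)" by (simp add: field_hom_on_def)
  moreover have "map_poly (\<lambda>z. z) m = m" by (simp add: map_poly_idI)
  ultimately obtain \<psi> where \<psi>: "field_hom_on (adjoin \<rat> a) \<psi>" "\<psi> a = y"
    using extend_field_hom_to_root[OF Q _ m, of "\<lambda>z. z" y] y(1) by auto
  have alg: "algebraic z" if "z \<in> complex_roots f" for z
    using that f rat_map_poly_over_Rats[of f]
    by (intro algebraicI'[of "map_poly of_rat f"]) (auto simp: polys_over_def complex_roots_def)
  obtain F \<psi>' where F: "csubfield F" "adjoin \<rat> a \<subseteq> F" "complex_roots f \<subseteq> F" "field_hom_on F \<psi>'"
    "\<forall>z\<in>adjoin \<rat> a. \<psi>' z = \<psi> z"
    by (rule extend_field_hom_finite[OF finite_complex_roots[OF f] alg csubfield_adjoin[OF Q m] \<psi>(1)])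
  have "restrict \<psi>' ?K \<in> carrier (field_galois_group \<rat> ?K)"
    using F by (intro restrict_hom_in_galois_group[OF F(4) _ f] splitting_field_least) auto
  from fixed[OF this] have "\<psi>' a = a" using a(1) by simp
  thus False using F(5) adjoin_superset(2)[OF Q, of a] \<psi>(2) y(2) by simp
qed

section \<open>Inertia\<close>

text \<open>What the arithmetic arguments use of the ring of integers of a splitting field, with
  permutations of root labels in place of automorphisms. \<open>fixed_Ints\<close> combines Galois
  descent with the integral closedness of the integers; \<open>prime_not_unit\<close> guarantees
  that \<open>q * A\<close> is a proper ideal.\<close>

locale galois_action =
  fixes A :: "complex set" and n :: nat and x :: "nat \<Rightarrow> complex"
    and G :: "(nat \<Rightarrow> nat) set" and act :: "(nat \<Rightarrow> nat) \<Rightarrow> complex \<Rightarrow> complex"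
  assumes A_of_int: "of_int k \<in> A"
    and A_add: "a \<in> A \<Longrightarrow> b \<in> A \<Longrightarrow> a + b \<in> A"
    and A_mult: "a \<in> A \<Longrightarrow> b \<in> A \<Longrightarrow> a * b \<in> A"
    and G_permutes: "\<pi> \<in> G \<Longrightarrow> \<pi> permutes {1..n}"
    and G_id: "id \<in> G"
    and G_comp: "\<pi> \<in> G \<Longrightarrow> \<rho> \<in> G \<Longrightarrow> \<pi> \<circ> \<rho> \<in> G"
    and G_inv: "\<pi> \<in> G \<Longrightarrow> inv' \<pi> \<in> G"
    and act_closed: "\<pi> \<in> G \<Longrightarrow> a \<in> A \<Longrightarrow> act \<pi> a \<in> A"
    and act_add: "\<pi> \<in> G \<Longrightarrow> a \<in> A \<Longrightarrow> b \<in> A \<Longrightarrow> act \<pi> (a + b) = act \<pi> a + act \<pi> b"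
    and act_mult: "\<pi> \<in> G \<Longrightarrow> a \<in> A \<Longrightarrow> b \<in> A \<Longrightarrow> act \<pi> (a * b) = act \<pi> a * act \<pi> b"
    and act_of_int: "\<pi> \<in> G \<Longrightarrow> act \<pi> (of_int k) = of_int k"
    and act_id: "a \<in> A \<Longrightarrow> act id a = a"
    and act_comp: "\<pi> \<in> G \<Longrightarrow> \<rho> \<in> G \<Longrightarrow> a \<in> A \<Longrightarrow> act (\<pi> \<circ> \<rho>) a = act \<pi> (act \<rho> a)"
    and root_in_A: "i \<in> {1..n} \<Longrightarrow> x i \<in> A"
    and act_root: "\<pi> \<in> G \<Longrightarrow> i \<in> {1..n} \<Longrightarrow> act \<pi> (x i) = x (\<pi> i)"
    and inj_roots: "inj_on x {1..n}"
    and fixed_Ints: "a \<in> A \<Longrightarrow> (\<And>\<pi>. \<pi> \<in> G \<Longrightarrow> act \<pi> a = a) \<Longrightarrow> a \<in> \<int>"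
    and prime_not_unit: "prime (q :: int) \<Longrightarrow> a \<in> A \<Longrightarrow> of_int q * a \<noteq> 1"
begin

lemma finite_G: "finite G"
  using finite_subset[of G "{\<pi>. \<pi> permutes {1..n}}"] G_permutes finite_permutations[of "{1..n}"] by auto

lemma A_0: "0 \<in> A" and A_1: "1 \<in> A"
  using A_of_int[of 0] A_of_int[of 1] by auto

lemma A_uminus: "a \<in> A \<Longrightarrow> - a \<in> A"
  using A_mult[OF A_of_int[of "-1"], of a] by simp

lemma A_diff: "a \<in> A \<Longrightarrow> b \<in> A \<Longrightarrow> a - b \<in> A"
  using A_add[of a "- b"] A_uminus[of b] by simp

lemma A_power: "a \<in> A \<Longrightarrow> a ^ k \<in> A"
  by (induction k) (auto intro: A_1 A_mult)

lemma A_sum: "(\<And>i. i \<in> S \<Longrightarrow> f i \<in> A) \<Longrightarrow> sum f S \<in> A"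
  by (induction S rule: infinite_finite_induct) (auto intro: A_0 A_add)

lemma A_prod: "(\<And>i. i \<in> S \<Longrightarrow> f i \<in> A) \<Longrightarrow> prod f S \<in> A"
  by (induction S rule: infinite_finite_induct) (auto intro: A_1 A_mult)

lemma act_0: "\<pi> \<in> G \<Longrightarrow> act \<pi> 0 = 0" and act_1: "\<pi> \<in> G \<Longrightarrow> act \<pi> 1 = 1"
  using act_of_int[of \<pi> 0] act_of_int[of \<pi> 1] by auto

lemma act_uminus: "\<pi> \<in> G \<Longrightarrow> a \<in> A \<Longrightarrow> act \<pi> (- a) = - act \<pi> a"
  using act_mult[OF _ A_of_int[of "-1"], of \<pi> a] act_of_int[of \<pi> "-1"] by simp

lemma act_diff: "\<pi> \<in> G \<Longrightarrow> a \<in> A \<Longrightarrow> b \<in> A \<Longrightarrow> act \<pi> (a - b) = act \<pi> a - act \<pi> b"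
  using act_add[of \<pi> a "- b"] act_uminus[of \<pi> b] A_uminus[of b] by simp

lemma act_sum:
  "\<pi> \<in> G \<Longrightarrow> (\<And>i. i \<in> S \<Longrightarrow> f i \<in> A) \<Longrightarrow> act \<pi> (sum f S) = (\<Sum>i\<in>S. act \<pi> (f i))"
  by (induction S rule: infinite_finite_induct) (auto simp: act_0 act_add A_sum)

lemma act_prod:
  "\<pi> \<in> G \<Longrightarrow> (\<And>i. i \<in> S \<Longrightarrow> f i \<in> A) \<Longrightarrow> act \<pi> (prod f S) = (\<Prod>i\<in>S. act \<pi> (f i))"
  by (induction S rule: infinite_finite_induct) (auto simp: act_1 act_mult A_prod)

lemma act_inv: "\<pi> \<in> G \<Longrightarrow> a \<in> A \<Longrightarrow> act \<pi> (act (inv' \<pi>) a) = a"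
  using act_comp[of \<pi> "inv' \<pi>" a] G_inv[of \<pi>] permutes_inv_o(1)[OF G_permutes, of \<pi>] act_id[of a] by simp

lemma trace_in_Ints:
  assumes "a \<in> A" shows "(\<Sum>\<pi>\<in>G. act \<pi> a) \<in> \<int>"
proof (rule fixed_Ints)
  show "(\<Sum>\<pi>\<in>G. act \<pi> a) \<in> A" using assms by (intro A_sum act_closed)
  fix \<rho> assume \<rho>: "\<rho> \<in> G"
  have "act \<rho> (\<Sum>\<pi>\<in>G. act \<pi> a) = (\<Sum>\<pi>\<in>G. act (\<rho> \<circ> \<pi>) a)"
    using \<rho> assms by (subst act_sum) (auto simp: act_closed act_comp intro!: sum.cong)
  also have "\<dots> = (\<Sum>\<pi>\<in>G. act \<pi> a)"
    using permutes_inv_o[OF G_permutes[OF \<rho>]] \<rho>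
    by (intro sum.reindex_bij_witness[of _ "\<lambda>\<pi>. inv' \<rho> \<circ> \<pi>" "\<lambda>\<pi>. \<rho> \<circ> \<pi>"])
       (auto simp: G_comp G_inv o_assoc)
  finally show "act \<rho> (\<Sum>\<pi>\<in>G. act \<pi> a) = (\<Sum>\<pi>\<in>G. act \<pi> a)" .
qed

definition ideal_over :: "int \<Rightarrow> complex set \<Rightarrow> bool" where
  "ideal_over p M \<longleftrightarrow> M \<subseteq> A \<and> of_int p \<in> M \<and> 1 \<notin> M \<and> (\<forall>a\<in>M. \<forall>b\<in>M. a + b \<in> M) \<and>
     (\<forall>a\<in>A. \<forall>b\<in>M. a * b \<in> M)"

text \<open>Zorn's lemma, started at the proper ideal \<open>p * A\<close>. Maximality is recorded
  as invertibility modulo \<open>M\<close> of every element outside \<open>M\<close>, that is,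
  \<open>A / M\<close> is a field; primality and the later separation argument use it in this
  form.\<close>

lemma maximal_ideal_over_exists:
  assumes "prime (p :: int)"
  obtains M where "ideal_over p M" "\<And>c. c \<in> A \<Longrightarrow> c \<notin> M \<Longrightarrow> \<exists>z\<in>A. c * z - 1 \<in> M"
proof -
  have "\<exists>M\<in>Collect (ideal_over p). \<forall>N\<in>Collect (ideal_over p). M \<subseteq> N \<longrightarrow> N = M"
  proof (rule subset_Zorn_nonempty)
    have "ideal_over p ((\<lambda>a. of_int p * a) ` A)"
      unfolding ideal_over_def
    proof (intro conjI ballI)
      show "(\<lambda>a. of_int p * a) ` A \<subseteq> A" by (auto intro: A_mult A_of_int)
      show "of_int p \<in> (\<lambda>a. of_int p * a) ` A" using A_1 by force
      show "1 \<notin> (\<lambda>a. of_int p * a) ` A" using prime_not_unit[OF assms] by force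
      show "a + b \<in> (\<lambda>a. of_int p * a) ` A"
        if "a \<in> (\<lambda>a. of_int p * a) ` A" "b \<in> (\<lambda>a. of_int p * a) ` A" for a b
        using that by (auto simp: distrib_left[symmetric] intro!: imageI A_add)
      show "a * b \<in> (\<lambda>a. of_int p * a) ` A" if "a \<in> A" "b \<in> (\<lambda>a. of_int p * a) ` A" for a b
        using that by (auto simp: mult.left_commute[of a] intro!: imageI A_mult)
    qed
    thus "Collect (ideal_over p) \<noteq> {}" by blast
    fix C assume C: "C \<noteq> {}" "subset.chain (Collect (ideal_over p)) C"
    have I: "ideal_over p N" if "N \<in> C" for N using C(2) that unfolding subset_chain_def by blast
    have "\<Union>C \<subseteq> A" "1 \<notin> \<Union>C" using I unfolding ideal_over_def by blast+
    moreover have "of_int p \<in> \<Union>C" using C(1) I unfolding ideal_over_def by blast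
    moreover have "a * b \<in> \<Union>C" if ab: "a \<in> A" "b \<in> \<Union>C" for a b
      using ab I unfolding ideal_over_def by blast
    moreover have "a + b \<in> \<Union>C" if ab: "a \<in> \<Union>C" "b \<in> \<Union>C" for a b
    proof -
      obtain N1 N2 where N: "N1 \<in> C" "a \<in> N1" "N2 \<in> C" "b \<in> N2" using ab by blast
      hence "N1 \<subseteq> N2 \<or> N2 \<subseteq> N1" using C(2) unfolding subset_chain_def by blast
      then obtain N where "N \<in> C" "a \<in> N" "b \<in> N" using N by blast
      thus ?thesis using I[of N] unfolding ideal_over_def by blast
    qed
    ultimately have "ideal_over p (\<Union>C)" unfolding ideal_over_def by (intro conjI ballI)
    thus "\<Union>C \<in> Collect (ideal_over p)" by simp
  qed
  then obtain M where M: "ideal_over p M" and max: "\<And>N. ideal_over p N \<Longrightarrow> M \<subseteq> N \<Longrightarrow> N = M"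
    by blast
  have "\<exists>z\<in>A. c * z - 1 \<in> M" if c: "c \<in> A" "c \<notin> M" for c
  proof (rule ccontr)
    assume neg: "\<not> (\<exists>z\<in>A. c * z - 1 \<in> M)"
    define N where "N = {m + c * z |m z. m \<in> M \<and> z \<in> A}"
    have M0: "0 \<in> M" using M A_0 unfolding ideal_over_def by (metis mult_zero_left)
    have "ideal_over p N"
      unfolding ideal_over_def
    proof (intro conjI ballI)
      show "N \<subseteq> A" using M c unfolding N_def ideal_over_def by (auto intro!: A_add A_mult)
      show "of_int p \<in> N" using M A_0 unfolding N_def ideal_over_def by force
      show "1 \<notin> N"
      proof
        assume "1 \<in> N"
        then obtain m z where mz: "1 = m + c * z" "m \<in> M" "z \<in> A" unfolding N_def by blast
        have "(-1) * m \<in> M" using mz(2) M A_of_int[of "-1"] unfolding ideal_over_def by (metis of_int_1 of_int_minus)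
        moreover have "(-1) * m = c * z - 1" using mz(1) by (simp add: algebra_simps)
        ultimately show False using neg mz(3) by auto
      qed
      fix a b assume "b \<in> N"
      then obtain m z where b: "b = m + c * z" "m \<in> M" "z \<in> A" unfolding N_def by blast
      { assume "a \<in> N"
        then obtain m' z' where a: "a = m' + c * z'" "m' \<in> M" "z' \<in> A" unfolding N_def by blast
        have "a + b = (m' + m) + c * (z' + z)" using a b by (simp add: algebra_simps)
        moreover have "m' + m \<in> M" using a b M unfolding ideal_over_def by blast
        ultimately show "a + b \<in> N" using A_add[OF a(3) b(3)] unfolding N_def by blast }
      { assume "a \<in> A"
        have "a * b = a * m + c * (a * z)" using b by (simp add: algebra_simps)
        moreover have "a * m \<in> M" using \<open>a \<in> A\<close> b M unfolding ideal_over_def by blast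
        ultimately show "a * b \<in> N" using A_mult[OF \<open>a \<in> A\<close> b(3)] unfolding N_def by blast }
    qed
    moreover have "M \<subseteq> N" unfolding N_def using A_0 by force
    ultimately have "N = M" by (rule max)
    moreover have "c \<in> N" unfolding N_def using M0 A_1 by force
    ultimately show False using c(2) by simp
  qed
  thus ?thesis using that M by blast
qed

end

section \<open>Arithmetic modulo a maximal ideal above \<open>p\<close>, and its inertia
  group\<close>

locale prime_above = galois_action +
  fixes p :: int and M :: "complex set"
  assumes p_prime: "prime p"
    and M_ideal: "ideal_over p M"
    and M_maximal: "c \<in> A \<Longrightarrow> c \<notin> M \<Longrightarrow> \<exists>z\<in>A. c * z - 1 \<in> M"
begin

lemma M_A: "a \<in> M \<Longrightarrow> a \<in> A" and p_in_M: "of_int p \<in> M" and one_notin_M: "1 \<notin> M"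
  and M_add: "a \<in> M \<Longrightarrow> b \<in> M \<Longrightarrow> a + b \<in> M" and M_mult: "a \<in> A \<Longrightarrow> b \<in> M \<Longrightarrow> a * b \<in> M"
  using M_ideal unfolding ideal_over_def by blast+

lemma M_mult': "b \<in> M \<Longrightarrow> a \<in> A \<Longrightarrow> b * a \<in> M"
  using M_mult[of a b] by (simp add: mult.commute)

lemma M_0: "0 \<in> M"
  using M_mult[OF A_0 p_in_M] by simp

lemma M_uminus: "a \<in> M \<Longrightarrow> - a \<in> M"
  using M_mult[OF A_of_int[of "-1"], of a] by simp

lemma M_diff: "a \<in> M \<Longrightarrow> b \<in> M \<Longrightarrow> a - b \<in> M"
  using M_add[of a "- b"] M_uminus[of b] by simp

lemma M_sum: "(\<And>i. i \<in> S \<Longrightarrow> f i \<in> M) \<Longrightarrow> sum f S \<in> M"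
  by (induction S rule: infinite_finite_induct) (auto intro: M_0 M_add)

lemma M_add_cancel: "a - b \<in> M \<Longrightarrow> b \<in> M \<Longrightarrow> a \<in> M"
  using M_add[of "a - b" b] by simp

lemma M_prime:
  assumes "a \<in> A" "b \<in> A" "a * b \<in> M"
  shows "a \<in> M \<or> b \<in> M"
proof (rule ccontr)
  assume *: "\<not> (a \<in> M \<or> b \<in> M)"
  then obtain z where z: "z \<in> A" "a * z - 1 \<in> M" using M_maximal[OF assms(1)] by blast
  have "z * (a * b) - (a * z - 1) * b \<in> M"
    by (rule M_diff[OF M_mult[OF z(1) assms(3)] M_mult'[OF z(2) assms(2)]])
  moreover have "z * (a * b) - (a * z - 1) * b = b" by (simp add: algebra_simps)
  ultimately show False using * by simp
qed

lemma M_power: "a \<in> A \<Longrightarrow> a ^ k \<in> M \<Longrightarrow> a \<in> M"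
  by (induction k) (use one_notin_M M_prime A_power in auto)

lemma M_prod_mem:
  assumes "finite S" "i \<in> S" "f i \<in> M" "\<And>i. i \<in> S \<Longrightarrow> f i \<in> A"
  shows "prod f S \<in> M"
  using assms by (subst prod.remove[of _ i]) (auto intro!: M_mult' A_prod)

lemma M_prod_prime:
  assumes "finite S" "\<And>i. i \<in> S \<Longrightarrow> f i \<in> A" "prod f S \<in> M"
  shows "\<exists>i\<in>S. f i \<in> M"
  using assms
proof (induction S)
  case (insert i S)
  thus ?case using M_prime[of "f i" "prod f S"] A_prod[of S f] by auto
qed (use one_notin_M in auto)

lemma of_int_in_M_iff: "of_int k \<in> M \<longleftrightarrow> p dvd k"
proof
  assume "p dvd k"
  then obtain j where "k = p * j" by blast
  thus "of_int k \<in> M" using M_mult'[OF p_in_M A_of_int[of j]] by simp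
next
  assume k: "of_int k \<in> M"
  show "p dvd k"
  proof (rule ccontr)
    assume "\<not> p dvd k"
    hence "coprime p k" using p_prime by (simp add: prime_imp_coprime)
    then obtain u v where "u * p + v * k = 1" using bezout_int[of p k] by auto
    hence "of_int u * of_int p + of_int v * of_int k = (1 :: complex)"
      by (metis of_int_1 of_int_add of_int_mult)
    thus False using M_add[OF M_mult[OF A_of_int[of u] p_in_M] M_mult[OF A_of_int[of v] k]] one_notin_M by simp
  qed
qed

lemma invariant_in_M_dvd:
  assumes "a \<in> M" "a \<in> \<int>"
  obtains b where "b \<in> A" "a = of_int p * b"
proof -
  obtain k where k: "a = of_int k" using assms(2) by (elim Ints_cases)
  hence "p dvd k" using assms(1) of_int_in_M_iff by simp
  then obtain j where "k = p * j" by blast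
  thus ?thesis using that[of "of_int j"] k A_of_int by simp
qed

text \<open>The elements acting trivially on the residue field \<open>A / M\<close>. That they map
  \<open>M\<close> into itself is not demanded separately, since the congruence implies it.\<close>

definition inertia :: "(nat \<Rightarrow> nat) set" where
  "inertia = {\<pi> \<in> G. \<forall>a\<in>A. act \<pi> a - a \<in> M}"

lemma inertia_G: "\<pi> \<in> inertia \<Longrightarrow> \<pi> \<in> G"
  by (simp add: inertia_def)

lemma inertia_id: "id \<in> inertia"
  by (simp add: inertia_def G_id act_id M_0)

lemma inertia_comp:
  assumes "\<pi> \<in> inertia" "\<rho> \<in> inertia" shows "\<pi> \<circ> \<rho> \<in> inertia"
proof -
  have "act \<pi> (act \<rho> a) - a \<in> M" if "a \<in> A" for a
    using M_add[of "act \<pi> (act \<rho> a) - act \<rho> a" "act \<rho> a - a"] assms that act_closed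
    by (auto simp: inertia_def)
  thus ?thesis using assms by (auto simp: inertia_def G_comp act_comp)
qed

lemma inertia_inv:
  assumes "\<pi> \<in> inertia" shows "inv' \<pi> \<in> inertia"
proof -
  have "act (inv' \<pi>) a - a \<in> M" if a: "a \<in> A" for a
  proof -
    have "act \<pi> (act (inv' \<pi>) a) - act (inv' \<pi>) a \<in> M"
      using assms a by (auto simp: inertia_def act_closed G_inv)
    hence "a - act (inv' \<pi>) a \<in> M" using act_inv[of \<pi> a] assms a by (simp add: inertia_def)
    thus ?thesis using M_uminus by fastforce
  qed
  thus ?thesis using assms by (auto simp: inertia_def G_inv)
qed

text \<open>Separates \<open>M\<close> from those conjugates that miss \<open>a\<close>, so that
  every conjugate of \<open>w * a\<close>, and hence every trace of a multiple of it, lies in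
  \<open>M\<close>. The product \<open>w\<close> has one factor for each \<open>\<pi>\<close>: if
  \<open>act \<pi> a\<close> is outside \<open>M\<close> with inverse \<open>z\<close> modulo
  \<open>M\<close>, then \<open>1 - a * act (inv' \<pi>) z\<close> is 1 modulo \<open>M\<close> but
  is sent into \<open>M\<close> by \<open>\<pi>\<close>.\<close>

lemma separating_element:
  assumes a: "a \<in> M"
  obtains w where "w \<in> A" "w \<notin> M" "\<forall>\<pi>\<in>G. act \<pi> (w * a) \<in> M"
proof -
  have aA: "a \<in> A" using a by (rule M_A)
  have "\<exists>y\<in>A. y \<notin> M \<and> (act \<pi> a \<in> M \<or> act \<pi> y \<in> M)" if \<pi>: "\<pi> \<in> G" for \<pi>
  proof (cases "act \<pi> a \<in> M")
    case True
    thus ?thesis using A_1 one_notin_M by blast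
  next
    case False
    then obtain z where z: "z \<in> A" "act \<pi> a * z - 1 \<in> M"
      using M_maximal[of "act \<pi> a"] act_closed[OF \<pi> aA] by blast
    define y where "y = 1 - a * act (inv' \<pi>) z"
    have az: "act (inv' \<pi>) z \<in> A" using act_closed[OF G_inv[OF \<pi>] z(1)] .
    have "y \<in> A" unfolding y_def by (intro A_diff A_1 A_mult aA az)
    moreover have "y \<notin> M"
      using M_add[of y "a * act (inv' \<pi>) z"] M_mult'[OF a az] one_notin_M by (auto simp: y_def)
    moreover have "act \<pi> y = - (act \<pi> a * z - 1)"
      unfolding y_def using \<pi> aA az z(1) by (simp add: act_diff act_1 act_mult A_1 A_mult act_inv)
    hence "act \<pi> y \<in> M" using M_uminus[OF z(2)] by (simp only:)
    ultimately show ?thesis by blast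
  qed
  then obtain y where y: "\<And>\<pi>. \<pi> \<in> G \<Longrightarrow> y \<pi> \<in> A \<and> y \<pi> \<notin> M \<and> (act \<pi> a \<in> M \<or> act \<pi> (y \<pi>) \<in> M)"
    by metis
  define w where "w = prod y G"
  have wA: "w \<in> A" unfolding w_def using y by (intro A_prod) auto
  moreover have "w \<notin> M" unfolding w_def using y M_prod_prime[OF finite_G, of y] by blast
  moreover have "\<forall>\<pi>\<in>G. act \<pi> (w * a) \<in> M"
  proof
    fix \<pi> assume \<pi>: "\<pi> \<in> G"
    show "act \<pi> (w * a) \<in> M"
    proof (cases "act \<pi> a \<in> M")
      case True
      thus ?thesis using act_mult[OF \<pi> wA aA] M_mult[OF act_closed[OF \<pi> wA]] by simp
    next
      case False
      hence "act \<pi> (y \<pi>) \<in> M" using y[OF \<pi>] by blast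
      hence "act \<pi> w \<in> M"
        unfolding w_def using y \<pi> act_closed[OF \<pi>]
        by (subst act_prod) (auto intro!: M_prod_mem[OF finite_G \<pi>])
      thus ?thesis using act_mult[OF \<pi> wA aA] M_mult'[OF _ act_closed[OF \<pi> aA]] by simp
    qed
  qed
  ultimately show ?thesis by (rule that)
qed

text \<open>For every \<open>v \<in> A\<close> the trace of \<open>w a v\<close> is an integer in \<open>M\<close>, hence divisible by \<open>p\<close>. As in
  Dedekind's lemma on the independence of characters, the conjugates outside the inertia group are
  eliminated from this linear relation one at a time.\<close>

lemma inertia_invariant_divisible:
  assumes a: "a \<in> M" and inv: "\<And>\<pi>. \<pi> \<in> inertia \<Longrightarrow> act \<pi> a = a"
    and card: "\<not> p dvd int (card inertia)"
  shows "\<exists>u\<in>A. \<exists>b\<in>A. u \<notin> M \<and> u * a = of_int p * b"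
proof -
  have aA: "a \<in> A" using a by (rule M_A)
  obtain w where w: "w \<in> A" "w \<notin> M" "\<forall>\<pi>\<in>G. act \<pi> (w * a) \<in> M"
    by (rule separating_element[OF a])
  \<comment> \<open>The \<open>\<alpha> \<pi>\<close> are the coefficients of a relation modulo
    \<open>p\<close> valid for all \<open>c\<close>, with the terms in \<open>E\<close> already
    eliminated. On inertia they are \<open>a\<close> times \<open>v \<pi>\<close>, and
    \<open>v\<close> is constant and nonzero modulo \<open>M\<close>.\<close>
  define good where "good = (\<lambda>E \<alpha> v. (\<forall>\<pi>\<in>G. \<alpha> \<pi> \<in> A) \<and>
      (\<forall>c\<in>A. \<exists>b\<in>A. (\<Sum>\<pi>\<in>G. \<alpha> \<pi> * act \<pi> c) = of_int p * b) \<and> (\<forall>\<pi>\<in>E. \<alpha> \<pi> = 0) \<and>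
      (\<forall>\<pi>\<in>inertia. v \<pi> \<in> A \<and> \<alpha> \<pi> = a * v \<pi> \<and> v \<pi> - v id \<in> M) \<and> v id \<notin> M)"
  have "\<exists>\<alpha> v. good E \<alpha> v" if "finite E" "E \<subseteq> G - inertia" for E
    using that
  proof (induction E)
    case empty
    have "\<exists>b\<in>A. (\<Sum>\<pi>\<in>G. act \<pi> (w * a) * act \<pi> c) = of_int p * b" if c: "c \<in> A" for c
    proof -
      have "(\<Sum>\<pi>\<in>G. act \<pi> (w * a) * act \<pi> c) = (\<Sum>\<pi>\<in>G. act \<pi> (w * a * c))"
        using c w(1) aA by (intro sum.cong) (auto simp: act_mult A_mult)
      moreover have "(\<Sum>\<pi>\<in>G. act \<pi> (w * a) * act \<pi> c) \<in> M"
        using w c by (intro M_sum M_mult' act_closed) auto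
      moreover have "(\<Sum>\<pi>\<in>G. act \<pi> (w * a * c)) \<in> \<int>"
        using c w(1) aA by (intro trace_in_Ints A_mult)
      ultimately show ?thesis using invariant_in_M_dvd[of "\<Sum>\<pi>\<in>G. act \<pi> (w * a) * act \<pi> c"] by auto
    qed
    moreover have "act \<pi> w - act id w \<in> M" if "\<pi> \<in> inertia" for \<pi>
      using that w(1) by (simp add: inertia_def act_id)
    ultimately have "good {} (\<lambda>\<pi>. act \<pi> (w * a)) (\<lambda>\<pi>. act \<pi> w)"
      using w aA inv inertia_G unfolding good_def
      by (auto simp: act_mult act_closed A_mult act_id mult.commute)
    thus ?case by blast
  next
    case (insert \<tau> E)
    then obtain \<alpha> v where g: "good E \<alpha> v" by auto
    have \<tau>: "\<tau> \<in> G" "\<tau> \<notin> inertia" using insert.prems by auto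
    then obtain c0 where c0: "c0 \<in> A" "act \<tau> c0 - c0 \<notin> M" unfolding inertia_def by blast
    \<comment> \<open>Subtracting \<open>act \<tau> c0\<close> times the relation at
      \<open>c\<close> from the relation at \<open>c0 * c\<close> removes the term of
      \<open>\<tau>\<close>. On inertia the new factor is \<open>c0 - act \<tau> c0\<close> modulo
      \<open>M\<close>, which is outside \<open>M\<close>, so the invariant of \<open>good\<close>
      survives.\<close>
    define \<alpha>' where "\<alpha>' = (\<lambda>\<pi>. \<alpha> \<pi> * (act \<pi> c0 - act \<tau> c0))"
    define v' where "v' = (\<lambda>\<pi>. v \<pi> * (act \<pi> c0 - act \<tau> c0))"
    have c\<tau>: "act \<tau> c0 \<in> A" using act_closed[OF \<tau>(1) c0(1)] .
    have "\<exists>b\<in>A. (\<Sum>\<pi>\<in>G. \<alpha>' \<pi> * act \<pi> c) = of_int p * b" if c: "c \<in> A" for c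
    proof -
      have rel: "\<forall>c\<in>A. \<exists>b\<in>A. (\<Sum>\<pi>\<in>G. \<alpha> \<pi> * act \<pi> c) = of_int p * b"
        using g unfolding good_def by (elim conjE)
      obtain b1 b2 where b: "b1 \<in> A" "(\<Sum>\<pi>\<in>G. \<alpha> \<pi> * act \<pi> (c0 * c)) = of_int p * b1"
        "b2 \<in> A" "(\<Sum>\<pi>\<in>G. \<alpha> \<pi> * act \<pi> c) = of_int p * b2"
        using bspec[OF rel c] bspec[OF rel A_mult[OF c0(1) c]] by blast
      have "(\<Sum>\<pi>\<in>G. \<alpha>' \<pi> * act \<pi> c) = (\<Sum>\<pi>\<in>G. \<alpha> \<pi> * act \<pi> (c0 * c)) - act \<tau> c0 * (\<Sum>\<pi>\<in>G. \<alpha> \<pi> * act \<pi> c)"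
        unfolding \<alpha>'_def sum_distrib_left sum_subtractf[symmetric]
        using c c0(1) by (intro sum.cong) (auto simp: act_mult algebra_simps)
      also have "\<dots> = of_int p * (b1 - act \<tau> c0 * b2)"
        unfolding b(2,4) by (simp add: algebra_simps)
      finally show ?thesis using A_diff[OF b(1) A_mult[OF c\<tau> b(3)]] by blast
    qed
    moreover have "v' \<pi> - v' id \<in> M" if \<pi>: "\<pi> \<in> inertia" for \<pi>
    proof -
      have "v' \<pi> - v' id = v \<pi> * (act \<pi> c0 - c0) + (v \<pi> - v id) * (c0 - act \<tau> c0)"
        unfolding v'_def act_id[OF c0(1)] by (simp add: algebra_simps)
      moreover have "v \<pi> \<in> A" "v \<pi> - v id \<in> M" using g \<pi> unfolding good_def by auto
      moreover have "act \<pi> c0 - c0 \<in> M" using \<pi> c0(1) unfolding inertia_def by blast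
      ultimately show ?thesis using M_add[OF M_mult M_mult'[OF _ A_diff[OF c0(1) c\<tau>]]] by simp
    qed
    moreover have "v' id \<notin> M"
    proof
      assume "v' id \<in> M"
      hence "v id * (c0 - act \<tau> c0) \<in> M" unfolding v'_def act_id[OF c0(1)] .
      moreover have "v id \<in> A" "v id \<notin> M" using g inertia_id unfolding good_def by auto
      ultimately have "c0 - act \<tau> c0 \<in> M" using M_prime A_diff[OF c0(1) c\<tau>] by blast
      thus False using c0(2) M_uminus by fastforce
    qed
    moreover have "\<forall>\<pi>\<in>G. \<alpha>' \<pi> \<in> A" "\<forall>\<pi>\<in>insert \<tau> E. \<alpha>' \<pi> = 0"
      "\<forall>\<pi>\<in>inertia. v' \<pi> \<in> A \<and> \<alpha>' \<pi> = a * v' \<pi>"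
      using g c0(1) c\<tau> inertia_G unfolding good_def \<alpha>'_def v'_def
      by (auto intro!: A_mult A_diff act_closed)
    ultimately have "good (insert \<tau> E) \<alpha>' v'" unfolding good_def by blast
    thus ?case by blast
  qed
  then obtain \<alpha> v where g: "good (G - inertia) \<alpha> v" using finite_G by blast
  obtain b where b: "b \<in> A" "(\<Sum>\<pi>\<in>G. \<alpha> \<pi> * act \<pi> 1) = of_int p * b"
    using g A_1 unfolding good_def by blast
  define u where "u = (\<Sum>\<pi>\<in>inertia. v \<pi>)"
  have sub: "inertia \<subseteq> G" using inertia_G by blast
  have v: "v \<pi> \<in> A" "\<alpha> \<pi> = a * v \<pi>" "v \<pi> - v id \<in> M" if "\<pi> \<in> inertia" for \<pi>
    using g that unfolding good_def by auto
  have vid: "v id \<notin> M" using g unfolding good_def by blast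
  have "(\<Sum>\<pi>\<in>G. \<alpha> \<pi> * act \<pi> 1) = (\<Sum>\<pi>\<in>inertia. \<alpha> \<pi> * act \<pi> 1)"
    using g by (intro sum.mono_neutral_right[OF finite_G sub]) (auto simp: good_def)
  also have "\<dots> = u * a"
    unfolding u_def sum_distrib_right using v(2) inertia_G by (intro sum.cong) (auto simp: act_1)
  finally have "u * a = of_int p * b" using b(2) by simp
  moreover have "u \<in> A" unfolding u_def using v(1) by (rule A_sum)
  moreover have "u \<notin> M"
  proof
    assume "u \<in> M"
    \<comment> \<open>Modulo \<open>M\<close> the sum \<open>u\<close> is the order of inertia times
      \<open>v id\<close>; this is where that order must be prime to \<open>p\<close>.\<close>
    have "(\<Sum>\<pi>\<in>inertia. v \<pi> - v id) \<in> M" using v(3) by (rule M_sum)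
    hence "u - of_int (int (card inertia)) * v id \<in> M" unfolding u_def by (simp add: sum_subtractf)
    hence "of_int (int (card inertia)) * v id \<in> M" using M_diff[OF \<open>u \<in> M\<close>] by fastforce
    thus False using M_prime[OF A_of_int v(1)[OF inertia_id]] vid card of_int_in_M_iff by blast
  qed
  ultimately show ?thesis using b(1) by blast
qed

text \<open>If the orbit of \<open>i\<close> missed \<open>j\<close>, then \<open>\<Prod>(r - x\<^sub>l)\<close> would split into two invariant factors, each
  divisible by \<open>p\<close> up to a unit at \<open>M\<close>.\<close>

lemma transitive_on_residue_class:
  assumes H: "H \<subseteq> G" "id \<in> H" "\<And>\<pi> \<rho>. \<pi> \<in> H \<Longrightarrow> \<rho> \<in> H \<Longrightarrow> \<pi> \<circ> \<rho> \<in> H" "\<And>\<pi>. \<pi> \<in> H \<Longrightarrow> inv' \<pi> \<in> H"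
    and div: "\<And>a. a \<in> M \<Longrightarrow> (\<And>\<pi>. \<pi> \<in> H \<Longrightarrow> act \<pi> a = a) \<Longrightarrow> \<exists>u\<in>A. \<exists>b\<in>A. u \<notin> M \<and> u * a = of_int p * b"
    and prod: "(\<Prod>l\<in>{1..n}. of_int r - x l) = of_int (p * k)" "\<not> p dvd k"
    and ij: "i \<in> {1..n}" "j \<in> {1..n}" "of_int r - x i \<in> M" "of_int r - x j \<in> M"
  shows "\<exists>\<pi>\<in>H. \<pi> i = j"
proof (rule ccontr)
  assume no: "\<not> (\<exists>\<pi>\<in>H. \<pi> i = j)"
  define Orb where "Orb = (\<lambda>\<pi>. \<pi> i) ` H"
  have perm: "\<pi> permutes {1..n}" if "\<pi> \<in> H" for \<pi> using G_permutes H(1) that by blast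
  have Orb: "Orb \<subseteq> {1..n}"
    unfolding Orb_def using permutes_in_image[OF perm] ij(1) by blast
  have fin: "finite Orb" using Orb finite_subset by blast
  have img: "\<pi> ` Orb = Orb" if \<pi>: "\<pi> \<in> H" for \<pi>
  proof -
    have "\<pi> (\<rho> i) \<in> Orb" if "\<rho> \<in> H" for \<rho>
      unfolding Orb_def using H(3)[OF \<pi> that] by (intro image_eqI[of _ _ "\<pi> \<circ> \<rho>"]) simp_all
    hence "\<pi> ` Orb \<subseteq> Orb" unfolding Orb_def by blast
    moreover have "inj_on \<pi> Orb" using permutes_inj_on[OF perm[OF \<pi>]] .
    ultimately show ?thesis using fin by (simp add: card_image card_subset_eq)
  qed
  have invar: "act \<pi> (\<Prod>l\<in>S. of_int r - x l) = (\<Prod>l\<in>S. of_int r - x l)"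
    if \<pi>: "\<pi> \<in> H" and S: "\<pi> ` S = S" "S \<subseteq> {1..n}" for \<pi> S
  proof -
    have "\<pi> \<in> G" using \<pi> H(1) by blast
    have "act \<pi> (\<Prod>l\<in>S. of_int r - x l) = (\<Prod>l\<in>S. of_int r - x (\<pi> l))"
      using S(2) root_in_A \<open>\<pi> \<in> G\<close>
      by (subst act_prod) (auto intro!: prod.cong A_diff A_of_int simp: act_diff A_of_int act_of_int act_root subset_iff)
    also have "\<dots> = (\<Prod>l\<in>S. of_int r - x l)"
      using prod.reindex[OF permutes_inj_on[OF perm[OF \<pi>], of S], of "\<lambda>l. of_int r - x l"] S(1) by simp
    finally show ?thesis .
  qed
  define y where "y = (\<Prod>l\<in>Orb. of_int r - x l)"
  define y' where "y' = (\<Prod>l\<in>{1..n} - Orb. of_int r - x l)"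
  have inA: "of_int r - x l \<in> A" if "l \<in> {1..n}" for l using root_in_A[OF that] A_diff A_of_int by blast
  have "i \<in> Orb" unfolding Orb_def using H(2) by (intro image_eqI[of _ _ id]) simp_all
  hence "y \<in> M" unfolding y_def using Orb inA ij(3) by (intro M_prod_mem[OF fin]) auto
  moreover have "act \<pi> y = y" if "\<pi> \<in> H" for \<pi>
    unfolding y_def using invar[OF that img[OF that] Orb] .
  ultimately obtain u b where u: "u \<in> A" "b \<in> A" "u \<notin> M" "u * y = of_int p * b" using div by blast
  have "j \<in> {1..n} - Orb" unfolding Orb_def using no ij(2) by blast
  hence "y' \<in> M" unfolding y'_def using inA ij(4) by (intro M_prod_mem[of _ j]) auto
  moreover have "act \<pi> y' = y'" if "\<pi> \<in> H" for \<pi>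
  proof -
    have "\<pi> ` ({1..n} - Orb) = {1..n} - Orb"
      using image_set_diff[OF permutes_inj[OF perm[OF that]]] img[OF that] permutes_image[OF perm[OF that]] by simp
    thus ?thesis unfolding y'_def by (intro invar[OF that]) auto
  qed
  ultimately obtain u' b' where u': "u' \<in> A" "b' \<in> A" "u' \<notin> M" "u' * y' = of_int p * b'" using div by blast
  have "y * y' = of_int (p * k)"
    unfolding y_def y'_def prod(1)[symmetric]
    using prod.subset_diff[OF Orb, of "\<lambda>l. of_int r - x l"] by (simp add: mult.commute)
  \<comment> \<open>One factor \<open>p\<close> cancels and a second one remains on the right, which
    puts \<open>u * u' * k\<close> into \<open>M\<close> although none of its factors lies
    there.\<close>
  hence "u * u' * (of_int p * of_int k) = (of_int p * b) * (of_int p * b')"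
    unfolding u(4)[symmetric] u'(4)[symmetric] by (simp add: algebra_simps)
  hence "of_int p * (u * u' * of_int k) = of_int p * (of_int p * (b * b'))"
    by (simp only: mult_ac)
  moreover have "(of_int p :: complex) \<noteq> 0" using p_prime by auto
  ultimately have "u * u' * of_int k = of_int p * (b * b')" by simp
  hence "u * u' * of_int k \<in> M" using M_mult'[OF p_in_M A_mult[OF u(2) u'(2)]] by simp
  hence "of_int k \<in> M"
    using M_prime[OF A_mult[OF u(1) u'(1)] A_of_int] M_prime[OF u(1) u'(1)] u(3) u'(3) by blast
  thus False using prod(2) of_int_in_M_iff by simp
qed

end

section \<open>The Galois group as a permutation group\<close>

lemma field_homs_equalizer_subfield:
  assumes "field_hom_on K \<sigma>" "field_hom_on K \<tau>" and K: "csubfield K"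
  shows "csubfield {z \<in> K. \<sigma> z = \<tau> z}"
  unfolding csubfield_def
  by (simp add: field_hom_onD[OF assms(1) K] field_hom_onD[OF assms(2) K] csubfieldD[OF K])

lemma field_hom_on_algebraic_int:
  assumes h: "field_hom_on K \<sigma>" and K: "csubfield K" and z: "z \<in> K" "algebraic_int z"
  shows "algebraic_int (\<sigma> z)"
proof -
  obtain q where q: "poly (map_poly of_int q) z = 0" "lead_coeff q = (1 :: int)"
    using z(2) unfolding algebraic_int_altdef_ipoly by blast
  let ?q = "map_poly of_int q :: complex poly"
  have "?q \<in> polys_over K" by (simp add: polys_over_def coeff_map_poly csubfield_of_int[OF K])
  moreover have "map_poly \<sigma> ?q = ?q"
    by (intro poly_eqI) (simp add: coeff_map_poly field_hom_onD(2)[OF h K] field_hom_on_of_int[OF h K])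
  ultimately have "poly ?q (\<sigma> z) = 0"
    using field_hom_on_poly[OF h K _ z(1), of ?q] q(1) field_hom_onD(2)[OF h K] by simp
  thus ?thesis unfolding algebraic_int_altdef_ipoly using q(2) by blast
qed

text \<open>The bijection carries separability: \<open>f\<close> has exactly \<open>n\<close>
  distinct complex roots, and the labelling turns automorphisms into permutations of
  \<open>{1..n}\<close>.\<close>

locale indexed_roots =
  fixes f :: "rat poly" and n :: nat and x :: "nat \<Rightarrow> complex"
  assumes f_nz: "f \<noteq> 0"
    and bij_roots: "bij_betw x {1..n} (complex_roots f)"
    and roots_integral: "i \<in> {1..n} \<Longrightarrow> algebraic_int (x i)"
begin

abbreviation "K \<equiv> splitting_field f"
abbreviation "Gal \<equiv> carrier (field_galois_group \<rat> K)"

definition "int_ring = {a \<in> K. algebraic_int a}"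

definition "galois_perms = {\<pi>. \<pi> permutes {1..n} \<and> (\<exists>\<sigma>\<in>Gal. \<forall>i\<in>{1..n}. \<sigma> (x i) = x (\<pi> i))}"

text \<open>The choice is harmless, because automorphisms that agree on the roots agree on
  \<open>K\<close>.\<close>

definition "galois_act \<pi> = (SOME \<sigma>. \<sigma> \<in> Gal \<and> (\<forall>i\<in>{1..n}. \<sigma> (x i) = x (\<pi> i)))"

lemma K_subfield: "csubfield K"
  by (rule csubfield_splitting_field)

lemma GalD:
  assumes "\<sigma> \<in> Gal"
  shows "\<sigma> \<in> Bij K" "field_hom_on K \<sigma>" "\<And>z. z \<in> K \<Longrightarrow> \<sigma> z \<in> K"
  using assms carrier_field_galois_group[OF K_subfield, of \<sigma>] Bij_imp_funcset[of \<sigma> K] by auto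

lemma GalI:
  assumes "bij_betw \<sigma> K K" "field_hom_on K \<sigma>"
  shows "restrict \<sigma> K \<in> Gal"
proof -
  have "field_hom_on K (restrict \<sigma> K)"
    using assms(2) csubfieldD[OF K_subfield] unfolding field_hom_on_def by simp
  moreover have "restrict \<sigma> K \<in> Bij K" using assms(1) by (simp add: Bij_def bij_betw_restrict_eq)
  ultimately show ?thesis using carrier_field_galois_group[OF K_subfield] by blast
qed

lemma root_in_K: "i \<in> {1..n} \<Longrightarrow> x i \<in> K"
  using bij_roots complex_roots_in_splitting_field[of f] by (auto simp: bij_betw_def)

text \<open>The set where two homomorphisms agree is a subfield; containing the roots, it is all of
  \<open>K\<close>.\<close>

lemma Gal_eqI:
  assumes "\<sigma> \<in> Gal" "\<tau> \<in> Gal" "\<And>i. i \<in> {1..n} \<Longrightarrow> \<sigma> (x i) = \<tau> (x i)" "z \<in> K"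
  shows "\<sigma> z = \<tau> z"
proof -
  have "complex_roots f \<subseteq> {z \<in> K. \<sigma> z = \<tau> z}"
  proof
    fix z assume "z \<in> complex_roots f"
    then obtain i where "i \<in> {1..n}" "z = x i" using bij_roots unfolding bij_betw_def by blast
    thus "z \<in> {z \<in> K. \<sigma> z = \<tau> z}" using assms(3) root_in_K by simp
  qed
  hence "K \<subseteq> {z \<in> K. \<sigma> z = \<tau> z}"
    using field_homs_equalizer_subfield[OF GalD(2)[OF assms(1)] GalD(2)[OF assms(2)] K_subfield]
    by (intro splitting_field_least)
  thus ?thesis using assms(4) by blast
qed

lemma galois_act:
  assumes "\<pi> \<in> galois_perms"
  shows "galois_act \<pi> \<in> Gal" "i \<in> {1..n} \<Longrightarrow> galois_act \<pi> (x i) = x (\<pi> i)"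
proof -
  have "\<exists>\<sigma>. \<sigma> \<in> Gal \<and> (\<forall>i\<in>{1..n}. \<sigma> (x i) = x (\<pi> i))"
    using assms unfolding galois_perms_def by blast
  hence *: "galois_act \<pi> \<in> Gal \<and> (\<forall>i\<in>{1..n}. galois_act \<pi> (x i) = x (\<pi> i))"
    unfolding galois_act_def by (rule someI_ex)
  show "galois_act \<pi> \<in> Gal" by (rule conjunct1[OF *])
  show "i \<in> {1..n} \<Longrightarrow> galois_act \<pi> (x i) = x (\<pi> i)" by (rule bspec[OF conjunct2[OF *]])
qed

lemma galois_act_unique:
  assumes "\<pi> \<in> galois_perms" "\<sigma> \<in> Gal" "\<And>i. i \<in> {1..n} \<Longrightarrow> \<sigma> (x i) = x (\<pi> i)" "z \<in> K"
  shows "galois_act \<pi> z = \<sigma> z"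
  by (rule Gal_eqI[OF galois_act(1)[OF assms(1)] assms(2) _ assms(4)])
     (simp only: galois_act(2)[OF assms(1)] assms(3))

lemma galois_permsI:
  assumes "\<pi> permutes {1..n}" "\<sigma> \<in> Gal" "\<And>i. i \<in> {1..n} \<Longrightarrow> \<sigma> (x i) = x (\<pi> i)"
  shows "\<pi> \<in> galois_perms"
  using assms unfolding galois_perms_def by blast

lemma perm_of_Gal:
  assumes "\<sigma> \<in> Gal"
  obtains \<pi> where "\<pi> \<in> galois_perms" "\<forall>i\<in>{1..n}. \<sigma> (x i) = x (\<pi> i)"
proof -
  define g where "g = inv_into {1..n} x"
  have g: "bij_betw g (complex_roots f) {1..n}" unfolding g_def by (rule bij_betw_inv_into[OF bij_roots])
  have xg: "x (g z) = z" if "z \<in> complex_roots f" for z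
    unfolding g_def using bij_roots that by (simp add: bij_betw_inv_into_right)
  have R: "\<sigma> ` complex_roots f \<subseteq> complex_roots f"
    using field_hom_on_root[OF GalD(2)[OF assms] K_subfield] complex_roots_in_splitting_field[of f] by auto
  have inj: "inj_on \<sigma> (complex_roots f)"
    using field_hom_on_inj[OF GalD(2)[OF assms] K_subfield] complex_roots_in_splitting_field[of f]
    by (rule inj_on_subset)
  have "\<sigma> ` complex_roots f = complex_roots f"
    using R inj finite_complex_roots[OF f_nz] by (simp add: card_image card_subset_eq)
  hence "bij_betw \<sigma> (complex_roots f) (complex_roots f)" using inj by (simp add: bij_betw_def)
  hence bij: "bij_betw (g \<circ> (\<sigma> \<circ> x)) {1..n} {1..n}"
    using bij_betw_trans[OF bij_betw_trans[OF bij_roots] g] by (simp add: comp_assoc)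
  define \<pi> where "\<pi> = restrict_id (g \<circ> (\<sigma> \<circ> x)) {1..n}"
  have "\<pi> permutes {1..n}" unfolding \<pi>_def by (rule permutes_restrict_id[OF bij])
  moreover have "\<forall>i\<in>{1..n}. \<sigma> (x i) = x (\<pi> i)"
  proof
    fix i assume i: "i \<in> {1..n}"
    hence "x i \<in> complex_roots f" using bij_roots unfolding bij_betw_def by blast
    hence "\<sigma> (x i) \<in> complex_roots f" using R by blast
    thus "\<sigma> (x i) = x (\<pi> i)" using xg i by (simp add: \<pi>_def restrict_id_def)
  qed
  ultimately show ?thesis using that[of \<pi>] galois_permsI[of \<pi> \<sigma>] assms by blast
qed

lemma id_Gal: "restrict id K \<in> Gal"
  by (rule GalI) (auto simp: field_hom_on_def bij_betw_def)

lemma comp_Gal: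
  assumes "\<sigma> \<in> Gal" "\<tau> \<in> Gal"
  shows "restrict (\<sigma> \<circ> \<tau>) K \<in> Gal"
proof (rule GalI)
  show "bij_betw (\<sigma> \<circ> \<tau>) K K"
    using GalD(1)[OF assms(1)] GalD(1)[OF assms(2)] by (auto simp: Bij_def intro: bij_betw_trans)
  show "field_hom_on K (\<sigma> \<circ> \<tau>)"
    using GalD(2,3)[OF assms(1)] GalD(2,3)[OF assms(2)] unfolding field_hom_on_def by simp
qed

lemma inv_Gal:
  assumes "\<sigma> \<in> Gal"
  shows "restrict (inv_into K \<sigma>) K \<in> Gal"
proof (rule GalI)
  have bij: "bij_betw \<sigma> K K" using GalD(1)[OF assms] by (auto simp: Bij_def)
  show "bij_betw (inv_into K \<sigma>) K K" by (rule bij_betw_inv_into[OF bij])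
  have inv: "inv_into K \<sigma> (\<sigma> a) = a" if "a \<in> K" for a using bij that by (simp add: bij_betw_inv_into_left)
  note h = field_hom_onD[OF GalD(2)[OF assms] K_subfield] and KF = csubfieldD[OF K_subfield]
  show "field_hom_on K (inv_into K \<sigma>)"
    unfolding field_hom_on_def
  proof (intro conjI ballI)
    show "inv_into K \<sigma> 1 = 1" using inv[OF KF(2)] h(1) by simp
    fix a b assume "a \<in> K" "b \<in> K"
    then obtain a' b' where ab: "a' \<in> K" "b' \<in> K" "a = \<sigma> a'" "b = \<sigma> b'"
      using bij unfolding bij_betw_def by blast
    show "inv_into K \<sigma> (a + b) = inv_into K \<sigma> a + inv_into K \<sigma> b"
      using inv[OF KF(3)[OF ab(1,2)]] by (simp add: ab inv h)
    show "inv_into K \<sigma> (a * b) = inv_into K \<sigma> a * inv_into K \<sigma> b"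
      using inv[OF KF(4)[OF ab(1,2)]] by (simp add: ab inv h)
  qed
qed

lemma galois_perms_permutes: "\<pi> \<in> galois_perms \<Longrightarrow> \<pi> permutes {1..n}"
  by (simp add: galois_perms_def)

lemma galois_perms_id: "id \<in> galois_perms"
  by (rule galois_permsI[OF _ id_Gal]) (use root_in_K in \<open>auto simp: permutes_id\<close>)

lemma galois_perms_comp:
  assumes "\<pi> \<in> galois_perms" "\<rho> \<in> galois_perms" shows "\<pi> \<circ> \<rho> \<in> galois_perms"
proof (rule galois_permsI[OF _ comp_Gal[OF galois_act(1)[OF assms(1)] galois_act(1)[OF assms(2)]]])
  show "\<pi> \<circ> \<rho> permutes {1..n}"
    using assms by (intro permutes_compose galois_perms_permutes)
  fix i assume i: "i \<in> {1..n}"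
  hence "\<rho> i \<in> {1..n}" using permutes_in_image[OF galois_perms_permutes[OF assms(2)]] by blast
  thus "restrict (galois_act \<pi> \<circ> galois_act \<rho>) K (x i) = x ((\<pi> \<circ> \<rho>) i)"
    using i root_in_K by (simp add: galois_act(2)[OF assms(1)] galois_act(2)[OF assms(2)])
qed

lemma galois_perms_inv:
  assumes "\<pi> \<in> galois_perms" shows "inv' \<pi> \<in> galois_perms"
proof (rule galois_permsI[OF _ inv_Gal[OF galois_act(1)[OF assms]]])
  note perm = galois_perms_permutes[OF assms]
  show "inv' \<pi> permutes {1..n}" by (rule permutes_inv[OF perm])
  fix i assume i: "i \<in> {1..n}"
  hence i': "inv' \<pi> i \<in> {1..n}" using permutes_in_image[OF permutes_inv[OF perm]] by blast
  have "galois_act \<pi> (x (inv' \<pi> i)) = x i"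
    using galois_act(2)[OF assms i'] permutes_inverses(1)[OF perm] by simp
  moreover have "bij_betw (galois_act \<pi>) K K" using GalD(1)[OF galois_act(1)[OF assms]] by (simp add: Bij_def)
  ultimately have "inv_into K (galois_act \<pi>) (x i) = x (inv' \<pi> i)"
    using bij_betw_inv_into_left[of "galois_act \<pi>" K K "x (inv' \<pi> i)"] root_in_K[OF i'] by simp
  thus "restrict (inv_into K (galois_act \<pi>)) K (x i) = x (inv' \<pi> i)"
    using root_in_K[OF i] by simp
qed

text \<open>The two arithmetic axioms rest on one fact, that a rational algebraic integer is an
  integer: a fixed element is rational by \<open>galois_fixed_imp_Rats\<close>, and an inverse of a
  prime would be rational as well.\<close>

sublocale galois_action int_ring n x galois_perms galois_act
proof
  note KF = csubfieldD[OF K_subfield]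
  note hom = field_hom_onD[OF GalD(2)[OF galois_act(1)] K_subfield]
  show "of_int k \<in> int_ring" for k by (simp add: int_ring_def csubfield_of_int[OF K_subfield])
  show "a + b \<in> int_ring" "a * b \<in> int_ring" if "a \<in> int_ring" "b \<in> int_ring" for a b
    using that KF by (auto simp: int_ring_def algebraic_int_add algebraic_int_mult)
  show "\<pi> permutes {1..n}" if "\<pi> \<in> galois_perms" for \<pi> using galois_perms_permutes[OF that] .
  show "id \<in> galois_perms" by (rule galois_perms_id)
  show "\<pi> \<circ> \<rho> \<in> galois_perms" if "\<pi> \<in> galois_perms" "\<rho> \<in> galois_perms" for \<pi> \<rho>
    using galois_perms_comp[OF that] .
  show "inv' \<pi> \<in> galois_perms" if "\<pi> \<in> galois_perms" for \<pi> using galois_perms_inv[OF that] .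
  show "galois_act \<pi> a \<in> int_ring" if "\<pi> \<in> galois_perms" "a \<in> int_ring" for \<pi> a
    using that(2) GalD(3)[OF galois_act(1)[OF that(1)]]
      field_hom_on_algebraic_int[OF GalD(2)[OF galois_act(1)[OF that(1)]] K_subfield]
    by (simp add: int_ring_def)
  show "galois_act \<pi> (a + b) = galois_act \<pi> a + galois_act \<pi> b"
    "galois_act \<pi> (a * b) = galois_act \<pi> a * galois_act \<pi> b"
    if "\<pi> \<in> galois_perms" "a \<in> int_ring" "b \<in> int_ring" for \<pi> a b
    using that hom(3,4)[OF that(1)] by (auto simp: int_ring_def)
  show "galois_act \<pi> (of_int k) = of_int k" if "\<pi> \<in> galois_perms" for \<pi> k
    using field_hom_on_of_int[OF GalD(2)[OF galois_act(1)[OF that]] K_subfield] .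
  show "galois_act id a = a" if a: "a \<in> int_ring" for a
  proof -
    have "a \<in> K" using a by (simp add: int_ring_def)
    thus ?thesis using galois_act_unique[OF galois_perms_id id_Gal _ \<open>a \<in> K\<close>] root_in_K by simp
  qed
  show "galois_act (\<pi> \<circ> \<rho>) a = galois_act \<pi> (galois_act \<rho> a)"
    if \<pi>: "\<pi> \<in> galois_perms" and \<rho>: "\<rho> \<in> galois_perms" and a: "a \<in> int_ring" for \<pi> \<rho> a
  proof -
    have aK: "a \<in> K" using a by (simp add: int_ring_def)
    have "galois_act (\<pi> \<circ> \<rho>) a = restrict (galois_act \<pi> \<circ> galois_act \<rho>) K a"
    proof (rule galois_act_unique[OF galois_perms_comp[OF \<pi> \<rho>] comp_Gal[OF galois_act(1)[OF \<pi>] galois_act(1)[OF \<rho>]] _ aK])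
      fix i assume i: "i \<in> {1..n}"
      hence "\<rho> i \<in> {1..n}" using permutes_in_image[OF galois_perms_permutes[OF \<rho>]] by blast
      thus "restrict (galois_act \<pi> \<circ> galois_act \<rho>) K (x i) = x ((\<pi> \<circ> \<rho>) i)"
        using i root_in_K by (simp add: galois_act(2)[OF \<pi>] galois_act(2)[OF \<rho>])
    qed
    thus ?thesis using aK by simp
  qed
  show "x i \<in> int_ring" if "i \<in> {1..n}" for i
    using root_in_K[OF that] roots_integral[OF that] by (simp add: int_ring_def)
  show "galois_act \<pi> (x i) = x (\<pi> i)" if "\<pi> \<in> galois_perms" "i \<in> {1..n}" for \<pi> i
    using galois_act(2)[OF that] .
  show "inj_on x {1..n}" using bij_roots by (simp add: bij_betw_def)
  show "a \<in> \<int>" if a: "a \<in> int_ring" and fixed: "\<And>\<pi>. \<pi> \<in> galois_perms \<Longrightarrow> galois_act \<pi> a = a" for a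
  proof -
    have aK: "a \<in> K" "algebraic_int a" using a by (auto simp: int_ring_def)
    have "\<sigma> a = a" if \<sigma>: "\<sigma> \<in> Gal" for \<sigma>
    proof -
      obtain \<pi> where \<pi>: "\<pi> \<in> galois_perms" "\<forall>i\<in>{1..n}. \<sigma> (x i) = x (\<pi> i)"
        by (rule perm_of_Gal[OF \<sigma>])
      have "galois_act \<pi> a = \<sigma> a" using \<pi> by (intro galois_act_unique[OF \<pi>(1) \<sigma> _ aK(1)]) simp
      thus ?thesis using fixed[OF \<pi>(1)] by simp
    qed
    hence "a \<in> \<rat>" using aK by (intro galois_fixed_imp_Rats[OF f_nz]) auto
    thus ?thesis using aK(2) rational_algebraic_int_is_int by blast
  qed
  show "of_int q * a \<noteq> 1" if q: "prime (q :: int)" and a: "a \<in> int_ring" for q a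
  proof
    assume 1: "of_int q * a = 1"
    have "q > 0" using q by (rule prime_gt_0_int)
    hence "a = 1 / of_int q" using 1 by (simp add: field_simps)
    hence "a \<in> \<rat>" by simp
    hence "a \<in> \<int>" using a rational_algebraic_int_is_int by (auto simp: int_ring_def)
    then obtain k where "a = of_int k" by (elim Ints_cases)
    hence "of_int (q * k) = (1 :: complex)" using 1 by simp
    hence "q * k = 1" by (simp only: of_int_eq_1_iff)
    thus False using q by (metis dvd_triv_left not_prime_unit)
  qed
qed

text \<open>Conjugation by the labelling \<open>x\<close>: the map \<open>\<Phi>\<close> is
  determined by \<open>\<Phi> \<pi> (x i) = x (\<pi> i)\<close>, which yields multiplicativity and
  injectivity; surjectivity is \<open>perm_of_Gal\<close>.\<close>

lemma poly_galois_group_iso_alt_group: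
  assumes "galois_perms = carrier (alt_group n)"
  shows "poly_galois_group f \<cong> alt_group n"
proof -
  let ?R = "complex_roots f"
  define \<Phi> where "\<Phi> = (\<lambda>\<pi>. restrict (galois_act \<pi>) ?R)"
  have xR: "x i \<in> ?R" if "i \<in> {1..n}" for i using that bij_roots by (auto simp: bij_betw_def)
  have Rx: "\<exists>i\<in>{1..n}. z = x i" if "z \<in> ?R" for z using that bij_roots by (auto simp: bij_betw_def)
  have \<Phi>x: "\<Phi> \<pi> (x i) = x (\<pi> i)" if "\<pi> \<in> galois_perms" "i \<in> {1..n}" for \<pi> i
    using that galois_act(2) xR by (simp add: \<Phi>_def)
  have carr: "carrier (poly_galois_group f) = (\<lambda>\<sigma>. restrict \<sigma> ?R) ` Gal"
    by (simp add: poly_galois_group_def)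
  have \<Phi>_Bij: "\<Phi> \<pi> \<in> Bij ?R" if \<pi>: "\<pi> \<in> galois_perms" for \<pi>
  proof -
    have perm: "\<pi> permutes {1..n}" using galois_perms_permutes[OF \<pi>] .
    have "bij_betw (\<Phi> \<pi> \<circ> x) {1..n} ?R"
      using bij_betw_trans[OF permutes_imp_bij[OF perm] bij_roots] \<Phi>x[OF \<pi>] by (subst bij_betw_cong[of _ _ "x \<circ> \<pi>"]) auto
    hence "bij_betw (\<Phi> \<pi>) ?R ?R" using bij_betw_comp_iff[OF bij_roots] by blast
    thus ?thesis by (simp add: Bij_def \<Phi>_def)
  qed
  have "\<Phi> \<in> iso (alt_group n) (poly_galois_group f)"
  proof (rule isoI)
    show "\<Phi> \<in> hom (alt_group n) (poly_galois_group f)"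
    proof (rule homI)
      fix \<pi> assume "\<pi> \<in> carrier (alt_group n)"
      thus "\<Phi> \<pi> \<in> carrier (poly_galois_group f)"
        using galois_act(1) assms unfolding carr \<Phi>_def by blast
    next
      fix \<pi> \<rho> assume "\<pi> \<in> carrier (alt_group n)" "\<rho> \<in> carrier (alt_group n)"
      hence \<pi>: "\<pi> \<in> galois_perms" and \<rho>: "\<rho> \<in> galois_perms" using assms by auto
      have "\<Phi> (\<pi> \<circ> \<rho>) = compose ?R (\<Phi> \<pi>) (\<Phi> \<rho>)"
      proof (rule extensionalityI[of _ ?R])
        fix z assume "z \<in> ?R"
        then obtain i where i: "i \<in> {1..n}" "z = x i" using Rx by blast
        hence "\<rho> i \<in> {1..n}" using permutes_in_image[OF galois_perms_permutes[OF \<rho>]] by blast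
        thus "\<Phi> (\<pi> \<circ> \<rho>) z = compose ?R (\<Phi> \<pi>) (\<Phi> \<rho>) z"
          using \<open>z \<in> ?R\<close> \<Phi>x[OF galois_perms_comp[OF \<pi> \<rho>] i(1)] \<Phi>x[OF \<rho> i(1)] \<Phi>x[OF \<pi>] i(2)
          by (simp add: compose_eq)
      qed (simp_all add: \<Phi>_def)
      thus "\<Phi> (\<pi> \<otimes>\<^bsub>alt_group n\<^esub> \<rho>) = \<Phi> \<pi> \<otimes>\<^bsub>poly_galois_group f\<^esub> \<Phi> \<rho>"
        using \<Phi>_Bij[OF \<pi>] \<Phi>_Bij[OF \<rho>]
        by (simp add: alt_group_mult poly_galois_group_def BijGroup_def)
    qed
    show "bij_betw \<Phi> (carrier (alt_group n)) (carrier (poly_galois_group f))"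
      unfolding bij_betw_def assms[symmetric]
    proof
      show "inj_on \<Phi> galois_perms"
      proof (rule inj_onI)
        fix \<pi> \<rho> assume \<pi>: "\<pi> \<in> galois_perms" and \<rho>: "\<rho> \<in> galois_perms" and eq: "\<Phi> \<pi> = \<Phi> \<rho>"
        note perm = galois_perms_permutes[OF \<pi>] galois_perms_permutes[OF \<rho>]
        show "\<pi> = \<rho>"
        proof
          fix i
          show "\<pi> i = \<rho> i"
          proof (cases "i \<in> {1..n}")
            case True
            hence "x (\<pi> i) = x (\<rho> i)" using \<Phi>x[OF \<pi> True] \<Phi>x[OF \<rho> True] eq by simp
            thus ?thesis using True permutes_in_image[OF perm(1)] permutes_in_image[OF perm(2)] bij_roots
              unfolding bij_betw_def inj_on_def by blast
          next
            case False
            thus ?thesis using perm by (simp add: permutes_not_in)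
          qed
        qed
      qed
      show "\<Phi> ` galois_perms = carrier (poly_galois_group f)"
      proof
        show "\<Phi> ` galois_perms \<subseteq> carrier (poly_galois_group f)"
          unfolding carr \<Phi>_def using galois_act(1) by blast
        show "carrier (poly_galois_group f) \<subseteq> \<Phi> ` galois_perms"
        proof
          fix g assume "g \<in> carrier (poly_galois_group f)"
          then obtain \<sigma> where \<sigma>: "\<sigma> \<in> Gal" "g = restrict \<sigma> ?R" unfolding carr by blast
          obtain \<pi> where \<pi>: "\<pi> \<in> galois_perms" "\<forall>i\<in>{1..n}. \<sigma> (x i) = x (\<pi> i)"
            by (rule perm_of_Gal[OF \<sigma>(1)])
          have "g = \<Phi> \<pi>"
            unfolding \<sigma>(2) \<Phi>_def
          proof (rule restrict_ext)
            fix z assume "z \<in> ?R"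
            then obtain i where "i \<in> {1..n}" "z = x i" using Rx by blast
            thus "\<sigma> z = galois_act \<pi> z" using \<pi> galois_act(2)[OF \<pi>(1)] by simp
          qed
          thus "g \<in> \<Phi> ` galois_perms" using \<pi>(1) by blast
        qed
      qed
    qed
  qed
  hence "alt_group n \<cong> poly_galois_group f" unfolding is_iso_def by blast
  thus ?thesis using group.iso_sym[OF alt_group_is_group] by blast
qed

end

section \<open>Permutation groups containing a 3-cycle\<close>

lemma cycle_of_three:
  assumes "distinct [a, b, c]"
  shows "cycle_of_list [a, b, c] a = b" "cycle_of_list [a, b, c] b = c" "cycle_of_list [a, b, c] c = a"
    "\<And>z. z \<notin> {a, b, c} \<Longrightarrow> cycle_of_list [a, b, c] z = z"
  using assms by (auto simp: transpose_def)

lemma eq_cycle_of_three: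
  assumes "distinct [a, b, c]" "\<pi> a = b" "\<pi> b = c" "\<pi> c = a" "\<And>z. z \<notin> {a, b, c} \<Longrightarrow> \<pi> z = z"
  shows "\<pi> = cycle_of_list [a, b, c]"
proof
  fix z
  consider "z = a" | "z = b" | "z = c" | "z \<notin> {a, b, c}" by blast
  thus "\<pi> z = cycle_of_list [a, b, c] z"
    by cases (simp_all only: assms(2-5) cycle_of_three[OF assms(1)] not_False_eq_True)
qed

text \<open>If one of the points were fixed, \<open>\<pi>\<close> would permute at most two points
  and be the identity or an odd transposition. So all three points exist and are moved, and a
  permutation of three points without fixed points is a 3-cycle.\<close>

lemma even_permutes_three:
  assumes perm: "\<pi> permutes S" and S: "finite S" "card S \<le> 3" and even: "evenperm \<pi>" and "\<pi> \<noteq> id"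
  shows "\<exists>a b c. distinct [a, b, c] \<and> \<pi> = cycle_of_list [a, b, c]"
proof -
  have small: False if p: "\<pi> permutes U" and U: "finite U" "card U \<le> 2" for U
  proof -
    have "card U = 0 \<or> card U = 1 \<or> card U = 2" using U(2) by linarith
    then consider "U = {}" | a where "U = {a}" | a b where "U = {a, b}" "a \<noteq> b"
      using U(1) by (auto simp: card_1_singleton_iff card_2_iff)
    thus False
    proof cases
      case 3
      hence "\<pi> = Transposition.transpose a b" using p \<open>\<pi> \<noteq> id\<close> permutes_doubleton_iff by metis
      thus False using even 3(2) by (simp add: evenperm_swap)
    qed (use p \<open>\<pi> \<noteq> id\<close> in auto)
  qed
  have nofix: "\<pi> a \<noteq> a" if "a \<in> S" for a
  proof
    assume "\<pi> a = a"
    hence "\<pi> permutes (S - {a})" by (intro permutes_superset[OF perm]) auto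
    moreover have "card (S - {a}) \<le> 2" using S that by (simp add: card_Diff_singleton)
    ultimately show False using small[of "S - {a}"] S(1) by blast
  qed
  have "\<not> card S \<le> 2" using small[OF perm S(1)] by blast
  hence "card S = 3" using S(2) by linarith
  then obtain a b c where abc: "S = {a, b, c}" "distinct [a, b, c]"
    by (auto simp: card_3_iff)
  have inj: "\<pi> u = \<pi> v \<Longrightarrow> u = v" for u v using permutes_inj[OF perm] by (auto dest: injD)
  have img: "\<pi> a \<in> {a, b, c}" "\<pi> b \<in> {a, b, c}" "\<pi> c \<in> {a, b, c}"
    using permutes_in_image[OF perm] abc by auto
  have out: "\<pi> z = z" if "z \<notin> {a, b, c}" for z using permutes_not_in[OF perm] that abc by simp
  have nf: "\<pi> a \<noteq> a" "\<pi> b \<noteq> b" "\<pi> c \<noteq> c" using nofix abc by auto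
  show ?thesis
  proof (cases "\<pi> a = b")
    case True
    hence c: "\<pi> c = a" using img nf inj[of c a] abc(2) by auto
    hence b: "\<pi> b = c" using img nf inj[of b c] abc(2) by auto
    have "\<pi> = cycle_of_list [a, b, c]"
      using True b c out by (intro eq_cycle_of_three[OF abc(2)]) auto
    thus ?thesis using abc(2) by blast
  next
    case False
    hence 1: "\<pi> a = c" using img nf by auto
    hence 2: "\<pi> b = a" using img nf inj[of b a] abc(2) by auto
    hence 3: "\<pi> c = b" using 1 img nf inj[of c b] abc(2) by auto
    have "distinct [a, c, b]" using abc(2) by auto
    moreover have "\<pi> = cycle_of_list [a, c, b]"
      using 1 2 3 out by (intro eq_cycle_of_three[OF \<open>distinct [a, c, b]\<close>]) auto
    ultimately show ?thesis by blast
  qed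
qed

locale perm_group =
  fixes G :: "(nat \<Rightarrow> nat) set" and n :: nat
  assumes perm: "\<pi> \<in> G \<Longrightarrow> \<pi> permutes {1..n}"
    and id_mem: "id \<in> G"
    and comp_mem: "\<pi> \<in> G \<Longrightarrow> \<rho> \<in> G \<Longrightarrow> \<pi> \<circ> \<rho> \<in> G"
    and inv_mem: "\<pi> \<in> G \<Longrightarrow> inv' \<pi> \<in> G"
begin

definition tri :: "nat \<Rightarrow> nat \<Rightarrow> nat \<Rightarrow> bool" where
  "tri a b c \<longleftrightarrow> distinct [a, b, c] \<and> cycle_of_list [a, b, c] \<in> G"

text \<open>Two points are linked when a 3-cycle of \<open>G\<close> sends one to the other. This is
  an equivalence relation preserved by \<open>G\<close>, so its classes are blocks.\<close>

definition linked :: "nat \<Rightarrow> nat \<Rightarrow> bool" where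
  "linked a b \<longleftrightarrow> a = b \<or> (\<exists>c. tri a b c)"

lemma tri_distinct: "tri a b c \<Longrightarrow> distinct [a, b, c]"
  by (simp add: tri_def)

lemma tri_rotate: "tri a b c \<Longrightarrow> tri b c a"
proof -
  assume t: "tri a b c"
  hence d: "distinct [a, b, c]" by (rule tri_distinct)
  have "cycle_of_list [a, b, c] = cycle_of_list [b, c, a]"
    using cycle_of_three[OF d] d by (intro eq_cycle_of_three) auto
  thus ?thesis using t by (auto simp: tri_def simp del: cycle_of_list.simps)
qed

lemma tri_swap: "tri a b c \<Longrightarrow> tri b a c"
proof -
  assume t: "tri a b c"
  hence d: "distinct [a, b, c]" by (rule tri_distinct)
  have "inv' (cycle_of_list [a, b, c]) = cycle_of_list [b, a, c]"
  proof (rule eq_cycle_of_three)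
    have bij: "bij (cycle_of_list [a, b, c])" using permutation_bijective[OF permutation_of_cycle] .
    have inv: "inv' (cycle_of_list [a, b, c]) v = u" if "cycle_of_list [a, b, c] u = v" for u v
      by (rule inv_f_eq[OF bij_is_inj[OF bij] that])
    show "distinct [b, a, c]" using d by auto
    show "inv' (cycle_of_list [a, b, c]) b = a" by (rule inv[OF cycle_of_three(1)[OF d]])
    show "inv' (cycle_of_list [a, b, c]) a = c" by (rule inv[OF cycle_of_three(3)[OF d]])
    show "inv' (cycle_of_list [a, b, c]) c = b" by (rule inv[OF cycle_of_three(2)[OF d]])
    show "inv' (cycle_of_list [a, b, c]) z = z" if "z \<notin> {b, a, c}" for z
      using that by (intro inv[OF cycle_of_three(4)[OF d]]) auto
  qed
  thus ?thesis using t inv_mem[of "cycle_of_list [a, b, c]"] by (auto simp: tri_def simp del: cycle_of_list.simps)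
qed

lemma tri_conj:
  assumes "tri a b c" "\<pi> \<in> G"
  shows "tri (\<pi> a) (\<pi> b) (\<pi> c)"
proof -
  have bij: "bij \<pi>" using permutes_bij[OF perm[OF assms(2)]] .
  have d: "distinct [a, b, c]" using assms(1) by (rule tri_distinct)
  have "\<pi> \<circ> cycle_of_list [a, b, c] \<circ> inv' \<pi> = cycle_of_list (map \<pi> [a, b, c])"
    by (rule conjugation_of_cycle[OF d bij])
  moreover have "\<pi> \<circ> cycle_of_list [a, b, c] \<circ> inv' \<pi> \<in> G"
    using assms by (intro comp_mem inv_mem) (auto simp: tri_def simp del: cycle_of_list.simps)
  moreover have "distinct (map \<pi> [a, b, c])" using d bij_is_inj[OF bij] by (auto dest: injD)
  ultimately show ?thesis by (simp add: tri_def del: cycle_of_list.simps)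
qed

lemma tri_in: "tri a b c \<Longrightarrow> a \<in> {1..n}"
proof (rule ccontr)
  assume t: "tri a b c" and a: "a \<notin> {1..n}"
  have "cycle_of_list [a, b, c] permutes {1..n}" using t unfolding tri_def by (intro perm) (rule conjunct2)
  hence "cycle_of_list [a, b, c] a = a" using a by (rule permutes_not_in)
  thus False using cycle_of_three(1)[OF tri_distinct[OF t]] tri_distinct[OF t] by simp
qed

lemma linked_sym: "linked a b \<Longrightarrow> linked b a"
  unfolding linked_def using tri_swap by blast

lemma linked_conj: "linked a b \<Longrightarrow> \<pi> \<in> G \<Longrightarrow> linked (\<pi> a) (\<pi> b)"
  unfolding linked_def using tri_conj by blast

text \<open>Conjugating the cycle (a b c) by (b d e) fixes \<open>a\<close> and sends
  \<open>b\<close> to \<open>d\<close>, provided \<open>a\<close> differs from \<open>e\<close>;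
  otherwise (b d e) itself links \<open>a\<close> and \<open>d\<close>.\<close>

lemma linked_trans:
  assumes "linked a b" "linked b d"
  shows "linked a d"
proof (cases "a = b \<or> b = d \<or> a = d")
  case True
  thus ?thesis using assms by (auto simp: linked_def)
next
  case False
  then obtain c e where c: "tri a b c" and e: "tri b d e" using assms unfolding linked_def by blast
  have de: "distinct [b, d, e]" using tri_distinct[OF e] .
  show ?thesis
  proof (cases "a = e")
    case True
    thus ?thesis using tri_swap[OF tri_rotate[OF e]] unfolding linked_def by blast
  next
    case ae: False
    let ?s = "cycle_of_list [b, d, e]"
    have "?s a = a" using cycle_of_three(4)[OF de, of a] ae False by simp
    moreover have "?s b = d" by (rule cycle_of_three(1)[OF de])
    moreover have "?s \<in> G" using e by (simp add: tri_def del: cycle_of_list.simps)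
    ultimately have "tri a d (?s c)" using tri_conj[OF c, of ?s] by simp
    thus ?thesis unfolding linked_def by blast
  qed
qed

text \<open>Linking gives a cycle (a b c) whose third entry is not under control. A cycle (c d e)
  replaces \<open>c\<close> by \<open>d\<close> through conjugation, as long as it fixes
  \<open>a\<close> and \<open>b\<close>.\<close>

lemma tri_all:
  assumes link: "\<And>a b. a \<in> {1..n} \<Longrightarrow> b \<in> {1..n} \<Longrightarrow> linked a b"
    and d: "distinct [a, b, d]" and mem: "a \<in> {1..n}" "b \<in> {1..n}" "d \<in> {1..n}"
  shows "tri a b d"
proof -
  obtain c where c: "tri a b c" using link[OF mem(1,2)] d unfolding linked_def by auto
  show ?thesis
  proof (cases "c = d")
    case True
    thus ?thesis using c by simp
  next
    case False
    have "c \<in> {1..n}" using tri_in[OF tri_rotate[OF tri_rotate[OF c]]] .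
    then obtain e where e: "tri c d e" using link[OF _ mem(3)] False unfolding linked_def by blast
    \<comment> \<open>If the replacing cycle runs through \<open>a\<close>, two conjugations are
      needed: (c d a) turns (a b c) into (c b d), and (b a c) turns that into (b a d). The case of
      \<open>b\<close> follows by exchanging the roles of \<open>a\<close> and
      \<open>b\<close>.\<close>
    have via: "tri a b d" if c: "tri a b c" and e: "tri c d a" and d: "distinct [a, b, d]" for a b
    proof -
      have dc: "distinct [a, b, c]" and dd: "distinct [c, d, a]" using tri_distinct[OF c] tri_distinct[OF e] by auto
      have 1: "tri (cycle_of_list [c, d, a] a) (cycle_of_list [c, d, a] b) (cycle_of_list [c, d, a] c)"
        using e by (intro tri_conj[OF c]) (simp add: tri_def del: cycle_of_list.simps)
      have "cycle_of_list [c, d, a] b = b" using dc d by (intro cycle_of_three(4)[OF dd]) auto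
      hence cbd: "tri c b d" using 1 by (simp only: cycle_of_three[OF dd])
      have bac: "tri b a c" using tri_swap[OF c] .
      have db: "distinct [b, a, c]" using tri_distinct[OF bac] .
      have 2: "tri (cycle_of_list [b, a, c] c) (cycle_of_list [b, a, c] b) (cycle_of_list [b, a, c] d)"
        using bac by (intro tri_conj[OF cbd]) (simp add: tri_def del: cycle_of_list.simps)
      have "cycle_of_list [b, a, c] d = d" using dd d by (intro cycle_of_three(4)[OF db]) auto
      hence "tri b a d" using 2 by (simp only: cycle_of_three[OF db])
      thus ?thesis by (rule tri_swap)
    qed
    consider "e = a" | "e = b" | "e \<noteq> a" "e \<noteq> b" by blast
    thus ?thesis
    proof cases
      case 1
      thus ?thesis using via[OF c _ d] e by simp
    next
      case 2
      have "distinct [b, a, d]" using d by auto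
      hence "tri b a d" using via[OF tri_swap[OF c], of] e 2 by simp
      thus ?thesis by (rule tri_swap)
    next
      case 3
      let ?s = "cycle_of_list [c, d, e]"
      have de: "distinct [c, d, e]" using tri_distinct[OF e] .
      have "?s a = a" "?s b = b" using 3 d tri_distinct[OF c] by (auto intro!: cycle_of_three(4)[OF de])
      moreover have "tri (?s a) (?s b) (?s c)"
        using e by (intro tri_conj[OF c]) (simp add: tri_def del: cycle_of_list.simps)
      ultimately show ?thesis by (simp only: cycle_of_three(1)[OF de])
    qed
  qed
qed

text \<open>Primitivity enters only through \<open>linked\<close>. By transitivity a point outside
  \<open>S\<close> lies on some 3-cycle of \<open>G\<close>; at most two points lie outside
  \<open>S\<close>, so the cycle meets \<open>S\<close>. Since \<open>H\<close> fixes the outside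
  point and is transitive on \<open>S\<close>, that point is linked to all of \<open>S\<close>.
  Hence any two points are linked, every 3-cycle is in \<open>G\<close>, and 3-cycles generate the
  alternating group.\<close>

lemma alt_group_subset:
  assumes trans: "\<And>i j. i \<in> {1..n} \<Longrightarrow> j \<in> {1..n} \<Longrightarrow> \<exists>\<pi>\<in>G. \<pi> i = j"
    and tri: "tri a b c"
    and H: "H \<subseteq> G" "\<And>\<pi> i. \<pi> \<in> H \<Longrightarrow> i \<in> {1..n} - S \<Longrightarrow> \<pi> i = i"
      "\<And>i j. i \<in> S \<Longrightarrow> j \<in> S \<Longrightarrow> \<exists>\<pi>\<in>H. \<pi> i = j"
    and S: "card ({1..n} - S) \<le> 2" "u \<in> {1..n} - S"
  shows "carrier (alt_group n) \<subseteq> G"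
proof -
  have link_S: "linked v t" if v: "v \<in> {1..n} - S" and t: "t \<in> S" for v t
  proof -
    have "a \<in> {1..n}" by (rule tri_in[OF tri])
    then obtain \<pi> where "\<pi> \<in> G" "\<pi> a = v" using trans[of a v] v by blast
    then obtain p q where pq: "tri v p q" using tri_conj[OF tri, of \<pi>] by blast
    have "p \<in> S \<or> q \<in> S"
    proof (rule ccontr)
      assume "\<not> (p \<in> S \<or> q \<in> S)"
      moreover have "p \<in> {1..n}" "q \<in> {1..n}" using tri_in[OF tri_rotate[OF pq]] tri_in[OF tri_rotate[OF tri_rotate[OF pq]]] .
      ultimately have "{v, p, q} \<subseteq> {1..n} - S" using v by auto
      hence "card {v, p, q} \<le> 2" using card_mono[of "{1..n} - S" "{v, p, q}"] S(1) by simp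
      thus False using tri_distinct[OF pq] by simp
    qed
    moreover have "linked v p" "linked v q"
      using pq tri_swap[OF tri_rotate[OF tri_rotate[OF pq]]] unfolding linked_def by blast+
    ultimately obtain s where s: "s \<in> S" "linked v s" by blast
    then obtain \<rho> where \<rho>: "\<rho> \<in> H" "\<rho> s = t" using H(3)[OF _ t] by blast
    have "linked (\<rho> v) (\<rho> s)" using linked_conj[OF s(2)] \<rho>(1) H(1) by blast
    thus ?thesis using H(2)[OF \<rho>(1) v] \<rho>(2) by simp
  qed
  have u: "linked u v" if v: "v \<in> {1..n}" for v
  proof (cases "v \<in> S")
    case True
    thus ?thesis using link_S[OF S(2)] by blast
  next
    case False
    show ?thesis
    proof (cases "S = {}")
      case True
      hence "{1..n} - S = {1..n}" by simp
      hence "n \<le> 2" using S(1) by simp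
      moreover have "{a, b, c} \<subseteq> {1..n}"
        using tri_in[OF tri] tri_in[OF tri_rotate[OF tri]] tri_in[OF tri_rotate[OF tri_rotate[OF tri]]] by blast
      hence "card {a, b, c} \<le> n" using card_mono[of "{1..n}" "{a, b, c}"] by simp
      ultimately show ?thesis using tri_distinct[OF tri] by simp
    next
      case False
      then obtain s where "s \<in> S" by blast
      thus ?thesis using link_S[of v s] link_S[OF S(2), of s] v \<open>v \<notin> S\<close> linked_sym[of v s] linked_trans[of u s v] by blast
    qed
  qed
  have all: "linked v w" if "v \<in> {1..n}" "w \<in> {1..n}" for v w
    by (rule linked_trans[OF linked_sym[OF u[OF that(1)]] u[OF that(2)]])
  have three: "three_cycles n \<subseteq> G"
  proof
    fix \<pi> assume "\<pi> \<in> three_cycles n"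
    then obtain cs where cs: "\<pi> = cycle_of_list cs" "cycle cs" "length cs = 3" "set cs \<subseteq> {1..n}" by auto
    obtain p q r where pqr: "cs = [p, q, r]" using stupid_lemma[OF cs(3)] by blast
    have "tri p q r" using cs(2,4) pqr by (intro tri_all[OF all]) auto
    thus "\<pi> \<in> G" using cs(1) pqr by (simp add: tri_def del: cycle_of_list.simps)
  qed
  have "\<pi> \<in> G" if "\<pi> \<in> generate (alt_group n) (three_cycles n)" for \<pi>
    using that
  proof induction
    case one
    show ?case unfolding alt_group_one by (rule id_mem)
  next
    case (incl h)
    thus ?case using three by blast
  next
    case (inv h)
    hence "h \<in> carrier (alt_group n)" using three_cycles_incl by blast
    moreover have "h \<in> G" using inv three by blast
    ultimately show ?case by (simp add: alt_group_inv_equality inv_mem)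
  next
    case (eng h1 h2)
    show ?case unfolding alt_group_mult by (rule comp_mem[OF eng.IH])
  qed
  thus ?thesis unfolding alt_group_carrier_as_three_cycles by blast
qed

end

section \<open>The square root of the discriminant\<close>

definition ordered_pairs :: "nat \<Rightarrow> (nat \<times> nat) set" where
  "ordered_pairs n = {(i, j). i \<in> {1..n} \<and> j \<in> {1..n} \<and> i < j}"

definition vandermonde_prod :: "nat \<Rightarrow> (nat \<Rightarrow> complex) \<Rightarrow> complex" where
  "vandermonde_prod n y = (\<Prod>(i, j)\<in>ordered_pairs n. y i - y j)"

lemma finite_ordered_pairs: "finite (ordered_pairs n)"
  by (rule finite_subset[of _ "{1..n} \<times> {1..n}"]) (auto simp: ordered_pairs_def)

text \<open>An adjacent transposition permutes the other ordered pairs without reversing any of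
  them, so just the factor of \<open>(k, Suc k)\<close> changes sign.\<close>

lemma vandermonde_prod_adjacent:
  assumes "k \<in> {1..n}" "Suc k \<in> {1..n}"
  shows "vandermonde_prod n (y \<circ> Transposition.transpose k (Suc k)) = - vandermonde_prod n y"
proof -
  let ?t = "Transposition.transpose k (Suc k)"
  let ?E = "ordered_pairs n - {(k, Suc k)}"
  have kE: "(k, Suc k) \<in> ordered_pairs n" using assms by (auto simp: ordered_pairs_def)
  have split: "vandermonde_prod n z = (z k - z (Suc k)) * (\<Prod>(i, j)\<in>?E. z i - z j)" for z
    unfolding vandermonde_prod_def
    using prod.remove[OF finite_ordered_pairs kE, of "\<lambda>(i, j). z i - z j"] by simp
  have mem: "(?t i, ?t j) \<in> ?E" if "(i, j) \<in> ?E" for i j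
    using that assms by (auto simp: ordered_pairs_def Transposition.transpose_def split: if_splits)
  have "(\<Prod>(i, j)\<in>?E. (y \<circ> ?t) i - (y \<circ> ?t) j) = (\<Prod>(i, j)\<in>?E. y i - y j)"
    by (rule prod.reindex_bij_witness[of _ "\<lambda>(i, j). (?t i, ?t j)" "\<lambda>(i, j). (?t i, ?t j)"])
       (use mem in auto)
  thus ?thesis unfolding split by (simp add: algebra_simps)
qed

lemma vandermonde_prod_apply_adj_transps:
  assumes "\<forall>k\<in>set ks. k \<in> {1..n} \<and> Suc k \<in> {1..n}"
  shows "vandermonde_prod n (y \<circ> apply_adj_transps ks) = (-1) ^ length ks * vandermonde_prod n y"
  using assms
proof (induction ks arbitrary: y)
  case (Cons k ks)
  have "y \<circ> apply_adj_transps (k # ks) = (y \<circ> Transposition.transpose k (Suc k)) \<circ> apply_adj_transps ks"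
    by (simp add: o_assoc)
  hence "vandermonde_prod n (y \<circ> apply_adj_transps (k # ks)) =
      (-1) ^ length ks * vandermonde_prod n (y \<circ> Transposition.transpose k (Suc k))"
    using Cons.IH[of "y \<circ> Transposition.transpose k (Suc k)"] Cons.prems by (simp only: list.set insert_iff) blast
  also have "vandermonde_prod n (y \<circ> Transposition.transpose k (Suc k)) = - vandermonde_prod n y"
    using Cons.prems by (intro vandermonde_prod_adjacent) auto
  also have "(-1) ^ length ks * - vandermonde_prod n y = (-1) ^ length (k # ks) * vandermonde_prod n y"
    by simp
  finally show ?case .
qed simp

text \<open>A transposition of \<open>a < b\<close> is a product of \<open>2 * (b - a) - 1\<close>
  adjacent ones, an odd number.\<close>

lemma vandermonde_prod_transpose:
  assumes "a \<in> {1..n}" "b \<in> {1..n}" "a \<noteq> b"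
  shows "vandermonde_prod n (y \<circ> Transposition.transpose a b) = - vandermonde_prod n y"
proof -
  have *: "vandermonde_prod n (y \<circ> Transposition.transpose a b) = - vandermonde_prod n y"
    if "a < b" "a \<in> {1..n}" "b \<in> {1..n}" for a b
  proof -
    have "\<forall>k\<in>set (adj_transp_seq a b). k \<in> {1..n} \<and> Suc k \<in> {1..n}"
      using that by (auto simp: set_adj_transp_seq)
    from vandermonde_prod_apply_adj_transps[OF this, of y]
    have "vandermonde_prod n (y \<circ> Transposition.transpose a b) =
        (-1) ^ (2 * (b - a) - 1) * vandermonde_prod n y"
      using that(1) by (simp add: adj_transp_seq_correct length_adj_transp_seq)
    moreover have "odd (2 * (b - a) - 1)" using that(1) by simp
    ultimately show ?thesis by simp
  qed
  show ?thesis using *[of a b] *[of b a] assms by (cases "a < b") (auto simp: transpose_commute)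
qed

lemma vandermonde_prod_permutes:
  assumes "\<pi> permutes {1..n}"
  shows "vandermonde_prod n (y \<circ> \<pi>) = of_int (sign \<pi>) * vandermonde_prod n y"
proof -
  have "finite {1..n}" by simp
  with assms have "\<forall>y. vandermonde_prod n (y \<circ> \<pi>) = of_int (sign \<pi>) * vandermonde_prod n y"
  proof (induction rule: permutes_induct)
    case id
    thus ?case by simp
  next
    case (swap a b \<rho>)
    have "permutation \<rho>" using swap.hyps(4) by (rule permutes_imp_permutation[rotated]) simp
    hence sgn: "sign (Transposition.transpose a b \<circ> \<rho>) = - sign \<rho>"
      using swap.hyps(3) by (simp add: sign_compose[OF permutation_swap_id] sign_swap_id)
    show ?case
    proof
      fix y
      have "vandermonde_prod n (y \<circ> (Transposition.transpose a b \<circ> \<rho>)) =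
          of_int (sign \<rho>) * vandermonde_prod n (y \<circ> Transposition.transpose a b)"
        using swap.IH unfolding o_assoc by blast
      thus "vandermonde_prod n (y \<circ> (Transposition.transpose a b \<circ> \<rho>)) =
          of_int (sign (Transposition.transpose a b \<circ> \<rho>)) * vandermonde_prod n y"
        unfolding sgn using vandermonde_prod_transpose[OF swap.hyps(1-3), of y] by simp
    qed
  qed
  thus ?thesis by blast
qed

lemma vandermonde_prod_nonzero:
  assumes "inj_on y {1..n}" shows "vandermonde_prod n y \<noteq> 0"
proof
  assume "vandermonde_prod n y = 0"
  then obtain i j where "(i, j) \<in> ordered_pairs n" "y i = y j"
    using finite_ordered_pairs[of n] unfolding vandermonde_prod_def by (auto simp: prod_zero_iff)
  thus False using inj_onD[OF assms, of i j] by (auto simp: ordered_pairs_def)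
qed

lemma off_diagonal_pairs:
  "Sigma {1..n} (\<lambda>i. {1..n} - {i}) = ordered_pairs n \<union> prod.swap ` ordered_pairs n"
  "ordered_pairs n \<inter> prod.swap ` ordered_pairs n = {}"
  by (auto simp: ordered_pairs_def image_iff)

lemma prod_differences:
  "(\<Prod>i\<in>{1..n}. \<Prod>j\<in>{1..n} - {i}. y i - y j) = (-1) ^ card (ordered_pairs n) * vandermonde_prod n y ^ 2"
proof -
  let ?E = "ordered_pairs n" and ?E' = "prod.swap ` ordered_pairs n"
  have "(\<Prod>i\<in>{1..n}. \<Prod>j\<in>{1..n} - {i}. y i - y j) = (\<Prod>(i, j)\<in>?E \<union> ?E'. y i - y j)"
    unfolding off_diagonal_pairs(1)[symmetric] by (rule prod.Sigma) auto
  also have "\<dots> = vandermonde_prod n y * (\<Prod>(i, j)\<in>?E'. y i - y j)"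
    unfolding vandermonde_prod_def using off_diagonal_pairs(2) finite_ordered_pairs by (intro prod.union_disjoint) auto
  also have "(\<Prod>(i, j)\<in>?E'. y i - y j) = (\<Prod>(i, j)\<in>?E. - (y i - y j))"
    by (subst prod.reindex) (auto simp: inj_on_def intro!: prod.cong)
  also have "\<dots> = (-1) ^ card ?E * vandermonde_prod n y"
    unfolding vandermonde_prod_def case_prod_unfold prod_uminus ..
  finally show ?thesis by (simp add: power2_eq_square)
qed

lemma card_ordered_pairs: "2 * card (ordered_pairs n) = n * (n - 1)"
proof -
  let ?E = "ordered_pairs n" and ?E' = "prod.swap ` ordered_pairs n"
  have "card (?E \<union> ?E') = card ?E + card ?E'"
    using off_diagonal_pairs(2) finite_ordered_pairs by (intro card_Un_disjoint) auto
  moreover have "card ?E' = card ?E" by (intro card_image) (auto simp: inj_on_def)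
  moreover have "card (Sigma {1..n} (\<lambda>i. {1..n} - {i})) = (\<Sum>i\<in>{1..n}. card ({1..n} - {i}))"
    by (rule card_SigmaI) auto
  moreover have "(\<Sum>i\<in>{1..n}. card ({1..n} - {i})) = n * (n - 1)" by simp
  ultimately show ?thesis unfolding off_diagonal_pairs(1) by simp
qed

context galois_action
begin

text \<open>Each \<open>\<pi>\<close> multiplies the product by \<open>sign \<pi>\<close> and fixes
  integers; as the roots are distinct, the product is nonzero and the sign must be 1.\<close>

lemma evenperm_if_vandermonde_Ints:
  assumes "vandermonde_prod n x \<in> \<int>" "\<pi> \<in> G"
  shows "evenperm \<pi>"
proof -
  obtain k where k: "vandermonde_prod n x = of_int k" using assms(1) by (elim Ints_cases)
  have "act \<pi> (vandermonde_prod n x) = (\<Prod>q\<in>ordered_pairs n. act \<pi> (x (fst q) - x (snd q)))"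
    unfolding vandermonde_prod_def case_prod_unfold
    using assms(2) root_in_A by (intro act_prod A_diff) (auto simp: ordered_pairs_def)
  also have "\<dots> = vandermonde_prod n (x \<circ> \<pi>)"
    unfolding vandermonde_prod_def case_prod_unfold
    using assms(2) root_in_A act_root by (intro prod.cong) (auto simp: ordered_pairs_def act_diff)
  also have "\<dots> = of_int (sign \<pi>) * vandermonde_prod n x"
    by (rule vandermonde_prod_permutes[OF G_permutes[OF assms(2)]])
  finally have "of_int (sign \<pi>) * vandermonde_prod n x = vandermonde_prod n x"
    using act_of_int[OF assms(2), of k] unfolding k by simp
  hence "of_int (sign \<pi>) = (1 :: complex)" using vandermonde_prod_nonzero[OF inj_roots] by simp
  hence "sign \<pi> = 1" by (simp only: of_int_eq_1_iff)
  thus ?thesis by (simp add: sign_def split: if_splits)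
qed

end

section \<open>The family of polynomials\<close>

text \<open>The scale common to the constants below. Up to squares, the discriminant is this scale
  times \<open>m\<close> times the sign (-1)^(n(n-1)/2); for odd \<open>m\<close> and n = m + 2 that
  sign is the one used here, so the choice yields a square.\<close>

definition line_sg :: "nat \<Rightarrow> int" where "line_sg m = (-1) ^ ((m + 1) div 2) * int m"
lemma not_dvd_line_sg: "\<not> p dvd int m \<Longrightarrow> \<not> p dvd line_sg m"
  by (cases "even ((m + 1) div 2)") (auto simp: line_sg_def)

text \<open>With P = X^m (X^2 + b) and Q = X^2 + g, the identity P'Q - PQ' = m X^(m-1) (X^2 + k)^2
  amounts to 2mk = (m+2)g + (m-2)b and k^2 = bg. Apart from b = g, where P/Q is just X^m, nonzero
  solutions satisfy b : k : g = (m+2)^2 : (m^2-4) : (m-2)^2. Only the scale is free.\<close>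

definition line_beta :: "nat \<Rightarrow> int" where "line_beta m = (int m + 2)\<^sup>2 * line_sg m"
definition line_gamma :: "nat \<Rightarrow> int" where "line_gamma m = (int m - 2)\<^sup>2 * line_sg m"
definition line_kappa :: "nat \<Rightarrow> int" where "line_kappa m = ((int m)\<^sup>2 - 4) * line_sg m"

definition line_P :: "nat \<Rightarrow> int poly" where "line_P m = monom 1 (m + 2) + monom (line_beta m) m"
definition line_Q :: "nat \<Rightarrow> int poly" where "line_Q m = [:line_gamma m, 0, 1:]"

definition line_poly :: "nat \<Rightarrow> int \<Rightarrow> complex poly" where
  "line_poly m t = monom 1 (m + 2) + monom (of_int (line_beta m)) m - smult (of_int t) [:of_int (line_gamma m), 0, 1:]"

lemma map_poly_line: "map_poly of_int (line_P m - smult t (line_Q m)) = line_poly m t"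
  by (intro poly_eqI)
     (simp add: line_P_def line_Q_def line_poly_def coeff_map_poly coeff_pCons coeff_monom split: nat.splits)

lemma poly_line_poly:
  "poly (line_poly m t) z = z ^ m * (z\<^sup>2 + of_int (line_beta m)) - of_int t * (z\<^sup>2 + of_int (line_gamma m))"
  by (simp add: line_poly_def poly_monom power_add algebra_simps power2_eq_square)

text \<open>In f'Q - fQ' with f = P - tQ the terms containing \<open>t\<close> cancel, so one
  identity describes the critical points of all members of the family.\<close>

lemma line_wronskian:
  assumes "m > 0"
  shows "pderiv (line_poly m t) * [:of_int (line_gamma m), 0, 1:] - line_poly m t * [:0, 2:] =
    smult (of_nat m) (monom 1 (m - 1) * [:of_int (line_kappa m), 0, 1:] ^ 2)"
proof (rule poly_ext)
  fix z :: complex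
  obtain k where k: "m = Suc k" using assms by (cases m) auto
  define w where "w = z ^ k"
  define c :: complex where "c = of_int (line_sg m)"
  define b :: complex where "b = of_nat m"
  have b: "line_gamma m = (int m - 2)\<^sup>2 * line_sg m" "line_beta m = (int m + 2)\<^sup>2 * line_sg m"
    "line_kappa m = ((int m)\<^sup>2 - 4) * line_sg m"
    by (simp_all add: line_gamma_def line_beta_def line_kappa_def)
  have gb: "of_int (line_gamma m) = (b - 2)\<^sup>2 * c" "of_int (line_beta m) = (b + 2)\<^sup>2 * c"
    "of_int (line_kappa m) = (b\<^sup>2 - 4) * c"
    unfolding b b_def c_def by simp_all
  have bk: "b = of_nat k + 1" by (simp add: b_def k)
  have zm: "z ^ m = w * z" by (simp add: w_def k mult.commute)
  have d: "poly (pderiv (line_poly m t)) z = (b + 2) * (w * z\<^sup>2) + b * of_int (line_beta m) * w - 2 * of_int t * z"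
    unfolding line_poly_def pderiv_add pderiv_diff pderiv_smult pderiv_monom
    by (simp add: poly_monom pderiv_pCons k w_def bk algebra_simps power2_eq_square)
  show "poly (pderiv (line_poly m t) * [:of_int (line_gamma m), 0, 1:] - line_poly m t * [:0, 2:]) z =
    poly (smult (of_nat m) (monom 1 (m - 1) * [:of_int (line_kappa m), 0, 1:] ^ 2)) z"
    unfolding poly_diff poly_mult d poly_line_poly poly_smult poly_monom poly_power zm b_def[symmetric] gb
    by (simp add: k w_def[symmetric] algebra_simps power2_eq_square)
qed

locale line_member = galois_action A n x G act
  for A :: "complex set" and n x G act +
  fixes m :: nat and t :: int
  assumes m_odd: "odd m" and n_eq: "n = m + 2"
    and factors: "line_poly m t = (\<Prod>i\<in>{1..n}. [:- x i, 1:])"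
begin

abbreviation "sg \<equiv> line_sg m"
abbreviation "\<beta> \<equiv> line_beta m"
abbreviation "\<gamma> \<equiv> line_gamma m"
abbreviation "\<kappa> \<equiv> line_kappa m"

text \<open>The value of the derivative of \<open>line_poly m t\<close> at the root
  \<open>x i\<close>.\<close>

definition "root_diff i = (\<Prod>j\<in>{1..n} - {i}. x i - x j)"

lemma m_pos: "m > 0"
  using m_odd by (cases m) auto

lemma prod_roots: "(\<Prod>i\<in>{1..n}. z - x i) = z ^ m * (z\<^sup>2 + of_int \<beta>) - of_int t * (z\<^sup>2 + of_int \<gamma>)"
proof -
  have "poly (line_poly m t) z = (\<Prod>i\<in>{1..n}. z - x i)"
    unfolding factors poly_prod by simp
  thus ?thesis unfolding poly_line_poly by simp
qed

lemma root_eq: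
  assumes "i \<in> {1..n}"
  shows "x i ^ m * ((x i)\<^sup>2 + of_int \<beta>) = of_int t * ((x i)\<^sup>2 + of_int \<gamma>)"
proof -
  have "(\<Prod>j\<in>{1..n}. x i - x j) = 0" using assms by (intro prod_zero) auto
  thus ?thesis unfolding prod_roots by simp
qed

lemma root_diff_eq:
  assumes "i \<in> {1..n}"
  shows "root_diff i * ((x i)\<^sup>2 + of_int \<gamma>) = of_nat m * x i ^ (m - 1) * ((x i)\<^sup>2 + of_int \<kappa>)\<^sup>2"
proof -
  have "poly (pderiv (line_poly m t)) (x i) = (\<Sum>a\<in>{1..n}. \<Prod>j\<in>{1..n} - {a}. x i - x j)"
    unfolding factors pderiv_prod poly_sum poly_mult poly_prod by (simp add: pderiv_pCons)
  also have "\<dots> = (\<Sum>a\<in>{1..n}. if a = i then root_diff i else 0)"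
    unfolding root_diff_def using assms by (intro sum.cong) (auto intro!: prod_zero)
  finally have d: "poly (pderiv (line_poly m t)) (x i) = root_diff i" using assms by simp
  have "poly (line_poly m t) (x i) = 0" unfolding poly_line_poly using root_eq[OF assms] by simp
  with arg_cong[OF line_wronskian[OF m_pos, of t], of "\<lambda>q. poly q (x i)"] d show ?thesis
    by (simp add: poly_monom power2_eq_square algebra_simps)
qed

text \<open>The resultant of the polynomial with X^2 + c. If q^2 = -c, each factor is
  \<open>(q - x i) * (- q - x i)\<close>, so the product is f(q) f(-q); because \<open>m\<close> is
  odd this is a difference of squares, and only even powers of \<open>q\<close> remain.\<close>

lemma prod_sq_add:
  "(\<Prod>i\<in>{1..n}. (x i)\<^sup>2 + of_int c) = of_int (t\<^sup>2 * (\<gamma> - c)\<^sup>2 + c ^ m * (\<beta> - c)\<^sup>2)"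
proof -
  define q where "q = csqrt (- of_int c)"
  have q2: "q\<^sup>2 = - of_int c" by (simp add: q_def)
  have "(\<Prod>i\<in>{1..n}. (x i)\<^sup>2 + of_int c) = (\<Prod>i\<in>{1..n}. (q - x i) * (- q - x i))"
    using q2 by (intro prod.cong) (auto simp: algebra_simps power2_eq_square add_eq_0_iff)
  also have "\<dots> = (q ^ m * (of_int \<beta> - of_int c) - of_int t * (of_int \<gamma> - of_int c)) *
      (- (q ^ m) * (of_int \<beta> - of_int c) - of_int t * (of_int \<gamma> - of_int c))"
    unfolding prod.distrib prod_roots using m_odd by (simp add: q2 power_minus_odd)
  also have "\<dots> = of_int t ^ 2 * (of_int \<gamma> - of_int c) ^ 2 - (q ^ m) ^ 2 * (of_int \<beta> - of_int c) ^ 2"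
    by (simp add: algebra_simps power2_eq_square)
  also have "(q ^ m) ^ 2 = - (of_int c ^ m)"
    using m_odd by (simp add: power_mult[symmetric] mult.commute[of m] power_mult q2 power_minus_odd)
  finally show ?thesis by simp
qed

lemma prod_roots_0: "(\<Prod>i\<in>{1..n}. x i) = of_int (t * \<gamma>)"
proof -
  have "(\<Prod>i\<in>{1..n}. 0 - x i) = - of_int (t * \<gamma>)" unfolding prod_roots using m_pos by simp
  moreover have "(\<Prod>i\<in>{1..n}. 0 - x i) = - (\<Prod>i\<in>{1..n}. x i)"
    using m_odd n_eq by (simp add: prod_uminus)
  ultimately show ?thesis by simp
qed

lemma sg_nz: "sg \<noteq> 0"
  using m_pos by (simp add: line_sg_def)

text \<open>Multiplying \<open>root_diff_eq\<close> over all roots expresses the discriminant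
  through the norms of \<open>x i\<close>, of its square plus \<open>\<gamma>\<close>, and of its
  square plus \<open>\<kappa>\<close>, all known explicitly. Both sides turn out to be
  \<open>m ^ m\<close> times a square, so the Vandermonde product times a nonzero integer
  \<open>a\<close> is an integer.\<close>

lemma vandermonde_Ints: "vandermonde_prod n x \<in> \<int>"
proof (rule fixed_Ints)
  define v where "v = vandermonde_prod n x"
  define s :: int where "s = (-1) ^ ((m + 1) div 2)"
  obtain h where h: "m = 2 * h + 1" using m_odd by (elim oddE)
  define W where "W = t\<^sup>2 * (\<gamma> - \<kappa>)\<^sup>2 + \<kappa> ^ m * (\<beta> - \<kappa>)\<^sup>2"
  define a where "a = (int m - 2) ^ m * (\<beta> - \<gamma>)"
  define b where "b = int m * (t * \<gamma>) ^ h * W"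
  have "2 * card (ordered_pairs n) = 2 * ((m + 2) * (h + 1))"
    unfolding card_ordered_pairs n_eq h by simp
  hence "card (ordered_pairs n) = (m + 2) * (h + 1)" by simp
  hence sgn: "(-1) ^ card (ordered_pairs n) = (of_int s :: complex)"
    by (simp add: s_def h power_mult power_add)
  have s2: "s * s = 1" unfolding s_def by (simp add: power_add[symmetric] mult_2[symmetric] power_mult)
  hence sm: "s ^ m = s" unfolding h by (simp add: power_mult power2_eq_square)
  have "(\<Prod>i\<in>{1..n}. root_diff i) * (\<Prod>i\<in>{1..n}. (x i)\<^sup>2 + of_int \<gamma>) =
      (\<Prod>i\<in>{1..n}. of_nat m * x i ^ (m - 1) * ((x i)\<^sup>2 + of_int \<kappa>)\<^sup>2)"
    unfolding prod.distrib[symmetric] using root_diff_eq by (intro prod.cong) auto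
  also have "\<dots> = of_nat m ^ n * (\<Prod>i\<in>{1..n}. x i) ^ (m - 1) * (\<Prod>i\<in>{1..n}. (x i)\<^sup>2 + of_int \<kappa>)\<^sup>2"
    by (simp add: prod.distrib prod_power_distrib)
  also have "\<dots> = of_int (int m ^ n * (t * \<gamma>) ^ (m - 1) * W\<^sup>2)"
    unfolding prod_roots_0 prod_sq_add W_def by simp
  also have "(\<Prod>i\<in>{1..n}. root_diff i) = of_int s * v ^ 2"
    unfolding root_diff_def prod_differences sgn v_def ..
  also have "(\<Prod>i\<in>{1..n}. (x i)\<^sup>2 + of_int \<gamma>) = of_int (\<gamma> ^ m * (\<beta> - \<gamma>)\<^sup>2)"
    unfolding prod_sq_add by simp
  finally have 1: "of_int s * v\<^sup>2 * of_int (\<gamma> ^ m * (\<beta> - \<gamma>)\<^sup>2) = of_int (int m ^ n * (t * \<gamma>) ^ (m - 1) * W\<^sup>2)" .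
  \<comment> \<open>Here the scale takes effect: as \<open>m\<close> is odd, the sign in
    \<open>\<gamma> ^ m\<close> cancels the sign of the discriminant, and its factor
    \<open>m ^ m\<close> matches that of \<open>m ^ n\<close> up to a square.\<close>
  have "\<gamma> ^ m = ((int m - 2) ^ m)\<^sup>2 * (s * int m ^ m)"
    unfolding line_gamma_def line_sg_def s_def[symmetric]
    by (simp add: power_mult_distrib sm power_mult[symmetric] mult.commute)
  hence "s * (\<gamma> ^ m * (\<beta> - \<gamma>)\<^sup>2) = (s * s) * (int m ^ m * a\<^sup>2)"
    by (simp add: a_def power_mult_distrib mult_ac)
  hence 2: "s * (\<gamma> ^ m * (\<beta> - \<gamma>)\<^sup>2) = int m ^ m * a\<^sup>2" by (simp add: s2)
  have 3: "int m ^ n * (t * \<gamma>) ^ (m - 1) * W\<^sup>2 = int m ^ m * b\<^sup>2"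
    unfolding b_def n_eq power_add by (simp add: h power_mult power_mult_distrib power2_eq_square)
  have "of_int s * v\<^sup>2 * of_int (\<gamma> ^ m * (\<beta> - \<gamma>)\<^sup>2) = v\<^sup>2 * of_int (s * (\<gamma> ^ m * (\<beta> - \<gamma>)\<^sup>2))"
    by (simp only: of_int_mult mult_ac)
  with 1 have "v\<^sup>2 * of_int (s * (\<gamma> ^ m * (\<beta> - \<gamma>)\<^sup>2)) = of_int (int m ^ n * (t * \<gamma>) ^ (m - 1) * W\<^sup>2)"
    by (simp only:)
  hence "v\<^sup>2 * of_int (int m ^ m * a\<^sup>2) = of_int (int m ^ m * b\<^sup>2)" unfolding 2 3 .
  hence "of_int (int m ^ m) * (v * of_int a)\<^sup>2 = of_int (int m ^ m) * (of_int b)\<^sup>2"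
    by (simp add: power_mult_distrib mult_ac)
  hence "(v * of_int a)\<^sup>2 = (of_int b)\<^sup>2" using m_pos by simp
  hence vab: "v * of_int a = of_int b \<or> v * of_int a = of_int (- b)" by (auto simp: power2_eq_iff)
  have "\<beta> - \<gamma> = 8 * int m * sg"
    by (simp add: line_beta_def line_gamma_def algebra_simps power2_eq_square)
  hence "\<beta> - \<gamma> \<noteq> 0" using m_pos sg_nz by simp
  moreover have "int m \<noteq> 2" using m_odd by auto
  ultimately have "a \<noteq> 0" unfolding a_def by simp
  hence a0: "of_int a \<noteq> (0 :: complex)" by simp
  show vA: "vandermonde_prod n x \<in> A"
    unfolding vandermonde_prod_def using root_in_A
    by (intro A_prod) (auto simp: ordered_pairs_def intro!: A_diff)
  fix \<pi> assume \<pi>: "\<pi> \<in> G"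
  \<comment> \<open>Integrality comes from \<open>fixed_Ints\<close> rather than from dividing by
    \<open>a\<close>: both \<open>v * a\<close> and \<open>a\<close> are fixed, so \<open>v\<close>
    is.\<close>
  have "act \<pi> (v * of_int a) = v * of_int a" using vab act_of_int[OF \<pi>] by metis
  moreover have "act \<pi> (v * of_int a) = act \<pi> v * of_int a"
    using \<pi> vA by (simp add: act_mult A_of_int act_of_int v_def)
  ultimately show "act \<pi> (vandermonde_prod n x) = vandermonde_prod n x"
    using a0 unfolding v_def by simp
qed

end

section \<open>The inertia groups of the family\<close>

context galois_action
begin

definition "A_polys = {f :: complex poly. \<forall>i. coeff f i \<in> A}"

lemma A_polys_add: "f \<in> A_polys \<Longrightarrow> g \<in> A_polys \<Longrightarrow> f + g \<in> A_polys"
  and A_polys_diff: "f \<in> A_polys \<Longrightarrow> g \<in> A_polys \<Longrightarrow> f - g \<in> A_polys"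
  and A_polys_smult: "a \<in> A \<Longrightarrow> f \<in> A_polys \<Longrightarrow> smult a f \<in> A_polys"
  and A_polys_mult: "f \<in> A_polys \<Longrightarrow> g \<in> A_polys \<Longrightarrow> f * g \<in> A_polys"
  by (auto simp: A_polys_def coeff_mult intro!: A_add A_diff A_mult A_sum)

lemma A_polys_pCons: "a \<in> A \<Longrightarrow> f \<in> A_polys \<Longrightarrow> pCons a f \<in> A_polys"
  by (simp add: A_polys_def coeff_pCons split: nat.splits)

lemma A_polys_0: "0 \<in> A_polys" and A_polys_1: "1 \<in> A_polys"
  by (auto simp: A_polys_def A_0 A_1)

lemma A_polys_power: "f \<in> A_polys \<Longrightarrow> f ^ k \<in> A_polys"
  by (induction k) (auto intro: A_polys_1 A_polys_mult)

lemma A_polys_prod: "(\<And>i. i \<in> S \<Longrightarrow> f i \<in> A_polys) \<Longrightarrow> prod f S \<in> A_polys"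
  by (induction S rule: infinite_finite_induct) (auto intro: A_polys_1 A_polys_mult)

lemma A_of_nat: "of_nat k \<in> A"
  using A_of_int[of "int k"] by simp

lemma A_polys_pderiv: "f \<in> A_polys \<Longrightarrow> pderiv f \<in> A_polys"
  unfolding A_polys_def by (auto simp: coeff_pderiv simp del: of_nat_Suc intro!: A_mult A_of_nat)

lemma A_polys_monom: "a \<in> A \<Longrightarrow> monom a k \<in> A_polys"
  by (auto simp: A_polys_def coeff_monom A_0)

end

context prime_above
begin

definition "M_polys = {f :: complex poly. \<forall>i. coeff f i \<in> M}"

lemma M_polys_add: "f \<in> M_polys \<Longrightarrow> g \<in> M_polys \<Longrightarrow> f + g \<in> M_polys"
  and M_polys_diff: "f \<in> M_polys \<Longrightarrow> g \<in> M_polys \<Longrightarrow> f - g \<in> M_polys"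
  by (auto simp: M_polys_def intro!: M_add M_diff)

lemma M_polys_mult: "f \<in> A_polys \<Longrightarrow> g \<in> M_polys \<Longrightarrow> f * g \<in> M_polys"
  unfolding A_polys_def M_polys_def by (auto simp: coeff_mult intro!: M_sum intro: M_mult)

lemma M_polys_pderiv: "f \<in> M_polys \<Longrightarrow> pderiv f \<in> M_polys"
  unfolding M_polys_def by (auto simp: coeff_pderiv simp del: of_nat_Suc intro!: M_mult A_of_nat)

lemma M_polys_pCons: "a \<in> M \<Longrightarrow> f \<in> M_polys \<Longrightarrow> pCons a f \<in> M_polys"
  by (simp add: M_polys_def coeff_pCons split: nat.splits)

lemma M_polys_0: "0 \<in> M_polys"
  by (auto simp: M_polys_def M_0)

lemma poly_M_polys: "f \<in> M_polys \<Longrightarrow> a \<in> A \<Longrightarrow> poly f a \<in> M"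
  unfolding poly_altdef M_polys_def by (auto intro!: M_sum M_mult' A_power)

text \<open>The coefficients of the product say that \<open>coeff f k\<close> is congruent to
  \<open>a * coeff f (Suc k)\<close>. Descending from the vanishing coefficient just above the
  degree, all of them lie in \<open>M\<close>.\<close>

lemma M_polys_linear_cancel:
  assumes "a \<in> A" "f \<in> A_polys" "[:- a, 1:] * f \<in> M_polys"
  shows "f \<in> M_polys"
proof -
  have step: "coeff f k - a * coeff f (Suc k) \<in> M" for k
  proof -
    have "coeff ([:- a, 1:] * f) (Suc k) \<in> M" using assms(3) unfolding M_polys_def by blast
    thus ?thesis by simp
  qed
  have "coeff f k \<in> M" if "k + d = Suc (degree f)" for k d
    using that
  proof (induction d arbitrary: k)
    case 0
    thus ?case by (simp add: coeff_eq_0 M_0)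
  next
    case (Suc d)
    hence "coeff f (Suc k) \<in> M" by simp
    hence "a * coeff f (Suc k) \<in> M" by (rule M_mult[OF assms(1)])
    thus ?case using step[of k] M_add_cancel by blast
  qed
  moreover have "coeff f k \<in> M" if "k > degree f" for k using that by (simp add: coeff_eq_0 M_0)
  ultimately have "coeff f k \<in> M" for k
    by (cases "k > degree f") (auto intro: \<open>\<And>k d. k + d = Suc (degree f) \<Longrightarrow> coeff f k \<in> M\<close>[of k "Suc (degree f) - k"])
  thus ?thesis by (simp add: M_polys_def)
qed

lemma M_polys_prod_linear:
  assumes "finite T" "r \<in> A" "\<And>i. i \<in> T \<Longrightarrow> y i \<in> A \<and> r - y i \<in> M"
  shows "(\<Prod>i\<in>T. [:- y i, 1:]) - [:- r, 1:] ^ card T \<in> M_polys"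
  using assms(1,3)
proof (induction T)
  case (insert i T)
  let ?Y = "\<Prod>i\<in>T. [:- y i, 1:]" and ?L = "[:- r, 1:]"
  have Y: "?Y \<in> A_polys" using insert.prems
    by (intro A_polys_prod A_polys_pCons A_polys_0 A_1 A_uminus) auto
  have "[:- y i, 1:] * ?Y - ?L * ?L ^ card T = ?Y * [:r - y i:] + ?L * (?Y - ?L ^ card T)"
    by (simp add: algebra_simps smult_diff_left)
  also have "\<dots> \<in> M_polys"
    using insert assms(2)
    by (intro M_polys_add M_polys_mult Y M_polys_pCons M_polys_0 A_polys_pCons A_polys_0 A_1 A_uminus) auto
  finally show ?case using insert.hyps by simp
qed (simp add: M_polys_0)

end

section \<open>Ramification of one member of the family at a chosen prime\<close>

locale line_prime = line_member A n x G act m t + prime_above A n x G act p M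
  for A n x G act m t p M
begin

text \<open>The factorisations show that X^2 + \<open>\<kappa>\<close> can share a root modulo
  \<open>p\<close> with X^2 + \<open>\<beta>\<close> or X^2 + \<open>\<gamma>\<close> only if
  \<open>p\<close> divides 2, \<open>m\<close>, \<open>m + 2\<close> or \<open>m - 2\<close>;
  excluding these primes keeps the special points apart.\<close>

lemma beta_kappa: "\<beta> - \<kappa> = 2 * 2 * (int m + 2) * sg"
  and gamma_kappa: "\<kappa> - \<gamma> = 2 * 2 * (int m - 2) * sg"
  by (simp_all add: line_beta_def line_gamma_def line_kappa_def algebra_simps power2_eq_square)

lemma not_dvd_gamma: "\<not> p dvd int m \<Longrightarrow> \<not> p dvd int m - 2 \<Longrightarrow> \<not> p dvd \<gamma>"
  using not_dvd_line_sg p_prime by (auto simp: line_gamma_def prime_dvd_mult_iff prime_dvd_power_iff)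

lemma not_dvd_beta: "\<not> p dvd int m \<Longrightarrow> \<not> p dvd int m + 2 \<Longrightarrow> \<not> p dvd \<beta>"
  using not_dvd_line_sg p_prime by (auto simp: line_beta_def prime_dvd_mult_iff prime_dvd_power_iff)

lemma not_dvd_beta_kappa:
  "\<not> p dvd 2 \<Longrightarrow> \<not> p dvd int m \<Longrightarrow> \<not> p dvd int m + 2 \<Longrightarrow> \<not> p dvd \<beta> - \<kappa>"
  unfolding beta_kappa prime_dvd_mult_iff[OF p_prime] using not_dvd_line_sg by blast

lemma not_dvd_gamma_kappa:
  "\<not> p dvd 2 \<Longrightarrow> \<not> p dvd int m \<Longrightarrow> \<not> p dvd int m - 2 \<Longrightarrow> \<not> p dvd \<kappa> - \<gamma>"
  unfolding gamma_kappa prime_dvd_mult_iff[OF p_prime] using not_dvd_line_sg by blast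

lemma sq_in_A: "i \<in> {1..n} \<Longrightarrow> (x i)\<^sup>2 + of_int c \<in> A"
  using root_in_A by (intro A_add A_power A_of_int)

lemma root_diff_in_M:
  assumes "i \<in> {1..n}" "j \<in> {1..n}" "i \<noteq> j" "x i - x j \<in> M"
  shows "root_diff i \<in> M"
  unfolding root_diff_def using assms root_in_A by (intro M_prod_mem[of _ j]) (auto intro!: A_diff)

text \<open>Two congruent roots put the derivative at \<open>x i\<close> into \<open>M\<close>, and
  then the right-hand side of \<open>root_diff_eq\<close> shows that roots can only collide at the
  critical points: 0 and the zeros of X^2 + \<open>\<kappa>\<close>.\<close>

lemma congruent_roots:
  assumes "i \<in> {1..n}" "j \<in> {1..n}" "i \<noteq> j" "x i - x j \<in> M" "\<not> p dvd int m"
  shows "x i \<in> M \<or> (x i)\<^sup>2 + of_int \<kappa> \<in> M"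
proof -
  have xA: "x i \<in> A" using root_in_A assms(1) by blast
  have "root_diff i * ((x i)\<^sup>2 + of_int \<gamma>) \<in> M"
    by (rule M_mult'[OF root_diff_in_M[OF assms(1-4)] sq_in_A[OF assms(1)]])
  hence "of_nat m * x i ^ (m - 1) * ((x i)\<^sup>2 + of_int \<kappa>)\<^sup>2 \<in> M" unfolding root_diff_eq[OF assms(1)] .
  moreover have "of_nat m \<notin> M" using of_int_in_M_iff[of "int m"] assms(5) by simp
  ultimately have "x i ^ (m - 1) \<in> M \<or> ((x i)\<^sup>2 + of_int \<kappa>)\<^sup>2 \<in> M"
    using M_prime[OF A_mult[OF A_of_nat A_power[OF xA]] A_power[OF sq_in_A[OF assms(1)]]]
      M_prime[OF A_of_nat A_power[OF xA]] by blast
  thus ?thesis using M_power[OF xA] M_power[OF sq_in_A[OF assms(1)]] by blast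
qed

text \<open>A prime dividing \<open>m + 2\<close> divides \<open>\<beta>\<close>, so the polynomial
  is X^n modulo \<open>p\<close> and all roots lie in \<open>M\<close>, while the constant term is
  divisible by \<open>p\<close> exactly once. This is the residue class of 0 with all of
  \<open>G\<close> acting.\<close>

lemma transitive_if_eisenstein:
  assumes dvd: "p dvd int m + 2" and t: "t = p * k" "\<not> p dvd k" and ij: "i \<in> {1..n}" "j \<in> {1..n}"
  shows "\<exists>\<pi>\<in>G. \<pi> i = j"
proof -
  have p2: "\<not> p dvd 2"
  proof
    assume "p dvd 2"
    hence "p = 2" using p_prime primes_dvd_imp_eq two_is_prime by blast
    thus False using dvd m_odd by auto
  qed
  have pm: "\<not> p dvd int m"
  proof
    assume "p dvd int m"
    hence "p dvd (int m + 2) - int m" using dvd by (rule dvd_diff[rotated])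
    thus False using p2 by simp
  qed
  have pm2: "\<not> p dvd int m - 2"
  proof
    assume "p dvd int m - 2"
    hence "p dvd (int m + 2) - (int m - 2)" using dvd by (rule dvd_diff[rotated])
    hence "p dvd 2 * 2" by simp
    thus False using p2 prime_dvd_mult_iff[OF p_prime, of 2 2] by blast
  qed
  have tM: "of_int t \<in> M" using of_int_in_M_iff[of t] unfolding t(1) by (simp only: dvd_triv_left)
  have all: "x l \<in> M" if l: "l \<in> {1..n}" for l
  proof -
    have xA: "x l \<in> A" using root_in_A l by blast
    have "p dvd \<beta>"
      unfolding line_beta_def power2_eq_square by (rule dvd_mult2[OF dvd_mult2[OF dvd]])
    hence "x l ^ m * of_int \<beta> \<in> M" using of_int_in_M_iff by (intro M_mult A_power xA) auto
    moreover have "of_int t * ((x l)\<^sup>2 + of_int \<gamma>) \<in> M" by (rule M_mult'[OF tM sq_in_A[OF l]])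
    ultimately have "of_int t * ((x l)\<^sup>2 + of_int \<gamma>) - x l ^ m * of_int \<beta> \<in> M" by (intro M_diff)
    moreover have "of_int t * ((x l)\<^sup>2 + of_int \<gamma>) - x l ^ m * of_int \<beta> = x l ^ (m + 2)"
      unfolding root_eq[OF l, symmetric] by (simp add: algebra_simps power_add power2_eq_square)
    ultimately show ?thesis using M_power[OF xA, of "m + 2"] by (simp only:)
  qed
  show ?thesis
  proof (rule transitive_on_residue_class[of G 0 "- k * \<gamma>"])
    show "(\<Prod>l\<in>{1..n}. of_int 0 - x l) = of_int (p * (- k * \<gamma>))"
      unfolding prod_roots using m_pos t(1) by simp
    show "\<not> p dvd - k * \<gamma>" using t(2) not_dvd_gamma[OF pm pm2] p_prime by (simp add: prime_dvd_mult_iff)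
    show "of_int 0 - x i \<in> M" "of_int 0 - x j \<in> M" using all[OF ij(1)] all[OF ij(2)] by (simp_all add: M_uminus)
    show "\<exists>u\<in>A. \<exists>b\<in>A. u \<notin> M \<and> u * a = of_int p * b"
      if a: "a \<in> M" and inv: "\<And>\<pi>. \<pi> \<in> G \<Longrightarrow> act \<pi> a = a" for a
    proof -
      \<comment> \<open>Invariants of the full group are integers, so divisibility by
        \<open>p\<close> holds without any condition on the order of \<open>G\<close>.\<close>
      have "a \<in> \<int>" using fixed_Ints[OF M_A[OF a] inv] .
      then obtain b where "b \<in> A" "a = of_int p * b" using invariant_in_M_dvd[OF a] by blast
      thus ?thesis using A_1 one_notin_M by force
    qed
  qed (rule subset_refl, rule G_id, erule (1) G_comp, erule G_inv, rule ij(1), rule ij(2))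
qed

lemma card_inertia: "card inertia \<le> fact n" "card inertia > 0"
proof -
  have "inertia \<subseteq> {\<pi>. \<pi> permutes {1..n}}" using inertia_G G_permutes by blast
  hence "card inertia \<le> card {\<pi>. \<pi> permutes {1..n}}" by (intro card_mono finite_permutations) auto
  thus "card inertia \<le> fact n" using card_permutations[of "{1..n}" n] by simp
  have "finite inertia" using finite_subset[OF _ finite_G] inertia_G by blast
  thus "card inertia > 0" using inertia_id by (auto simp: card_gt_0_iff)
qed

text \<open>Modulo \<open>p\<close> the polynomial becomes \<open>X\<^sup>m (X\<^sup>2 + \<beta>)\<close>.\<close>

lemma inertia_at_zero:
  assumes p: "\<not> p dvd 2" "\<not> p dvd int m" "\<not> p dvd int m + 2" "\<not> p dvd int m - 2" and big: "p > fact n"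
    and t: "t = p * k" "\<not> p dvd k"
  defines "S \<equiv> {i \<in> {1..n}. x i \<in> M}"
  shows "\<And>i j. i \<in> S \<Longrightarrow> j \<in> S \<Longrightarrow> \<exists>\<pi>\<in>inertia. \<pi> i = j"
    and "\<And>\<pi> i. \<pi> \<in> inertia \<Longrightarrow> i \<in> {1..n} - S \<Longrightarrow> \<pi> i = i"
    and "card ({1..n} - S) \<le> 2" and "{1..n} - S \<noteq> {}"
proof -
  have tM: "of_int t \<in> M" using of_int_in_M_iff[of t] unfolding t(1) by (simp only: dvd_triv_left)
  \<comment> \<open>Tameness: inertia embeds into the permutations of \<open>n\<close> points, and
    \<open>p\<close> exceeds \<open>n!\<close>.\<close>
  have card: "\<not> p dvd int (card inertia)"
  proof
    assume "p dvd int (card inertia)"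
    hence "p \<le> int (card inertia)" using card_inertia(2) by (intro zdvd_imp_le) auto
    also have "\<dots> \<le> fact n" using card_inertia(1) by (metis of_nat_fact of_nat_le_iff)
    finally show False using big by simp
  qed
  show "\<exists>\<pi>\<in>inertia. \<pi> i = j" if ij: "i \<in> S" "j \<in> S" for i j
  proof (rule transitive_on_residue_class[of inertia 0 "- k * \<gamma>"])
    show "(\<Prod>l\<in>{1..n}. of_int 0 - x l) = of_int (p * (- k * \<gamma>))"
      unfolding prod_roots using m_pos t(1) by simp
    show "\<not> p dvd - k * \<gamma>" using t(2) not_dvd_gamma[OF p(2,4)] p_prime by (simp add: prime_dvd_mult_iff)
    show "of_int 0 - x i \<in> M" "of_int 0 - x j \<in> M" using ij by (simp_all add: M_uminus S_def)
    show "i \<in> {1..n}" "j \<in> {1..n}" using ij by (simp_all add: S_def)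
    show "\<exists>u\<in>A. \<exists>b\<in>A. u \<notin> M \<and> u * a = of_int p * b"
      if "a \<in> M" "\<And>\<pi>. \<pi> \<in> inertia \<Longrightarrow> act \<pi> a = a" for a
      using inertia_invariant_divisible[OF that card] .
  qed (rule subsetI, erule inertia_G, rule inertia_id, erule (1) inertia_comp, erule inertia_inv)
  have beta: "(x i)\<^sup>2 + of_int \<beta> \<in> M" if i: "i \<in> {1..n} - S" for i
  proof -
    have xA: "x i \<in> A" using root_in_A i by blast
    have "x i ^ m * ((x i)\<^sup>2 + of_int \<beta>) \<in> M"
      using root_eq[of i] i by (simp add: M_mult'[OF tM sq_in_A])
    hence "x i ^ m \<in> M \<or> (x i)\<^sup>2 + of_int \<beta> \<in> M" using i by (intro M_prime A_power xA sq_in_A) auto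
    thus ?thesis using M_power[OF xA, of m] i by (auto simp: S_def)
  qed
  \<comment> \<open>A root outside \<open>S\<close> is a zero of X^2 + \<open>\<beta>\<close> modulo
    \<open>M\<close>, so it could only collide with another at a zero of X^2 +
    \<open>\<kappa>\<close>. An inertia element fixes residues and hence fixes such a root.\<close>
  have sep: "x i - x j \<notin> M" if i: "i \<in> {1..n} - S" and j: "j \<in> {1..n}" "i \<noteq> j" for i j
  proof
    assume "x i - x j \<in> M"
    hence "x i \<in> M \<or> (x i)\<^sup>2 + of_int \<kappa> \<in> M" using i j p(2) by (intro congruent_roots[of i j]) auto
    hence "(x i)\<^sup>2 + of_int \<kappa> \<in> M" using i by (auto simp: S_def)
    hence "((x i)\<^sup>2 + of_int \<beta>) - ((x i)\<^sup>2 + of_int \<kappa>) \<in> M" using beta[OF i] by (intro M_diff)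
    hence "of_int (\<beta> - \<kappa>) \<in> M" by simp
    thus False using of_int_in_M_iff not_dvd_beta_kappa[OF p(1,2,3)] by blast
  qed
  show "\<pi> i = i" if \<pi>: "\<pi> \<in> inertia" and i: "i \<in> {1..n} - S" for \<pi> i
  proof (rule ccontr)
    assume "\<pi> i \<noteq> i"
    have \<pi>G: "\<pi> \<in> G" using inertia_G[OF \<pi>] .
    have "\<pi> i \<in> {1..n}" using permutes_in_image[OF G_permutes[OF \<pi>G]] i by blast
    moreover have "act \<pi> (x i) - x i \<in> M" using \<pi> i root_in_A unfolding inertia_def by blast
    hence "x (\<pi> i) - x i \<in> M" using act_root[OF \<pi>G, of i] i by simp
    hence "x i - x (\<pi> i) \<in> M" using M_uminus by fastforce
    ultimately show False using sep[OF i, of "\<pi> i"] \<open>\<pi> i \<noteq> i\<close> by auto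
  qed
  \<comment> \<open>Roots outside \<open>S\<close> have congruent squares and incongruent values, so
    they are pairwise negatives modulo \<open>M\<close>. For three of them, two would be congruent
    to the negative of the third.\<close>
  show "card ({1..n} - S) \<le> 2"
  proof (rule ccontr)
    assume "\<not> card ({1..n} - S) \<le> 2"
    hence "3 \<le> card ({1..n} - S)" by simp
    then obtain T where T: "T \<subseteq> {1..n} - S" "card T = 3" by (meson obtain_subset_with_card_n)
    then obtain a b c where abc: "T = {a, b, c}" "a \<noteq> b" "b \<noteq> c" "a \<noteq> c" by (auto simp: card_3_iff)
    have plus: "x a + x j \<in> M" if j: "j \<in> {1..n} - S" "a \<noteq> j" for j
    proof -
      have a: "a \<in> {1..n} - S" using T abc by blast
      have "((x a)\<^sup>2 + of_int \<beta>) - ((x j)\<^sup>2 + of_int \<beta>) \<in> M" by (intro M_diff beta a j(1))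
      hence "(x a - x j) * (x a + x j) \<in> M" by (simp add: algebra_simps power2_eq_square)
      moreover have "x a - x j \<in> A" "x a + x j \<in> A" using a j(1) root_in_A by (auto intro!: A_diff A_add)
      ultimately show ?thesis using M_prime sep[OF a, of j] j by blast
    qed
    have "(x a + x b) - (x a + x c) \<in> M" using T abc by (intro M_diff plus) auto
    hence "x b - x c \<in> M" by simp
    thus False using sep[of b c] T abc by auto
  qed
  \<comment> \<open>If all roots were in \<open>M\<close>, the value at 1 would be 1 modulo
    \<open>M\<close>; but it is \<open>1 + \<beta>\<close> there, and \<open>p\<close> does not
    divide \<open>\<beta>\<close>.\<close>
  show "{1..n} - S \<noteq> {}"
  proof
    assume "{1..n} - S = {}"
    hence all: "x i \<in> M" if "i \<in> {1..n}" for i using that by (auto simp: S_def)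
    have "(\<Prod>i\<in>T. 1 - x i) - 1 \<in> M" if "finite T" "T \<subseteq> {1..n}" for T
      using that
    proof (induction T)
      case (insert i T)
      let ?q = "\<Prod>i\<in>T. 1 - x i"
      have "?q \<in> A" using insert.prems root_in_A by (intro A_prod A_diff A_1) auto
      moreover have "?q - 1 \<in> M" "x i \<in> M" using insert all by auto
      ultimately have "(?q - 1) - ?q * x i \<in> M" using M_diff M_mult by blast
      thus ?case using insert.hyps by (simp add: algebra_simps)
    qed (simp add: M_0)
    from this[of "{1..n}"] have "of_int \<beta> - of_int t * (1 + of_int \<gamma>) \<in> M"
      unfolding prod_roots[of 1] by simp
    moreover have "of_int t * of_int (1 + \<gamma>) \<in> M" by (rule M_mult'[OF tM A_of_int])
    ultimately have "of_int \<beta> \<in> M" using M_add_cancel[of "of_int \<beta>"] by simp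
    thus False using of_int_in_M_iff not_dvd_beta[OF p(2,3)] by blast
  qed
qed

text \<open>Modulo \<open>p\<close> the polynomial has a triple root at \<open>r\<close>, a root of \<open>X\<^sup>2 + \<kappa>\<close>.\<close>

lemma inertia_at_triple_root:
  assumes p: "\<not> p dvd 2" "\<not> p dvd int m" "\<not> p dvd int m + 2" "\<not> p dvd int m - 2"
    and r: "p dvd r\<^sup>2 + \<kappa>" "\<not> p dvd r"
    and k: "r ^ m * (r\<^sup>2 + \<beta>) - t * (r\<^sup>2 + \<gamma>) = p * k" "\<not> p dvd k"
  shows "\<exists>\<pi>\<in>G. \<exists>S. \<pi> \<noteq> id \<and> \<pi> permutes S \<and> finite S \<and> card S \<le> 3"
proof -
  define S where "S = {i \<in> {1..n}. of_int r - x i \<in> M}"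
  have rA: "of_int r \<in> A" by (rule A_of_int)
  have xA: "x i \<in> A" if "i \<in> {1..n}" for i using root_in_A that by blast
  have rk: "of_int r ^ 2 + of_int \<kappa> \<in> M" using r(1) of_int_in_M_iff[of "r\<^sup>2 + \<kappa>"] by simp
  have nr_beta: "\<not> p dvd r\<^sup>2 + \<beta>"
  proof
    assume "p dvd r\<^sup>2 + \<beta>"
    hence "p dvd (r\<^sup>2 + \<beta>) - (r\<^sup>2 + \<kappa>)" using r(1) by (rule dvd_diff)
    thus False using not_dvd_beta_kappa[OF p(1,2,3)] by simp
  qed
  have nr: "\<not> p dvd r ^ m * (r\<^sup>2 + \<beta>)"
    using nr_beta r(2) p_prime by (auto simp: prime_dvd_mult_iff dest: prime_dvd_power)
  have nt: "\<not> p dvd t"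
  proof
    assume "p dvd t"
    hence "p dvd p * k + t * (r\<^sup>2 + \<gamma>)" by simp
    thus False using nr unfolding k(1)[symmetric] by simp
  qed
  have prod: "(\<Prod>l\<in>{1..n}. of_int r - x l) = of_int (p * k)"
    unfolding prod_roots k(1)[symmetric] by simp
  have sq: "(x i)\<^sup>2 - (of_int r)\<^sup>2 \<in> M" if "i \<in> S" for i
  proof -
    have "(of_int r - x i) * (- (of_int r + x i)) \<in> M"
      using that xA rA by (intro M_mult' A_uminus A_add) (auto simp: S_def)
    thus ?thesis by (simp add: algebra_simps power2_eq_square)
  qed
  have kap: "(x i)\<^sup>2 + of_int \<kappa> \<in> M" if "i \<in> S" for i
    using M_add[OF sq[OF that] rk] by simp
  \<comment> \<open>Modulo \<open>M\<close> a root in the class of \<open>r\<close> is a zero of the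
    right-hand side of \<open>root_diff_eq\<close>, while the factor with \<open>\<gamma>\<close> is
    not in \<open>M\<close>. So the derivative vanishes modulo \<open>M\<close>, and some other root
    lies in the same class.\<close>
  have SS: "\<exists>j\<in>S. j \<noteq> i" if i: "i \<in> S" for i
  proof -
    have i': "i \<in> {1..n}" using i by (simp add: S_def)
    have "of_nat m * x i ^ (m - 1) * (((x i)\<^sup>2 + of_int \<kappa>) * ((x i)\<^sup>2 + of_int \<kappa>)) \<in> M"
      using kap[OF i] xA[OF i'] by (intro M_mult A_mult A_of_nat A_power sq_in_A[OF i']) auto
    hence "root_diff i * ((x i)\<^sup>2 + of_int \<gamma>) \<in> M"
      unfolding root_diff_eq[OF i'] by (simp add: power2_eq_square mult.assoc)
    moreover have "root_diff i \<in> A" unfolding root_diff_def using xA i' by (intro A_prod A_diff) auto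
    moreover have "(x i)\<^sup>2 + of_int \<gamma> \<notin> M"
    proof
      assume "(x i)\<^sup>2 + of_int \<gamma> \<in> M"
      hence "((x i)\<^sup>2 + of_int \<kappa>) - ((x i)\<^sup>2 + of_int \<gamma>) \<in> M" using kap[OF i] by (intro M_diff)
      hence "of_int (\<kappa> - \<gamma>) \<in> M" by simp
      thus False using of_int_in_M_iff not_dvd_gamma_kappa[OF p(1,2,4)] by blast
    qed
    ultimately have "root_diff i \<in> M" using M_prime sq_in_A[OF i'] by blast
    hence "\<exists>j\<in>{1..n} - {i}. x i - x j \<in> M"
      unfolding root_diff_def using xA i' by (intro M_prod_prime A_diff) auto
    then obtain j where j: "j \<in> {1..n} - {i}" "x i - x j \<in> M" by blast
    have "(of_int r - x i) + (x i - x j) \<in> M" using i j(2) by (intro M_add) (auto simp: S_def)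
    hence "j \<in> S" using j(1) by (simp add: S_def)
    thus ?thesis using j(1) by blast
  qed
  have "of_int (p * k) \<in> M" using of_int_in_M_iff[of "p * k"] by (simp only: dvd_triv_left)
  hence "\<exists>i\<in>{1..n}. of_int r - x i \<in> M"
    unfolding prod[symmetric] using xA rA by (intro M_prod_prime A_diff) auto
  then obtain i where i: "i \<in> S" by (auto simp: S_def)
  then obtain j where j: "j \<in> S" "j \<noteq> i" using SS by blast
  \<comment> \<open>Trivial inertia would have order 1, prime to \<open>p\<close>, and would then
    have to be transitive on a class with two distinct members.\<close>
  have "\<exists>\<pi>\<in>inertia. \<pi> \<noteq> id"
  proof (rule ccontr)
    assume "\<not> (\<exists>\<pi>\<in>inertia. \<pi> \<noteq> id)"
    hence I: "inertia = {id}" using inertia_id by blast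
    have card: "\<not> p dvd int (card inertia)" using I not_prime_unit[of p] p_prime by auto
    have "\<exists>\<pi>\<in>inertia. \<pi> i = j"
    proof (rule transitive_on_residue_class[of inertia r k])
      show "\<exists>u\<in>A. \<exists>b\<in>A. u \<notin> M \<and> u * a = of_int p * b"
        if "a \<in> M" "\<And>\<pi>. \<pi> \<in> inertia \<Longrightarrow> act \<pi> a = a" for a
        using inertia_invariant_divisible[OF that card] .
      show "(\<Prod>l\<in>{1..n}. of_int r - x l) = of_int (p * k)" by (rule prod)
      show "\<not> p dvd k" by (rule k(2))
      show "i \<in> {1..n}" "j \<in> {1..n}" "of_int r - x i \<in> M" "of_int r - x j \<in> M"
        using i j(1) by (simp_all add: S_def)
    qed (rule subsetI, erule inertia_G, rule inertia_id, erule (1) inertia_comp, erule inertia_inv)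
    thus False using I j(2) by auto
  qed
  then obtain \<pi> where \<pi>: "\<pi> \<in> inertia" "\<pi> \<noteq> id" by blast
  have \<pi>G: "\<pi> \<in> G" using inertia_G[OF \<pi>(1)] .
  have fix_out: "\<pi> i = i" if i: "i \<in> {1..n} - S" for i
  proof (rule ccontr)
    assume "\<pi> i \<noteq> i"
    have i': "i \<in> {1..n}" using i by blast
    have "\<pi> i \<in> {1..n}" using permutes_in_image[OF G_permutes[OF \<pi>G]] i by blast
    moreover have "act \<pi> (x i) - x i \<in> M" using \<pi> i root_in_A unfolding inertia_def by blast
    hence "x (\<pi> i) - x i \<in> M" using act_root[OF \<pi>G, of i] i by simp
    hence "x i - x (\<pi> i) \<in> M" using M_uminus by fastforce
    ultimately have "x i \<in> M \<or> (x i)\<^sup>2 + of_int \<kappa> \<in> M"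
      using i \<open>\<pi> i \<noteq> i\<close> p(2) by (intro congruent_roots[of i "\<pi> i"]) auto
    thus False
    proof
      assume xM: "x i \<in> M"
      have "x i * (x i ^ (m - 1) * ((x i)\<^sup>2 + of_int \<beta>)) \<in> M"
        using xA[OF i'] by (intro M_mult'[OF xM] A_mult A_power sq_in_A[OF i'])
      hence "x i ^ m * ((x i)\<^sup>2 + of_int \<beta>) \<in> M"
        using m_pos by (simp add: power_eq_if mult.assoc)
      hence "of_int t * ((x i)\<^sup>2 + of_int \<gamma>) \<in> M" unfolding root_eq[OF i'] .
      hence "(x i)\<^sup>2 + of_int \<gamma> \<in> M"
        using M_prime[OF A_of_int sq_in_A[OF i']] of_int_in_M_iff nt by blast
      moreover have "(x i)\<^sup>2 \<in> M" unfolding power2_eq_square by (rule M_mult[OF xA[OF i'] xM])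
      ultimately have "((x i)\<^sup>2 + of_int \<gamma>) - (x i)\<^sup>2 \<in> M" by (intro M_diff)
      hence "of_int \<gamma> \<in> M" by simp
      thus False using of_int_in_M_iff not_dvd_gamma[OF p(2,4)] by blast
    next
      assume "(x i)\<^sup>2 + of_int \<kappa> \<in> M"
      hence sq': "((x i)\<^sup>2 + of_int \<kappa>) - (of_int r ^ 2 + of_int \<kappa>) \<in> M" using rk by (intro M_diff)
      hence "(of_int r - x i) * (of_int r + x i) \<in> M"
        using M_uminus[OF sq'] by (simp add: algebra_simps power2_eq_square)
      \<comment> \<open>Here \<open>x i\<close> is congruent to \<open>- r\<close>. Since
        \<open>m\<close> is odd, f(-r) = 0 modulo \<open>M\<close> gives t (r^2 +
        \<open>\<gamma>\<close>) = -r^m (r^2 + \<open>\<beta>\<close>), while f(r) = 0 gives the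
        opposite sign; together \<open>p\<close> divides 2 r^m (r^2 + \<open>\<beta>\<close>), which
        is excluded.\<close>
      hence sum: "of_int r + x i \<in> M"
        using M_prime[OF A_diff[OF rA xA[OF i']] A_add[OF rA xA[OF i']]] i by (auto simp: S_def)
      have pw: "of_int r ^ m + x i ^ m \<in> M"
      proof -
        have "of_int r ^ m - (- x i) ^ m = (of_int r - - x i) * (\<Sum>l<m. (- x i) ^ (m - Suc l) * of_int r ^ l)"
          by (rule power_diff_sumr2)
        also have "\<dots> \<in> M"
          using sum xA[OF i'] rA by (intro M_mult' A_sum A_mult A_power A_uminus) auto
        finally show ?thesis using m_odd by (simp add: power_minus_odd)
      qed
      have s2: "(x i)\<^sup>2 - of_int r ^ 2 \<in> M" using sq' by simp
      define u where "u = (x i)\<^sup>2 + of_int \<beta>"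
      define u' :: complex where "u' = of_int r ^ 2 + of_int \<beta>"
      have uA: "u \<in> A" "u' \<in> A" unfolding u_def u'_def by (intro sq_in_A[OF i'] A_add A_power rA A_of_int)+
      have "(of_int r ^ m + x i ^ m) * u - of_int r ^ m * ((x i)\<^sup>2 - of_int r ^ 2) \<in> M"
        by (rule M_diff[OF M_mult'[OF pw uA(1)] M_mult[OF A_power[OF rA] s2]])
      hence "x i ^ m * u + of_int r ^ m * u' \<in> M" unfolding u_def u'_def by (simp add: algebra_simps)
      hence 1: "of_int t * ((x i)\<^sup>2 + of_int \<gamma>) + of_int r ^ m * u' \<in> M" unfolding u_def root_eq[OF i'] .
      have "of_int t * ((x i)\<^sup>2 - of_int r ^ 2) \<in> M" by (rule M_mult[OF A_of_int s2])
      with 1 have "(of_int t * ((x i)\<^sup>2 + of_int \<gamma>) + of_int r ^ m * u') - of_int t * ((x i)\<^sup>2 - of_int r ^ 2) \<in> M"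
        by (intro M_diff)
      moreover have "of_int (p * k) \<in> M" using of_int_in_M_iff[of "p * k"] by (simp only: dvd_triv_left)
      ultimately have "(of_int t * ((x i)\<^sup>2 + of_int \<gamma>) + of_int r ^ m * u') - of_int t * ((x i)\<^sup>2 - of_int r ^ 2) +
          of_int (r ^ m * (r\<^sup>2 + \<beta>) - t * (r\<^sup>2 + \<gamma>)) \<in> M"
        unfolding k(1) by (intro M_add)
      hence "of_int (2 * (r ^ m * (r\<^sup>2 + \<beta>))) \<in> M" unfolding u'_def by (simp add: algebra_simps)
      thus False
        unfolding of_int_in_M_iff using nr p(1) prime_dvd_mult_iff[OF p_prime, of 2 "r ^ m * (r\<^sup>2 + \<beta>)"] by blast
    qed
  qed
  have "\<pi> permutes S"
    using fix_out by (intro permutes_superset[OF G_permutes[OF \<pi>G]]) auto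
  \<comment> \<open>Four roots in the class would make \<open>L ^ 4\<close> divide \<open>f\<close>
    modulo \<open>M\<close>, hence \<open>L ^ 3\<close> divide the Wronskian
    \<open>w * C ^ 2\<close>. But \<open>C\<close> is \<open>L * R\<close> modulo \<open>M\<close>.
    Cancelling \<open>L ^ 2\<close> and evaluating at \<open>r\<close> would put m r^(m-1) (2r)^2
    into \<open>M\<close>.\<close>
  moreover have "card S \<le> 3"
  proof (rule ccontr)
    assume "\<not> card S \<le> 3"
    hence "4 \<le> card S" by simp
    then obtain T where T: "T \<subseteq> S" "card T = 4" by (meson obtain_subset_with_card_n)
    have T': "T \<subseteq> {1..n}" using T(1) by (auto simp: S_def)
    have finT: "finite T" by (rule finite_subset[OF T']) simp
    define L :: "complex poly" where "L = [:- of_int r, 1:]"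
    define R :: "complex poly" where "R = [:of_int r, 1:]"
    define V :: "complex poly" where "V = [:of_int \<gamma>, 0, 1:]"
    define C :: "complex poly" where "C = [:of_int \<kappa>, 0, 1:]"
    define f where "f = line_poly m t"
    define g where "g = (\<Prod>i\<in>{1..n} - T. [:- x i, 1:])"
    define w :: "complex poly" where "w = smult (of_nat m) (monom 1 (m - 1))"
    have lin: "[:a, b:] \<in> A_polys" if "a \<in> A" "b \<in> A" for a b
      using that by (intro A_polys_pCons A_polys_0)
    have LA: "L \<in> A_polys" and RA: "R \<in> A_polys" and VA: "V \<in> A_polys" and CA: "C \<in> A_polys"
      unfolding L_def R_def V_def C_def by (intro A_polys_pCons A_polys_0 A_uminus A_of_int A_0 A_1)+
    have DA: "[:0, 2:] \<in> A_polys" using A_of_int[of 2] A_0 by (intro lin) auto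
    have gA: "g \<in> A_polys" unfolding g_def using xA by (intro A_polys_prod lin A_uminus A_1) auto
    have wA: "w \<in> A_polys" unfolding w_def by (intro A_polys_smult A_polys_monom A_of_nat A_1)
    have "f = (\<Prod>i\<in>T. [:- x i, 1:]) * g"
      unfolding f_def g_def factors using prod.subset_diff[OF T', of "\<lambda>i. [:- x i, 1:]"] by (simp add: mult.commute)
    moreover have "g * ((\<Prod>i\<in>T. [:- x i, 1:]) - L ^ card T) \<in> M_polys"
      unfolding L_def using T T' finT xA rA
      by (intro M_polys_mult gA M_polys_prod_linear) (auto simp: S_def)
    ultimately have f1: "f - L ^ 4 * g \<in> M_polys" using T(2) by (simp add: algebra_simps)
    define h where "h = smult 4 g + L * pderiv g"
    have hA: "h \<in> A_polys" unfolding h_def using A_of_int[of 4] LA gA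
      by (intro A_polys_add A_polys_smult A_polys_mult A_polys_pderiv) auto
    have "pderiv L = 1" by (simp add: L_def pderiv_pCons)
    hence "pderiv (L ^ 4 * g) = L ^ 3 * h"
      unfolding h_def pderiv_mult pderiv_power
      by (simp add: algebra_simps power_numeral_reduce)
    hence f2: "pderiv f - L ^ 3 * h \<in> M_polys" using M_polys_pderiv[OF f1] by (simp add: pderiv_diff)
    define q where "q = h * V - L * g * [:0, 2:]"
    have qA: "q \<in> A_polys" unfolding q_def by (intro A_polys_diff A_polys_mult hA VA LA gA DA)
    have wr: "pderiv f * V - f * [:0, 2:] = w * C ^ 2"
      unfolding f_def V_def C_def w_def using line_wronskian[OF m_pos, of t] by simp
    have "V * (pderiv f - L ^ 3 * h) - [:0, 2:] * (f - L ^ 4 * g) \<in> M_polys"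
      by (intro M_polys_diff M_polys_mult VA DA f1 f2)
    moreover have "V * (pderiv f - L ^ 3 * h) - [:0, 2:] * (f - L ^ 4 * g) =
        (pderiv f * V - f * [:0, 2:]) - L ^ 3 * q"
      unfolding q_def by (simp add: algebra_simps power_numeral_reduce)
    ultimately have w1: "w * C ^ 2 - L ^ 3 * q \<in> M_polys" unfolding wr by simp
    have "C - L * R = [:of_int r ^ 2 + of_int \<kappa>:]"
      unfolding C_def L_def R_def by (simp add: power2_eq_square)
    hence "C - L * R \<in> M_polys" using rk by (simp add: M_polys_pCons M_polys_0)
    hence "(w * (C + L * R)) * (C - L * R) \<in> M_polys"
      by (intro M_polys_mult A_polys_mult A_polys_add wA CA LA RA)
    hence w2: "w * C ^ 2 - L ^ 2 * (w * R ^ 2) \<in> M_polys"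
      by (simp add: algebra_simps power2_eq_square)
    define e where "e = L * q - w * R ^ 2"
    have eA: "e \<in> A_polys" unfolding e_def by (intro A_polys_diff A_polys_mult A_polys_power LA qA wA RA)
    have "(w * C ^ 2 - L ^ 2 * (w * R ^ 2)) - (w * C ^ 2 - L ^ 3 * q) \<in> M_polys"
      by (intro M_polys_diff w1 w2)
    hence "L * (L * e) \<in> M_polys"
      unfolding e_def by (simp add: algebra_simps power_numeral_reduce)
    hence "L * e \<in> M_polys"
      using M_polys_linear_cancel[OF rA A_polys_mult[OF LA eA]] unfolding L_def by blast
    hence "e \<in> M_polys" using M_polys_linear_cancel[OF rA eA] unfolding L_def by blast
    hence "poly e (of_int r) \<in> M" using rA by (rule poly_M_polys)
    moreover have "poly e (of_int r) = - of_int (int m * r ^ (m - 1) * (2 * r) ^ 2)"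
      unfolding e_def L_def R_def w_def by (simp add: poly_monom power2_eq_square algebra_simps)
    ultimately have "p dvd int m * r ^ (m - 1) * (2 * r) ^ 2"
      using M_uminus of_int_in_M_iff by fastforce
    hence "p dvd int m \<or> p dvd r ^ (m - 1) \<or> p dvd (2 * r) ^ 2"
      unfolding prime_dvd_mult_iff[OF p_prime] by blast
    moreover have "\<not> p dvd 2 * r" using p(1) r(2) prime_dvd_mult_iff[OF p_prime] by blast
    ultimately show False using p(2) r(2) prime_dvd_power[OF p_prime] by blast
  qed
  moreover have "finite S" by (simp add: S_def)
  ultimately show ?thesis using \<pi>G \<pi>(2) by blast
qed

end

section \<open>Choice of the parameters\<close>

definition exactly_dvd :: "int \<Rightarrow> int \<Rightarrow> bool" where
  "exactly_dvd p a \<longleftrightarrow> (\<exists>k. a = p * k \<and> \<not> p dvd k)"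

text \<open>The conditions on the primes that do not involve \<open>t\<close>: \<open>p1\<close>
  serves for transitivity, \<open>p2\<close> for tame inertia at 0, and \<open>p3\<close> comes with
  a square root \<open>r\<close> of minus \<open>line_kappa m\<close> modulo \<open>p3\<close>, the
  place of the triple root.\<close>

definition line_primes :: "nat \<Rightarrow> int \<Rightarrow> int \<Rightarrow> int \<Rightarrow> int \<Rightarrow> bool" where
  "line_primes m p1 p2 p3 r \<longleftrightarrow> prime p1 \<and> prime p2 \<and> prime p3 \<and> p1 dvd int m + 2 \<and> fact (m + 2) < p2 \<and>
     (\<forall>q\<in>{p2, p3}. \<not> q dvd 2 \<and> \<not> q dvd int m \<and> \<not> q dvd int m + 2 \<and> \<not> q dvd int m - 2) \<and>
     p3 dvd r\<^sup>2 + line_kappa m \<and> \<not> p3 dvd r"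

definition line_param :: "nat \<Rightarrow> int \<Rightarrow> int \<Rightarrow> int \<Rightarrow> int \<Rightarrow> int \<Rightarrow> bool" where
  "line_param m p1 p2 p3 r t \<longleftrightarrow> exactly_dvd p1 t \<and> exactly_dvd p2 t \<and>
     exactly_dvd p3 (r ^ m * (r\<^sup>2 + line_beta m) - t * (r\<^sup>2 + line_gamma m))"

context line_member
begin

text \<open>Each prime enters through its own maximal ideal and supplies one hypothesis of
  \<open>alt_group_subset\<close>; no compatibility between the three ideals is required.\<close>

lemma G_eq_alt_group:
  assumes P: "line_primes m p1 p2 p3 r" and t: "line_param m p1 p2 p3 r t"
  shows "G = carrier (alt_group n)"
proof
  have even: "evenperm \<pi>" if "\<pi> \<in> G" for \<pi>
    using evenperm_if_vandermonde_Ints[OF vandermonde_Ints that] .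
  show "G \<subseteq> carrier (alt_group n)"
    using even G_permutes by (auto simp: alt_group_carrier)
  interpret perm_group G n
    by unfold_locales (fact G_permutes G_id G_comp G_inv)+
  have prime: "prime p1" "prime p2" "prime p3" using P by (auto simp: line_primes_def)
  have trans: "\<exists>\<pi>\<in>G. \<pi> i = j" if "i \<in> {1..n}" "j \<in> {1..n}" for i j
  proof -
    obtain M where M: "ideal_over p1 M" "\<And>c. c \<in> A \<Longrightarrow> c \<notin> M \<Longrightarrow> \<exists>z\<in>A. c * z - 1 \<in> M"
      using maximal_ideal_over_exists[OF prime(1)] by blast
    interpret line_prime A n x G act m t p1 M
      by unfold_locales (use prime(1) M in auto)
    show ?thesis
      using t P transitive_if_eisenstein[OF _ _ _ that]
      unfolding line_param_def line_primes_def exactly_dvd_def by blast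
  qed
  obtain \<pi> S where \<pi>: "\<pi> \<in> G" "\<pi> \<noteq> id" "\<pi> permutes S" "finite S" "card S \<le> 3"
  proof -
    obtain M where M: "ideal_over p3 M" "\<And>c. c \<in> A \<Longrightarrow> c \<notin> M \<Longrightarrow> \<exists>z\<in>A. c * z - 1 \<in> M"
      using maximal_ideal_over_exists[OF prime(3)] by blast
    interpret line_prime A n x G act m t p3 M
      by unfold_locales (use prime(3) M in auto)
    obtain k where "r ^ m * (r\<^sup>2 + \<beta>) - t * (r\<^sup>2 + \<gamma>) = p3 * k" "\<not> p3 dvd k"
      using t unfolding line_param_def exactly_dvd_def by blast
    hence "\<exists>\<pi>\<in>G. \<exists>S. \<pi> \<noteq> id \<and> \<pi> permutes S \<and> finite S \<and> card S \<le> 3"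
      using P by (intro inertia_at_triple_root[of r k]) (auto simp: line_primes_def)
    thus ?thesis using that by blast
  qed
  then obtain a b c where abc: "distinct [a, b, c]" "\<pi> = cycle_of_list [a, b, c]"
    using even_permutes_three[OF \<pi>(3-5) even[OF \<pi>(1)]] by blast
  hence tri: "tri a b c" using \<pi>(1) by (simp add: tri_def del: cycle_of_list.simps)
  show "carrier (alt_group n) \<subseteq> G"
  proof -
    obtain M where M: "ideal_over p2 M" "\<And>c. c \<in> A \<Longrightarrow> c \<notin> M \<Longrightarrow> \<exists>z\<in>A. c * z - 1 \<in> M"
      using maximal_ideal_over_exists[OF prime(2)] by blast
    interpret line_prime A n x G act m t p2 M
      by unfold_locales (use prime(2) M in auto)
    obtain k where k: "t = p2 * k" "\<not> p2 dvd k" using t unfolding line_param_def exactly_dvd_def by blast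
    have p2: "\<not> p2 dvd 2" "\<not> p2 dvd int m" "\<not> p2 dvd int m + 2" "\<not> p2 dvd int m - 2" "fact n < p2"
      using P by (auto simp: line_primes_def n_eq)
    note H = inertia_at_zero[OF p2 k]
    obtain u where u: "u \<in> {1..n} - {i \<in> {1..n}. x i \<in> M}" using H(4) by blast
    show ?thesis
    proof (rule alt_group_subset[where H = inertia and S = "{i \<in> {1..n}. x i \<in> M}" and a = a and b = b and c = c and u = u])
      show "inertia \<subseteq> G" using inertia_G by blast
    qed (erule (1) trans, rule tri, erule (1) H(2), erule (1) H(1), rule H(3), rule u)
  qed
qed

end

text \<open>Needed before the roots can be labelled, so it argues with integers only. A double root
  is a zero of the Wronskian. Zero is ruled out because t times \<open>line_gamma m\<close> is
  nonzero. At z^2 = -k, with k = \<open>line_kappa m\<close>, squaring removes the odd power of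
  \<open>z\<close> and leaves an equation of integers whose right side is divisible by
  \<open>p2\<close> and whose left side is not.\<close>

lemma line_poly_separable:
  assumes P: "line_primes m p1 p2 p3 r" and t: "line_param m p1 p2 p3 r t" and m: "odd m"
    and z: "poly (line_poly m t) z = 0"
  shows "poly (pderiv (line_poly m t)) z \<noteq> 0"
proof
  assume d: "poly (pderiv (line_poly m t)) z = 0"
  let ?b = "line_beta m" and ?g = "line_gamma m" and ?k = "line_kappa m"
  have m0: "m > 0" using m by (cases m) auto
  have p2: "prime p2" "\<not> p2 dvd 2" "\<not> p2 dvd int m" "\<not> p2 dvd int m + 2" "\<not> p2 dvd int m - 2"
    using P by (auto simp: line_primes_def)
  have sg: "\<not> p2 dvd line_sg m" by (rule not_dvd_line_sg[OF p2(3)])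
  have tp: "p2 dvd t" "t \<noteq> 0" using t p2(1) by (auto simp: line_param_def exactly_dvd_def)
  have "of_nat m * (z ^ (m - 1) * (z\<^sup>2 + of_int ?k)\<^sup>2) = 0"
    using arg_cong[OF line_wronskian[OF m0, of t], of "\<lambda>q. poly q z"] d z
    by (simp add: poly_monom power2_eq_square algebra_simps)
  hence "z = 0 \<or> z\<^sup>2 = - of_int ?k" using m0 by (auto simp: eq_neg_iff_add_eq_0)
  thus False
  proof
    assume "z = 0"
    hence "of_int t * of_int ?g = (0 :: complex)" using z m0 by (simp add: poly_line_poly zero_power)
    hence "?g = 0" using tp(2) by simp
    hence "p2 dvd ?g" by simp
    thus False using p2 sg by (auto simp: line_gamma_def prime_dvd_mult_iff dest: prime_dvd_power)
  next
    assume z2: "z\<^sup>2 = - of_int ?k"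
    have "z ^ m * of_int (?b - ?k) = of_int (t * (?g - ?k))"
      using z unfolding poly_line_poly z2 by (simp add: algebra_simps)
    hence "(z ^ m * of_int (?b - ?k))\<^sup>2 = of_int ((t * (?g - ?k))\<^sup>2)" by simp
    moreover have "(z ^ m * of_int (?b - ?k))\<^sup>2 = (z\<^sup>2) ^ m * of_int ((?b - ?k)\<^sup>2)"
      by (simp add: power_mult_distrib power_mult[symmetric] mult.commute)
    ultimately have "of_int ((- ?k) ^ m * (?b - ?k)\<^sup>2) = (of_int ((t * (?g - ?k))\<^sup>2) :: complex)"
      unfolding z2 by simp
    hence eq: "(- ?k) ^ m * (?b - ?k)\<^sup>2 = (t * (?g - ?k))\<^sup>2" by (simp only: of_int_eq_iff)
    have "p2 dvd (t * (?g - ?k))\<^sup>2" using tp(1) by (simp add: power2_eq_square dvd_mult2)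
    hence "p2 dvd - ?k \<or> p2 dvd ?b - ?k"
      unfolding eq[symmetric] prime_dvd_mult_iff[OF p2(1)] using prime_dvd_power[OF p2(1)] by blast
    moreover have *: "?k = (int m - 2) * (int m + 2) * line_sg m" "?b - ?k = 2 * 2 * (int m + 2) * line_sg m"
      by (simp_all add: line_beta_def line_kappa_def algebra_simps power2_eq_square)
    moreover have "\<not> p2 dvd ?k" unfolding *(1) prime_dvd_mult_iff[OF p2(1)] using p2 sg by blast
    moreover have "\<not> p2 dvd ?b - ?k" unfolding *(2) prime_dvd_mult_iff[OF p2(1)] using p2 sg by blast
    ultimately show False unfolding dvd_minus_iff by blast
  qed
qed

section \<open>From the integer polynomial to its labelled complex roots\<close>

lemma coeff_line:
  "coeff (line_P m - smult t (line_Q m)) i = (if i = m + 2 then 1 else 0) + (if i = m then line_beta m else 0) -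
     t * (if i = 0 then line_gamma m else if i = 2 then 1 else 0)"
  by (auto simp: line_P_def line_Q_def coeff_pCons coeff_monom numeral_2_eq_2 split: nat.splits)

lemma line_monic:
  assumes "m > 0"
  shows "degree (line_P m - smult t (line_Q m)) = m + 2" "lead_coeff (line_P m - smult t (line_Q m)) = 1"
proof -
  let ?f = "line_P m - smult t (line_Q m)"
  have "coeff ?f (m + 2) = 1" unfolding coeff_line using assms by simp
  moreover have "degree ?f \<le> m + 2" by (rule degree_le) (unfold coeff_line, use assms in auto)
  ultimately show deg: "degree ?f = m + 2" using le_degree[of ?f "m + 2"] by simp
  show "lead_coeff ?f = 1" unfolding deg using \<open>coeff ?f (m + 2) = 1\<close> .
qed

lemma complex_roots_line:
  "complex_roots (map_poly of_int (line_P m - smult t (line_Q m))) = {z. poly (line_poly m t) z = 0}"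
proof -
  have "map_poly of_rat (map_poly of_int q) = (map_poly of_int q :: complex poly)" for q :: "int poly"
    by (intro poly_eqI) (simp add: coeff_map_poly)
  thus ?thesis by (simp add: complex_roots_def map_poly_line)
qed

lemma line_galois_group:
  assumes P: "line_primes m p1 p2 p3 r" and t: "line_param m p1 p2 p3 r t" and m: "odd m"
  shows "poly_galois_group (map_poly of_int (line_P m - smult t (line_Q m))) \<cong> alt_group (m + 2)"
proof -
  have m0: "m > 0" using m by (cases m) auto
  let ?p = "line_P m - smult t (line_Q m)"
  let ?f = "line_poly m t"
  define n where "n = m + 2"
  have lc: "lead_coeff ?f = 1" and deg: "degree ?f = n"
    unfolding map_poly_line[symmetric] n_def using line_monic[OF m0, of t] by (simp_all add: degree_map_poly coeff_map_poly)
  obtain as where as: "smult (lead_coeff ?f) (\<Prod>a\<leftarrow>as. [:- a, 1:]) = ?f" "length as = degree ?f"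
    using fundamental_theorem_algebra_factorized by blast
  have f_as: "?f = (\<Prod>a\<leftarrow>as. [:- a, 1:])" using as(1) lc by simp
  have dist: "distinct as"
  proof (rule ccontr)
    assume "\<not> distinct as"
    then obtain us vs ws a where us: "as = us @ [a] @ vs @ [a] @ ws" using not_distinct_decomp by blast
    define L where "L = [:- a, 1:]"
    define g where "g = (\<Prod>a\<leftarrow>us. [:- a, 1:]) * (\<Prod>a\<leftarrow>vs. [:- a, 1:]) * (\<Prod>a\<leftarrow>ws. [:- a, 1:])"
    have g: "?f = L * (L * g)"
      unfolding f_as us g_def L_def
      by (simp only: map_append prod_list.append list.map prod_list.Cons prod_list.Nil mult_1_left mult_1_right mult_ac)
    have "poly L a = 0" by (simp add: L_def)
    hence "poly ?f a = 0" "poly (pderiv ?f) a = 0" unfolding g by (simp_all add: pderiv_mult)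
    thus False using line_poly_separable[OF P t m] by blast
  qed
  \<comment> \<open>The list is indexed from 0, whereas \<open>alt_group\<close> acts on
    \<open>{1..n}\<close>.\<close>
  define x where "x = (\<lambda>i. as ! (i - 1))"
  have bij: "bij_betw (\<lambda>i. i - 1) {1..n} {..<n}"
    by (rule bij_betwI[of _ _ _ Suc]) auto
  have "bij_betw (\<lambda>i. as ! i) {..<n} (set as)"
    using bij_betw_nth[OF dist] as(2) deg by simp
  hence bijx: "bij_betw x {1..n} (set as)"
    using bij_betw_trans[OF bij] by (simp add: x_def o_def)
  have factors: "?f = (\<Prod>i\<in>{1..n}. [:- x i, 1:])"
  proof -
    have "?f = (\<Prod>a\<in>set as. [:- a, 1:])"
      unfolding f_as using prod.distinct_set_conv_list[OF dist] by metis
    also have "\<dots> = (\<Prod>i\<in>{1..n}. [:- x i, 1:])"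
      using prod.reindex_bij_betw[OF bijx, of "\<lambda>a. [:- a, 1:]"] by simp
    finally show ?thesis .
  qed
  have roots: "complex_roots (map_poly of_int ?p) = set as"
    unfolding complex_roots_line f_as by (auto simp: poly_prod_list prod_list_zero_iff)
  interpret indexed_roots "map_poly of_int ?p" n x
  proof
    have "?p \<noteq> 0" using line_monic(2)[OF m0, of t] by auto
    thus "map_poly of_int ?p \<noteq> (0 :: rat poly)"
      using line_monic(2)[OF m0, of t] by (metis coeff_0 coeff_map_poly of_int_0 of_int_1 zero_neq_one)
    show "bij_betw x {1..n} (complex_roots (map_poly of_int ?p))" unfolding roots by (rule bijx)
    fix i assume "i \<in> {1..n}"
    hence "poly ?f (x i) = 0" unfolding factors poly_prod by (intro prod_zero) auto
    thus "algebraic_int (x i)"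
      unfolding algebraic_int_altdef_ipoly map_poly_line[symmetric] using line_monic(2)[OF m0, of t] by blast
  qed
  interpret line_member int_ring n x galois_perms galois_act m t
    by unfold_locales (use m factors n_def in auto)
  show ?thesis
    using poly_galois_group_iso_alt_group[OF G_eq_alt_group[OF P t]] unfolding n_def .
qed

section \<open>Existence of the primes and of the residue class of the parameter\<close>

lemma exactly_dvd_if_cong:
  assumes "prime p" "[a = p] (mod p\<^sup>2)"
  shows "exactly_dvd p a"
proof -
  obtain k where "a = p + p\<^sup>2 * k" using assms(2) by (metis cong_iff_lin cong_sym)
  hence a: "a = p * (1 + p * k)" by (simp add: algebra_simps power2_eq_square)
  have "\<not> p dvd 1 + p * k"
  proof
    assume "p dvd 1 + p * k"
    hence "p dvd (1 + p * k) - p * k" by (rule dvd_diff) simp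
    hence "p dvd 1" by simp
    thus False using assms(1) not_prime_unit by blast
  qed
  thus ?thesis unfolding exactly_dvd_def using a by blast
qed

text \<open>The delicate point is a prime modulo which minus \<open>line_kappa m\<close> is a
  nonzero square. As \<open>line_kappa m\<close> is s k with s = 1 or -1, the choice r = 2k gives
  r^2 + s k = k (4k + s), so any prime factor of \<open>N\<close> = 4k + s will do; it divides
  neither 2 nor \<open>k\<close>, hence none of \<open>m\<close>, \<open>m + 2\<close>,
  \<open>m - 2\<close>.\<close>

lemma line_primes_exist:
  assumes "odd m"
  obtains p1 p2 p3 r where "line_primes m p1 p2 p3 r" "p1 \<noteq> p2" "p1 \<noteq> p3" "p2 \<noteq> p3"
proof -
  define s :: int where "s = (-1) ^ ((m + 1) div 2)"
  define k where "k = int m * ((int m)\<^sup>2 - 4)"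
  define N where "N = 4 * k + s"
  define r where "r = 2 * k"
  have s: "s = 1 \<or> s = -1" unfolding s_def by (cases "even ((m + 1) div 2)") auto
  have m0: "m > 0" using assms by (cases m) auto
  have k_fac: "k = int m * ((int m + 2) * (int m - 2))" by (simp add: k_def algebra_simps power2_eq_square)
  have m2: "int m - 2 \<noteq> 0" using assms by auto
  have "k \<noteq> 0" unfolding k_fac using m0 m2 by simp
  hence N1: "\<bar>N\<bar> \<noteq> 1" using s by (auto simp: N_def)
  then obtain p3 where p3: "prime p3" "p3 dvd N" by (rule prime_factor_int)
  have N0: "N \<noteq> 0" using s by (auto simp: N_def) presburger+
  have unit: "\<not> p3 dvd s" using s p3(1) not_prime_unit[of p3] by auto
  have n2: "\<not> p3 dvd 2"
  proof
    assume "p3 dvd 2"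
    hence "p3 dvd 2 * (2 * k)" by (rule dvd_mult2)
    hence "p3 dvd N - 2 * (2 * k)" using p3(2) by (intro dvd_diff)
    thus False using unit by (simp add: N_def)
  qed
  have nk: "\<not> p3 dvd k"
  proof
    assume "p3 dvd k"
    hence "p3 dvd N - 4 * k" using p3(2) by (intro dvd_diff dvd_mult)
    thus False using unit by (simp add: N_def)
  qed
  have p3': "\<not> p3 dvd int m" "\<not> p3 dvd int m + 2" "\<not> p3 dvd int m - 2"
    using nk unfolding k_fac by (auto intro: dvd_mult dvd_mult2)
  have "line_sg m = s * int m" by (simp add: line_sg_def s_def)
  hence "r\<^sup>2 + line_kappa m = k * N"
    by (simp add: r_def N_def line_kappa_def k_def algebra_simps power2_eq_square)
  hence r1: "p3 dvd r\<^sup>2 + line_kappa m" using p3(2) by simp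
  have r2: "\<not> p3 dvd r" unfolding r_def prime_dvd_mult_iff[OF p3(1)] using n2 nk by blast
  have "\<bar>int m + 2\<bar> \<noteq> 1" by simp
  then obtain p1 where p1: "prime p1" "p1 dvd int m + 2" by (rule prime_factor_int)
  \<comment> \<open>The bound makes \<open>p2\<close> too large to divide 2, \<open>m\<close>,
    \<open>m + 2\<close>, \<open>m - 2\<close> or \<open>N\<close>; the last separates it from
    \<open>p3\<close>.\<close>
  obtain p where p: "prime p" "fact (m + 2) + nat \<bar>N\<bar> + (m + 3) < p" using bigger_prime by blast
  define p2 where "p2 = int p"
  have p2: "prime p2" using p(1) by (simp add: p2_def)
  define F :: int where "F = fact (m + 2)"
  have big: "F + \<bar>N\<bar> + (int m + 3) < p2"
  proof -
    have "int (fact (m + 2) + nat \<bar>N\<bar> + (m + 3)) < int p" using p(2) by (simp only: of_nat_less_iff)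
    thus ?thesis by (simp add: p2_def F_def del: fact_Suc)
  qed
  have f0: "F > 0" unfolding F_def by (rule fact_gt_zero)
  have small: "\<not> p2 dvd a" if "a \<noteq> 0" "\<bar>a\<bar> < p2" for a
    using that dvd_imp_le_int[of a p2] by auto
  have p2': "\<not> p2 dvd 2" "\<not> p2 dvd int m" "\<not> p2 dvd int m + 2" "\<not> p2 dvd int m - 2"
    by (rule small; use big f0 m0 m2 in arith)+
  have "fact (m + 2) < p2" using big unfolding F_def[symmetric] by arith
  hence "line_primes m p1 p2 p3 r"
    unfolding line_primes_def using p1 p2 p3 p2' p3' n2 r1 r2 by (auto simp del: fact_Suc)
  moreover have "p1 \<noteq> p2" "p1 \<noteq> p3" using p1(2) p2'(3) p3'(2) by auto
  moreover have "p2 \<noteq> p3" using p3(2) small[OF N0] big f0 by auto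
  ultimately show ?thesis by (rule that)
qed

text \<open>All three conditions are congruences on \<open>t\<close> modulo coprime squares. The
  third is linear in \<open>t\<close>, and its coefficient \<open>q\<close> is a unit modulo
  \<open>p3\<close> because it is congruent to the difference of \<open>line_gamma m\<close> and
  \<open>line_kappa m\<close>.\<close>

lemma line_param_exists:
  assumes P: "line_primes m p1 p2 p3 r" and ne: "p1 \<noteq> p2" "p1 \<noteq> p3" "p2 \<noteq> p3"
  obtains t0 where "\<And>t. line_param m p1 p2 p3 r (t0 + t * (p1 * p2 * p3)\<^sup>2)"
proof -
  have prime: "prime p1" "prime p2" "prime p3" using P by (auto simp: line_primes_def)
  have cop: "coprime (p1\<^sup>2) (p2\<^sup>2)" "coprime (p1\<^sup>2 * p2\<^sup>2) (p3\<^sup>2)"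
    using primes_coprime[OF prime(1,2) ne(1)] primes_coprime[OF prime(1,3) ne(2)] primes_coprime[OF prime(2,3) ne(3)]
    by auto
  define q where "q = r\<^sup>2 + line_gamma m"
  define a where "a = r ^ m * (r\<^sup>2 + line_beta m)"
  have p3: "\<not> p3 dvd 2" "\<not> p3 dvd int m" "\<not> p3 dvd int m - 2" "p3 dvd r\<^sup>2 + line_kappa m"
    using P by (auto simp: line_primes_def)
  have sg: "\<not> p3 dvd line_sg m" by (rule not_dvd_line_sg[OF p3(2)])
  have "\<not> p3 dvd q"
  proof
    assume "p3 dvd q"
    hence "p3 dvd (r\<^sup>2 + line_kappa m) - q" using p3(4) by (rule dvd_diff[rotated])
    moreover have "(r\<^sup>2 + line_kappa m) - q = 2 * 2 * (int m - 2) * line_sg m"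
      by (simp add: q_def line_gamma_def line_kappa_def algebra_simps power2_eq_square)
    ultimately have "p3 dvd 2 * 2 * (int m - 2) * line_sg m" by simp
    thus False unfolding prime_dvd_mult_iff[OF prime(3)] using p3 sg by blast
  qed
  hence "coprime p3 q" by (rule prime_imp_coprime[OF prime(3)])
  hence "coprime q (p3\<^sup>2)" by (simp add: coprime_commute[of q])
  then obtain u v where uv: "u * q + v * p3\<^sup>2 = 1" using bezout_int[of q "p3\<^sup>2"] by auto
  obtain t1 where t1: "[t1 = p1] (mod p1\<^sup>2)" "[t1 = p2] (mod p2\<^sup>2)"
    using binary_chinese_remainder_int[OF cop(1)] by blast
  \<comment> \<open>With \<open>u\<close> an inverse of \<open>q\<close> modulo \<open>p3^2\<close>,
    this residue makes \<open>a - t0 * q\<close> congruent to \<open>p3\<close>, so it is divisible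
    by \<open>p3\<close> exactly once.\<close>
  obtain t0 where t0: "[t0 = t1] (mod p1\<^sup>2 * p2\<^sup>2)" "[t0 = u * (a - p3)] (mod p3\<^sup>2)"
    using binary_chinese_remainder_int[OF cop(2)] by blast
  have "line_param m p1 p2 p3 r (t0 + t * (p1 * p2 * p3)\<^sup>2)" for t
  proof -
    let ?t = "t0 + t * (p1 * p2 * p3)\<^sup>2"
    have cong: "[?t = t0] (mod d)" if "d dvd (p1 * p2 * p3)\<^sup>2" for d
      using that by (simp add: cong_iff_dvd_diff)
    have "[?t = p1] (mod p1\<^sup>2)" "[?t = p2] (mod p2\<^sup>2)"
      using cong_trans[OF cong cong_trans[OF cong_dvd_modulus[OF t0(1)] t1(1)]]
        cong_trans[OF cong cong_trans[OF cong_dvd_modulus[OF t0(1)] t1(2)]]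
      by (simp_all add: power_mult_distrib)
    moreover have "[a - ?t * q = p3] (mod p3\<^sup>2)"
    proof -
      have "[?t = u * (a - p3)] (mod p3\<^sup>2)"
        using cong_trans[OF cong t0(2)] by (simp add: power_mult_distrib)
      hence "[a - ?t * q = a - u * (a - p3) * q] (mod p3\<^sup>2)"
        by (intro cong_diff cong_mult cong_refl)
      moreover have "u * q = 1 - v * p3\<^sup>2" using uv by simp
      hence "a - u * (a - p3) * q = a - (1 - v * p3\<^sup>2) * (a - p3)" by (simp add: mult_ac)
      hence "a - u * (a - p3) * q = p3 + p3\<^sup>2 * (v * (a - p3))" by (simp add: algebra_simps)
      ultimately show ?thesis by (simp add: cong_def)
    qed
    ultimately show ?thesis
      unfolding line_param_def using prime exactly_dvd_if_cong unfolding a_def q_def by blast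
  qed
  thus ?thesis by (rule that)
qed

theorem theorem1p1:
  fixes n :: nat
  assumes "n \<ge> 3" and "odd n"
  shows "\<exists>P Q :: int poly.
           lead_coeff P = 1 \<and> degree P = n \<and>
           Q \<noteq> 0 \<and> degree Q \<le> n - 1 \<and>
           (\<forall>t :: int. poly_galois_group (map_poly of_int (P - smult t Q)) \<cong> alt_group n)"
proof -
  define m where "m = n - 2"
  have m: "odd m" "m > 0" and n: "n = m + 2" using assms by (auto simp: m_def)
  obtain p1 p2 p3 r where P: "line_primes m p1 p2 p3 r" and ne: "p1 \<noteq> p2" "p1 \<noteq> p3" "p2 \<noteq> p3"
    by (rule line_primes_exist[OF m(1)])
  obtain t0 where t0: "\<And>t. line_param m p1 p2 p3 r (t0 + t * (p1 * p2 * p3)\<^sup>2)"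
    using line_param_exists[OF P ne] by blast
  define d where "d = (p1 * p2 * p3)\<^sup>2"
  \<comment> \<open>The progression \<open>t0 + t * d\<close> is absorbed into the pair:
    \<open>t0\<close> moves into \<open>P\<close> and the modulus \<open>d\<close> scales
    \<open>Q\<close>, so every integer \<open>t\<close> gives an admissible parameter.\<close>
  let ?P = "line_P m - smult t0 (line_Q m)" and ?Q = "smult d (line_Q m)"
  have "d \<noteq> 0" using P by (auto simp: d_def line_primes_def)
  have "lead_coeff ?P = 1" "degree ?P = n" using line_monic[OF m(2)] by (simp_all add: n)
  moreover have "?Q \<noteq> 0" using \<open>d \<noteq> 0\<close> by (simp add: line_Q_def)
  moreover have "degree ?Q \<le> n - 1" using \<open>d \<noteq> 0\<close> m(2) by (simp add: line_Q_def n)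
  moreover have "poly_galois_group (map_poly of_int (?P - smult t ?Q)) \<cong> alt_group n" for t
  proof -
    have "?P - smult t ?Q = line_P m - smult (t0 + t * d) (line_Q m)"
      by (simp add: smult_add_left algebra_simps)
    thus ?thesis using line_galois_group[OF P t0 m(1), of t] by (simp only: n d_def)
  qed
  ultimately show ?thesis by blast
qed

end
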